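(* The structure $(\mathbb Q F^{ch},\top,\cdot,\Delta^{ch},1,\varepsilon^{ch},\{\partial_i\}_{i\ge1})$ is a connected graded locality multi-differential bialgebra, and hence a locality multi-differential Hopf algebra. Explicitly: (a) $(\mathbb Q F^{ch},\top,\cdot,1)$ is a locality algebra and $(\mathbb Q F^{ch},\top,\Delta^{ch},\varepsilon^{ch})$ is a locality coalgebra; (b) for $f\top g$, $\Delta^{ch}(f\cdot g)=\Delta^{ch}(f)\cdot\Delta^{ch}(g)$ (componentwise product of tensors) and $\varepsilon^{ch}(f\cdot g)=\varepsilon^{ch}(f)\varepsilon^{ch}(g)$, with $\Delta^{ch}(1)=1\otimes1$, $\varepsilon^{ch}(1)=1$; (c) with the degree grading $\mathbb Q F^{ch}=\bigoplus_{m\ge0}\mathbb Q F_m$, where $F_0=\{1\}$ and $F_m$ is the set of Chen fractions with $s_1+\dots+s_k=m$, the product respects degrees on $\top$-pairs, $\Delta^{ch}(\mathbb Q F_m\cap U^\top)\subseteq\bigoplus_{p+q=m}(\mathbb Q F_p\cap U^\top)\otimes_\top(\mathbb Q F_q\cap U^\top)$ for every $U\subseteq\mathbb Q F^{ch}$, and $\ker\varepsilon^{ch}=\bigoplus_{m\ge1}\mathbb Q F_m$; (d) there is a linear map $S:\mathbb Q F^{ch}\to\mathbb Q F^{ch}$ with $a\top b\Rightarrow a\top S(b)$ such that $S\star\mathrm{id}=\mathrm{id}\star S=1\cdot\varepsilon^{ch}$, where $\phi\star\psi=\cdot\circ(\phi\otimes\psi)\circ\Delta^{ch}$; (e) the $\partial_i$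 are pairwise commuting locality derivations, and for every $a\in\mathbb Q F^{ch}$ and $i\ge 1$, $\Delta^{ch}\partial_i=(\mathrm{id}\otimes\partial_i+\partial_i\otimes\mathrm{id})\Delta^{ch}$ with $\Delta^{ch}\partial_i(a^\top)\subseteq a^\top\otimes_\top a^\top$.
   Context: Let $\{x_i\}_{i\ge1}$ be variables. For $k\ge1$, distinct $i_1,\dots,i_k\in\mathbb Z_{\ge1}$ and $(s_1,\dots,s_k)\in\mathbb Z_{\ge1}^k$, the Chen fraction is $\Phi^{s_1,\dots,s_k}_{i_1,\dots,i_k}:=\frac{1}{(x_{i_1}+\dots+x_{i_k})^{s_1}(x_{i_2}+\dots+x_{i_k})^{s_2}\cdots x_{i_k}^{s_k}}$. Let $F^{ch}$ be the set of Chen fractions together with the constant $1$, and $\mathbb Q F^{ch}$ its span, in which $F^{ch}$ is a basis; $\cdot$ is function multiplication. Locality relation: for $f,g\in F^{ch}$, $f\top g$ if they involve disjoint sets of variables, and $1\top f$ for all $f$; extended to $\mathbb Q F^{ch}$ by: $\sum a_if_i\top\sum b_jg_j$ (basis expansions) iff $f_i\top g_j$ for all $i,j$. For $U$ a subset (or element $a$), $U^\top=\{x: x\top u\ \forall u\in U\}$; $V\otimes_\top W$ denotes the span of $v\otimes w$ with $v\in V$, $w\in W$, $v\top w$. Locality notions: a locality algebra is a vector space with symmetric relation $\top$ (all $U^\top$ subspaces) and a product defined on $\top$-pairs, bilinear there, associative on pairwise-$\top$ triples (with $(uv)\top w$, $u\top(vw)$), with unit $1$ related to everything. A locality coalgebra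 is such a space with linear $\Delta$ satisfying $\Delta(U^\top)\subseteq U^\top\otimes_\top U^\top$ for all $U$, coassociativity, and a counit. A locality derivation is linear $d$ with $d(x)\top y$, $x\top d(y)$, $d(xy)=d(x)y+xd(y)$ whenever $x\top y$. Let $\partial_i:=-\frac{\partial}{\partial x_i}$, $d_{i,j}:=\partial_i-\partial_j$, and for a Chen fraction with indices $i_1,\dots,i_k$ set $d_{i_1,i_0}:=\partial_{i_1}$. Operators act on tensors factorwise. $\Delta^{ch}$ is the linear map defined by $\Delta^{ch}(1)=1\otimes1$; $\Delta^{ch}(\Phi^{1,\dots,1}_{i_1,\dots,i_k})=\sum_{j=0}^k\Phi^{1,\dots,1}_{i_1,\dots,i_j}\otimes\Phi^{1,\dots,1}_{i_{j+1},\dots,i_k}$ (empty index list meaning $1$); and recursively $\Delta^{ch}(\Phi^{s_1,\dots,s_j+1,\dots,s_k}_{i_1,\dots,i_k})=\frac1{s_j}(\mathrm{id}\otimes d_{i_j,i_{j-1}}+d_{i_j,i_{j-1}}\otimes\mathrm{id})\Delta^{ch}(\Phi^{s_1,\dots,s_k}_{i_1,\dots,i_k})$ (well defined). $\varepsilon^{ch}$ is linear with $\varepsilon^{ch}(1)=1$ and $\varepsilon^{ch}(f)=0$ for Chen fractions $f$. *)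

theory Defs
  imports
    Complex_Main
    "HOL-Library.Poly_Mapping"
    "HOL-Computational_Algebra.Fraction_Field"
begin

section \<open>Vector spaces over the rationals\<close>

class rat_vector = ab_group_add +
  fixes scaleQ :: "rat \<Rightarrow> 'a \<Rightarrow> 'a"  (infixr \<open>*\<^sub>Q\<close> 75)
  assumes scaleQ_add_right: "a *\<^sub>Q (x + y) = a *\<^sub>Q x + a *\<^sub>Q y"
    and scaleQ_add_left: "(a + b) *\<^sub>Q x = a *\<^sub>Q x + b *\<^sub>Q x"
    and scaleQ_scaleQ: "a *\<^sub>Q b *\<^sub>Q x = (a * b) *\<^sub>Q x"
    and scaleQ_one: "1 *\<^sub>Q x = x"

global_interpretation ratvec: vector_space "scaleQ :: rat \<Rightarrow> 'a \<Rightarrow> 'a::rat_vector"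
  by unfold_locales (rule scaleQ_add_right scaleQ_add_left scaleQ_scaleQ scaleQ_one)+

global_interpretation ratvec_pair: vector_space_pair
  "scaleQ :: rat \<Rightarrow> 'a \<Rightarrow> 'a::rat_vector" "scaleQ :: rat \<Rightarrow> 'b \<Rightarrow> 'b::rat_vector"
  by unfold_locales

abbreviation linearQ :: "('a::rat_vector \<Rightarrow> 'b::rat_vector) \<Rightarrow> bool"
  where "linearQ \<equiv> Vector_Spaces.linear scaleQ scaleQ"

lemma linearQI:
  assumes "\<And>x y. f (x + y) = f x + f y" and "\<And>c x. f (c *\<^sub>Q x) = c *\<^sub>Q f x"
  shows "linearQ f"
  using assms by unfold_locales auto

lemma linearQ_add: "linearQ f \<Longrightarrow> f (x + y) = f x + f y"
  by (rule ratvec_pair.linear_add)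

lemma linearQ_scale: "linearQ f \<Longrightarrow> f (c *\<^sub>Q x) = c *\<^sub>Q f x"
  by (rule ratvec_pair.linear_scale)

instantiation rat :: rat_vector
begin

definition scaleQ_rat :: "rat \<Rightarrow> rat \<Rightarrow> rat"
  where "scaleQ_rat = (*)"

instance
  by standard (simp_all add: scaleQ_rat_def algebra_simps)

end

instantiation poly_mapping :: (type, rat_vector) rat_vector
begin

lift_definition scaleQ_poly_mapping :: "rat \<Rightarrow> ('a \<Rightarrow>\<^sub>0 'b) \<Rightarrow> 'a \<Rightarrow>\<^sub>0 'b"
  is "\<lambda>c f x. c *\<^sub>Q f x"
  by (erule rev_finite_subset) auto

instance
  by standard (transfer; simp add: fun_eq_iff scaleQ_add_right scaleQ_add_left scaleQ_scaleQ scaleQ_one)+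

end

instance fract :: ("{idom, ring_char_0}") field_char_0
proof
  have *: "(of_nat n :: 'a fract) = Fract (of_nat n) 1" for n
    by (induction n) (simp_all add: Zero_fract_def One_fract_def add.commute)
  show "inj (of_nat :: nat \<Rightarrow> 'a fract)"
    by (rule injI) (simp add: * eq_fract)
qed

instantiation fract :: ("{idom, ring_char_0}") rat_vector
begin

definition scaleQ_fract :: "rat \<Rightarrow> 'a fract \<Rightarrow> 'a fract"
  where "scaleQ_fract c x = of_rat c * x"

instance
  by standard (simp_all add: scaleQ_fract_def algebra_simps of_rat_add of_rat_mult)

end


section \<open>Tensor products over the rationals\<close>

text \<open>The usual construction: the free vector space on pairs modulo the bilinearity relations.\<close>

definition tensor_relations :: "(('a::rat_vector \<times> 'b::rat_vector) \<Rightarrow>\<^sub>0 rat) set" where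
  "tensor_relations =
     {Poly_Mapping.single (a + a', b) 1 - Poly_Mapping.single (a, b) 1 - Poly_Mapping.single (a', b) 1 | a a' b. True}
   \<union> {Poly_Mapping.single (a, b + b') 1 - Poly_Mapping.single (a, b) 1 - Poly_Mapping.single (a, b') 1 | a b b'. True}
   \<union> {Poly_Mapping.single (c *\<^sub>Q a, b) 1 - Poly_Mapping.single (a, b) c | c a b. True}
   \<union> {Poly_Mapping.single (a, c *\<^sub>Q b) 1 - Poly_Mapping.single (a, b) c | c a b. True}"

definition tensor_rel ::
  "(('a::rat_vector \<times> 'b::rat_vector) \<Rightarrow>\<^sub>0 rat) \<Rightarrow> (('a \<times> 'b) \<Rightarrow>\<^sub>0 rat) \<Rightarrow> bool"
  where "tensor_rel p q \<longleftrightarrow> p - q \<in> ratvec.span tensor_relations"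

lemma tensor_rel_refl: "tensor_rel p p"
  by (simp add: tensor_rel_def ratvec.span_zero)

lemma tensor_rel_add: "tensor_rel p q \<Longrightarrow> tensor_rel p' q' \<Longrightarrow> tensor_rel (p + p') (q + q')"
  unfolding tensor_rel_def by (drule (1) ratvec.span_add) (simp add: algebra_simps)

lemma tensor_rel_scale: "tensor_rel p q \<Longrightarrow> tensor_rel (c *\<^sub>Q p) (c *\<^sub>Q q)"
  unfolding tensor_rel_def
  by (drule ratvec.span_scale[of _ _ c]) (simp add: ratvec.scale_right_diff_distrib)

lemma tensor_rel_sym: "tensor_rel p q \<Longrightarrow> tensor_rel q p"
  unfolding tensor_rel_def by (drule ratvec.span_neg) simp

lemma tensor_rel_trans: "tensor_rel p q \<Longrightarrow> tensor_rel q r \<Longrightarrow> tensor_rel p r"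
  unfolding tensor_rel_def by (drule (1) ratvec.span_add) simp

quotient_type (overloaded) ('a, 'b) tensor =
  "('a::rat_vector \<times> 'b::rat_vector) \<Rightarrow>\<^sub>0 rat" / tensor_rel
proof (rule equivpI)
  show "reflp tensor_rel"
    by (simp add: reflp_def tensor_rel_refl)
  show "symp tensor_rel"
    by (rule sympI) (rule tensor_rel_sym)
  show "transp tensor_rel"
    by (rule transpI) (rule tensor_rel_trans)
qed

instantiation tensor :: (rat_vector, rat_vector) rat_vector
begin

lift_definition zero_tensor :: "('a, 'b) tensor" is 0 .

lift_definition plus_tensor :: "('a, 'b) tensor \<Rightarrow> ('a, 'b) tensor \<Rightarrow> ('a, 'b) tensor"
  is "(+)" by (rule tensor_rel_add)

lift_definition uminus_tensor :: "('a, 'b) tensor \<Rightarrow> ('a, 'b) tensor"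
  is uminus
  by (drule tensor_rel_scale[of _ _ "-1"]) (simp add: ratvec.scale_minus_left)

lift_definition minus_tensor :: "('a, 'b) tensor \<Rightarrow> ('a, 'b) tensor \<Rightarrow> ('a, 'b) tensor"
  is "(-)"
  subgoal for p q p' q'
    using tensor_rel_add[of p q "- p'" "- q'"] tensor_rel_scale[of p' q' "-1"]
    by (simp add: ratvec.scale_minus_left)
  done

lift_definition scaleQ_tensor :: "rat \<Rightarrow> ('a, 'b) tensor \<Rightarrow> ('a, 'b) tensor"
  is scaleQ by (rule tensor_rel_scale)

instance
  by standard
    (transfer; simp add: algebra_simps tensor_rel_refl scaleQ_add_right scaleQ_add_left scaleQ_scaleQ scaleQ_one)+

end

lift_definition pure_tensor :: "'a::rat_vector \<Rightarrow> 'b::rat_vector \<Rightarrow> ('a, 'b) tensor" (infixr \<open>\<otimes>\<close> 75)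
  is "\<lambda>a b. Poly_Mapping.single (a, b) 1" .

definition free_extend :: "('a \<Rightarrow> 'b \<Rightarrow> 'c::rat_vector) \<Rightarrow> (('a \<times> 'b) \<Rightarrow>\<^sub>0 rat) \<Rightarrow> 'c"
  where "free_extend f p = (\<Sum>(a, b) \<in> Poly_Mapping.keys p. Poly_Mapping.lookup p (a, b) *\<^sub>Q f a b)"

text \<open>The linear map out of the tensor product induced by a bilinear map; see
  \<open>tensor_lift_pure\<close> and \<open>linearQ_tensor_lift\<close>. If the argument is not
  bilinear, the value depends on the chosen representative.\<close>

definition tensor_lift ::
  "('a::rat_vector \<Rightarrow> 'b::rat_vector \<Rightarrow> 'c::rat_vector) \<Rightarrow> ('a, 'b) tensor \<Rightarrow> 'c"
  where "tensor_lift f t = free_extend f (rep_tensor t)"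

definition tensor_map ::
  "('a::rat_vector \<Rightarrow> 'c::rat_vector) \<Rightarrow> ('b::rat_vector \<Rightarrow> 'd::rat_vector) \<Rightarrow> ('a, 'b) tensor \<Rightarrow> ('c, 'd) tensor"
  where "tensor_map f g = tensor_lift (\<lambda>a b. f a \<otimes> g b)"

definition tensor_assoc ::
  "(('a::rat_vector, 'b::rat_vector) tensor, 'c::rat_vector) tensor \<Rightarrow> ('a, ('b, 'c) tensor) tensor"
  where "tensor_assoc = tensor_lift (\<lambda>t c. tensor_lift (\<lambda>a b. a \<otimes> (b \<otimes> c)) t)"

definition bilinearQ :: "('a::rat_vector \<Rightarrow> 'b::rat_vector \<Rightarrow> 'c::rat_vector) \<Rightarrow> bool"
  where "bilinearQ f \<longleftrightarrow> (\<forall>b. linearQ (\<lambda>a. f a b)) \<and> (\<forall>a. linearQ (f a))"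

lemma free_extend_superset:
  assumes "finite A" "Poly_Mapping.keys p \<subseteq> A"
  shows "free_extend f p = (\<Sum>(a, b) \<in> A. Poly_Mapping.lookup p (a, b) *\<^sub>Q f a b)"
  unfolding free_extend_def
  by (rule sum.mono_neutral_left) (use assms in \<open>auto simp: in_keys_iff\<close>)

lemma linearQ_free_extend: "linearQ (free_extend f)"
proof (rule linearQI)
  fix p q :: "('a \<times> 'b) \<Rightarrow>\<^sub>0 rat" and c :: rat
  have A: "finite (Poly_Mapping.keys p \<union> Poly_Mapping.keys q)" by simp
  have "Poly_Mapping.keys (p + q) \<subseteq> Poly_Mapping.keys p \<union> Poly_Mapping.keys q" by (rule Poly_Mapping.keys_add)
  then show "free_extend f (p + q) = free_extend f p + free_extend f q"
    by (simp add: free_extend_superset[OF A] lookup_add scaleQ_add_left sum.distrib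
        case_prod_unfold)
  have "Poly_Mapping.keys (c *\<^sub>Q p) \<subseteq> Poly_Mapping.keys p"
    by transfer (auto simp: scaleQ_rat_def)
  moreover have "Poly_Mapping.lookup (c *\<^sub>Q p) x = c * Poly_Mapping.lookup p x" for x
    by transfer (simp add: scaleQ_rat_def)
  ultimately show "free_extend f (c *\<^sub>Q p) = c *\<^sub>Q free_extend f p"
    by (simp add: free_extend_superset[of "Poly_Mapping.keys p"] ratvec.scale_sum_right case_prod_unfold)
qed

lemma free_extend_single: "free_extend f (Poly_Mapping.single (a, b) c) = c *\<^sub>Q f a b"
  by (cases "c = 0") (simp_all add: free_extend_def)

lemma free_extend_relations:
  assumes "bilinearQ f" "p \<in> ratvec.span tensor_relations"
  shows "free_extend f p = 0"
proof -
  have l: "linearQ (\<lambda>a. f a b)" and r: "linearQ (f a)" for a b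
    using assms(1) by (auto simp: bilinearQ_def)
  note d = ratvec_pair.linear_diff[OF linearQ_free_extend]
  have "free_extend f x = 0" if "x \<in> tensor_relations" for x
    using that unfolding tensor_relations_def
    by (auto simp: d free_extend_single scaleQ_one linearQ_add[OF l] linearQ_add[OF r]
        linearQ_scale[OF l] linearQ_scale[OF r])
  then show ?thesis
    using ratvec_pair.linear_eq_0_on_span[OF linearQ_free_extend _ assms(2)] by blast
qed

lemma tensor_lift_abs:
  assumes "bilinearQ f"
  shows "tensor_lift f (abs_tensor p) = free_extend f p"
proof -
  have "tensor_rel (rep_tensor (abs_tensor p)) p"
    by (rule Quotient3_rep_abs[OF Quotient3_tensor]) (rule tensor_rel_refl)
  then have "free_extend f (rep_tensor (abs_tensor p) - p) = 0"
    unfolding tensor_rel_def by (rule free_extend_relations[OF assms])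
  then show ?thesis
    by (simp add: tensor_lift_def ratvec_pair.linear_diff[OF linearQ_free_extend])
qed

lemma tensor_lift_pure: "bilinearQ f \<Longrightarrow> tensor_lift f (a \<otimes> b) = f a b"
  by (simp add: pure_tensor.abs_eq tensor_lift_abs free_extend_single scaleQ_one)

lemma linearQ_tensor_lift:
  assumes "bilinearQ f"
  shows "linearQ (tensor_lift f)"
proof (rule linearQI)
  fix s t :: "('a, 'b) tensor" and c :: rat
  obtain p q where [simp]: "s = abs_tensor p" "t = abs_tensor q"
    by (metis Quotient3_abs_rep[OF Quotient3_tensor])
  show "tensor_lift f (s + t) = tensor_lift f s + tensor_lift f t"
    by (simp add: plus_tensor.abs_eq tensor_lift_abs[OF assms] linearQ_add[OF linearQ_free_extend])
  show "tensor_lift f (c *\<^sub>Q s) = c *\<^sub>Q tensor_lift f s"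
    by (simp add: scaleQ_tensor.abs_eq tensor_lift_abs[OF assms] linearQ_scale[OF linearQ_free_extend])
qed

lemma bilinearQ_pure_tensor: "bilinearQ (\<otimes>)"
proof -
  have *: "tensor_rel p q" if "p - q \<in> tensor_relations"
    for p q :: "('a \<times> 'b) \<Rightarrow>\<^sub>0 rat"
    using that by (simp add: tensor_rel_def ratvec.span_base)
  have sc: "c *\<^sub>Q Poly_Mapping.single x (1::rat) = Poly_Mapping.single x c" for c and x :: "'a \<times> 'b"
    by transfer (auto simp: fun_eq_iff when_def scaleQ_rat_def)
  have "linearQ (\<lambda>a::'a. a \<otimes> b)" for b :: 'b
  proof (rule linearQI)
    show "(x + y) \<otimes> b = x \<otimes> b + y \<otimes> b" for x y :: 'a
      by (transfer, rule *, unfold diff_diff_eq[symmetric] tensor_relations_def, intro UnI1) blast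
    show "(c *\<^sub>Q x) \<otimes> b = c *\<^sub>Q x \<otimes> b" for c and x :: 'a
      by (transfer, rule *, unfold sc tensor_relations_def, rule UnI1, rule UnI2) blast
  qed
  moreover have "linearQ ((\<otimes>) a :: 'b \<Rightarrow> _)" for a :: 'a
  proof (rule linearQI)
    show "a \<otimes> (x + y) = a \<otimes> x + a \<otimes> y" for x y :: 'b
      by (transfer, rule *, unfold diff_diff_eq[symmetric] tensor_relations_def, rule UnI1, rule UnI1, rule UnI2) blast
    show "a \<otimes> (c *\<^sub>Q x) = c *\<^sub>Q a \<otimes> x" for c and x :: 'b
      by (transfer, rule *, unfold sc tensor_relations_def, rule UnI2) blast
  qed
  ultimately show ?thesis
    by (simp add: bilinearQ_def)
qed

lemma bilinearQ_compose:
  assumes "bilinearQ h" "linearQ f" "linearQ g"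
  shows "bilinearQ (\<lambda>a b. h (f a) (g b))"
  unfolding bilinearQ_def
proof (intro conjI allI)
  have l: "linearQ (\<lambda>a. h a b)" and r: "linearQ (h a)" for a b
    using assms(1) by (auto simp: bilinearQ_def)
  show "linearQ (\<lambda>a. h (f a) (g b))" for b
    by (rule linearQI) (simp_all add: linearQ_add[OF assms(2)] linearQ_scale[OF assms(2)] linearQ_add[OF l] linearQ_scale[OF l])
  show "linearQ (\<lambda>b. h (f a) (g b))" for a
    by (rule linearQI) (simp_all add: linearQ_add[OF assms(3)] linearQ_scale[OF assms(3)] linearQ_add[OF r] linearQ_scale[OF r])
qed

lemma tensor_map_pure: "linearQ f \<Longrightarrow> linearQ g \<Longrightarrow> tensor_map f g (a \<otimes> b) = f a \<otimes> g b"
  unfolding tensor_map_def by (rule tensor_lift_pure) (rule bilinearQ_compose[OF bilinearQ_pure_tensor])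

lemma linearQ_tensor_map: "linearQ f \<Longrightarrow> linearQ g \<Longrightarrow> linearQ (tensor_map f g)"
  unfolding tensor_map_def
  by (rule linearQ_tensor_lift) (rule bilinearQ_compose[OF bilinearQ_pure_tensor])

lemma tensor_linear_eq:
  assumes "linearQ f" "linearQ g" "\<And>a b. f (a \<otimes> b) = g (a \<otimes> b)"
  shows "f t = g t"
proof -
  have add: "abs_tensor p + abs_tensor q = abs_tensor (p + q)"
    for p q :: "('a \<times> 'b) \<Rightarrow>\<^sub>0 rat"
    by (simp add: plus_tensor.abs_eq)
  have sc: "Poly_Mapping.single x c = c *\<^sub>Q Poly_Mapping.single x (1::rat)" for c and x :: "'a \<times> 'b"
    by transfer (auto simp: fun_eq_iff when_def scaleQ_rat_def)
  have single: "abs_tensor (Poly_Mapping.single (a, b) c) = c *\<^sub>Q (a \<otimes> b)" for a :: 'a and b :: 'b and c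
    by (subst sc) (simp add: scaleQ_tensor.abs_eq pure_tensor.abs_eq)
  have "f (abs_tensor p) = g (abs_tensor p)" for p
  proof (induction p rule: update_induct)
    case const
    then show ?case
      using ratvec_pair.linear_0[OF assms(1)] ratvec_pair.linear_0[OF assms(2)]
      by (simp add: zero_tensor_def)
  next
    case (update p x c)
    obtain a b where x: "x = (a, b)" by force
    have "Poly_Mapping.update x c p = p + Poly_Mapping.single x c"
      using update(1)
      by (intro poly_mapping_eqI) (auto simp: lookup_update lookup_add lookup_single when_def in_keys_iff)
    then show ?case
      using update(3)
      by (simp add: add[symmetric] x single linearQ_add[OF assms(1)] linearQ_add[OF assms(2)]
          linearQ_scale[OF assms(1)] linearQ_scale[OF assms(2)] assms(3))
  qed
  then show ?thesis
    by (metis Quotient3_abs_rep[OF Quotient3_tensor])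
qed


section \<open>Locality structures\<close>

definition polar :: "('v \<Rightarrow> 'v \<Rightarrow> bool) \<Rightarrow> 'v set \<Rightarrow> 'v set"
  where "polar T U = {x. \<forall>u\<in>U. T x u}"

definition locality_space :: "('v::rat_vector \<Rightarrow> 'v \<Rightarrow> bool) \<Rightarrow> bool"
  where "locality_space T \<longleftrightarrow> symp T \<and> (\<forall>U. ratvec.subspace (polar T U))"

definition locality_tensor ::
  "('v::rat_vector \<Rightarrow> 'v \<Rightarrow> bool) \<Rightarrow> 'v set \<Rightarrow> 'v set \<Rightarrow> ('v, 'v) tensor set"
  where "locality_tensor T V W = ratvec.span {v \<otimes> w | v w. v \<in> V \<and> w \<in> W \<and> T v w}"

text \<open>The product is a total function here, but only its values on \<open>T\<close>-related pairs
  are constrained.\<close>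

definition locality_algebra ::
  "('v::rat_vector \<Rightarrow> 'v \<Rightarrow> bool) \<Rightarrow> ('v \<Rightarrow> 'v \<Rightarrow> 'v) \<Rightarrow> 'v \<Rightarrow> bool"
  where "locality_algebra T m e \<longleftrightarrow>
    locality_space T \<and>
    (\<forall>u v w. T u w \<longrightarrow> T v w \<longrightarrow> m (u + v) w = m u w + m v w) \<and>
    (\<forall>u v w. T w u \<longrightarrow> T w v \<longrightarrow> m w (u + v) = m w u + m w v) \<and>
    (\<forall>c u w. T u w \<longrightarrow> m (c *\<^sub>Q u) w = c *\<^sub>Q m u w \<and> m u (c *\<^sub>Q w) = c *\<^sub>Q m u w) \<and>
    (\<forall>u v w. T u v \<longrightarrow> T v w \<longrightarrow> T u w \<longrightarrow>
       T (m u v) w \<and> T u (m v w) \<and> m (m u v) w = m u (m v w)) \<and>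
    (\<forall>u. T e u \<and> T u e \<and> m e u = u \<and> m u e = u)"

definition locality_coalgebra ::
  "('v::rat_vector \<Rightarrow> 'v \<Rightarrow> bool) \<Rightarrow> ('v \<Rightarrow> ('v, 'v) tensor) \<Rightarrow> ('v \<Rightarrow> rat) \<Rightarrow> bool"
  where "locality_coalgebra T D \<epsilon> \<longleftrightarrow>
    locality_space T \<and> linearQ D \<and> linearQ \<epsilon> \<and>
    (\<forall>U. D ` polar T U \<subseteq> locality_tensor T (polar T U) (polar T U)) \<and>
    (\<forall>u. tensor_assoc (tensor_map D id (D u)) = tensor_map id D (D u)) \<and>
    (\<forall>u. tensor_lift (\<lambda>a b. \<epsilon> a *\<^sub>Q b) (D u) = u \<and> tensor_lift (\<lambda>a b. \<epsilon> b *\<^sub>Q a) (D u) = u)"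

definition locality_derivation ::
  "('v::rat_vector \<Rightarrow> 'v \<Rightarrow> bool) \<Rightarrow> ('v \<Rightarrow> 'v \<Rightarrow> 'v) \<Rightarrow> ('v \<Rightarrow> 'v) \<Rightarrow> bool"
  where "locality_derivation T m d \<longleftrightarrow>
    linearQ d \<and>
    (\<forall>x y. T x y \<longrightarrow> T (d x) y \<and> T x (d y) \<and> d (m x y) = m (d x) y + m x (d y))"

definition subspace_sum :: "'i set \<Rightarrow> ('i \<Rightarrow> 'v::rat_vector set) \<Rightarrow> 'v set"
  where "subspace_sum I G = ratvec.span (\<Union>i\<in>I. G i)"

definition direct_family :: "'i set \<Rightarrow> ('i \<Rightarrow> 'v::rat_vector set) \<Rightarrow> bool"
  where "direct_family I G \<longleftrightarrow>
    (\<forall>J c. finite J \<and> J \<subseteq> I \<and> (\<forall>i\<in>J. c i \<in> G i) \<and> (\<Sum>i\<in>J. c i) = 0 \<longrightarrow> (\<forall>i\<in>J. c i = 0))"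


section \<open>Rational functions in countably many variables\<close>

type_synonym mpoly = "(nat \<Rightarrow>\<^sub>0 nat) \<Rightarrow>\<^sub>0 rat"
type_synonym ratfun = "mpoly fract"

definition xvar :: "nat \<Rightarrow> ratfun"
  where "xvar i = Fract (Poly_Mapping.single (Poly_Mapping.single i 1) 1) 1"

definition mpoly_pderiv :: "nat \<Rightarrow> mpoly \<Rightarrow> mpoly"
  where "mpoly_pderiv i p =
    (\<Sum>m\<in>Poly_Mapping.keys p. Poly_Mapping.single (m - Poly_Mapping.single i 1) (Poly_Mapping.lookup p m * of_nat (Poly_Mapping.lookup m i)))"

lemma mpoly_pderiv_superset:
  assumes "finite A" "Poly_Mapping.keys p \<subseteq> A"
  shows "mpoly_pderiv i p =
    (\<Sum>m\<in>A. Poly_Mapping.single (m - Poly_Mapping.single i 1) (Poly_Mapping.lookup p m * of_nat (Poly_Mapping.lookup m i)))"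
  unfolding mpoly_pderiv_def
  by (rule sum.mono_neutral_left) (use assms in \<open>auto simp: in_keys_iff\<close>)

lemma mpoly_pderiv_add: "mpoly_pderiv i (p + q) = mpoly_pderiv i p + mpoly_pderiv i q"
proof -
  have A: "finite (Poly_Mapping.keys p \<union> Poly_Mapping.keys q)" by simp
  have "Poly_Mapping.keys (p + q) \<subseteq> Poly_Mapping.keys p \<union> Poly_Mapping.keys q" by (rule Poly_Mapping.keys_add)
  then show ?thesis
    by (simp add: mpoly_pderiv_superset[OF A] lookup_add algebra_simps single_add sum.distrib)
qed

lemma mpoly_pderiv_single:
  "mpoly_pderiv i (Poly_Mapping.single m c) =
    Poly_Mapping.single (m - Poly_Mapping.single i 1) (c * of_nat (Poly_Mapping.lookup m i))"
  by (cases "c = 0") (simp_all add: mpoly_pderiv_def)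

lemma monomial_minus_add:
  "Poly_Mapping.lookup m i \<noteq> 0 \<Longrightarrow> m - Poly_Mapping.single i 1 + n = m + n - Poly_Mapping.single i (1::nat)"
  by (rule poly_mapping_eqI) (auto simp: lookup_add lookup_minus lookup_single when_def)

lemma mpoly_pderiv_mult_single:
  "mpoly_pderiv i (Poly_Mapping.single m c * Poly_Mapping.single n d) =
    mpoly_pderiv i (Poly_Mapping.single m c) * Poly_Mapping.single n d +
    Poly_Mapping.single m c * mpoly_pderiv i (Poly_Mapping.single n d)"
proof -
  have "Poly_Mapping.lookup m i \<noteq> 0 \<Longrightarrow> m - Poly_Mapping.single i 1 + n = m + n - Poly_Mapping.single i 1"
    by (rule monomial_minus_add)
  moreover have "Poly_Mapping.lookup n i \<noteq> 0 \<Longrightarrow> m + (n - Poly_Mapping.single i 1) = m + n - Poly_Mapping.single i 1"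
    using monomial_minus_add[of n i m] by (simp add: add.commute)
  ultimately show ?thesis
    by (cases "Poly_Mapping.lookup m i = 0"; cases "Poly_Mapping.lookup n i = 0")
      (simp_all add: mpoly_pderiv_single mult_single lookup_add single_add[symmetric] algebra_simps)
qed

lemma mpoly_induct [case_names single sum]:
  fixes p :: mpoly
  assumes "\<And>m c. P (Poly_Mapping.single m c)" "\<And>p q. P p \<Longrightarrow> P q \<Longrightarrow> P (p + q)"
  shows "P p"
proof (induction p rule: update_induct)
  case const
  show ?case using assms(1)[of 0 0] by simp
next
  case (update p m c)
  have "Poly_Mapping.update m c p = p + Poly_Mapping.single m c"
    using update(1)
    by (intro poly_mapping_eqI) (auto simp: lookup_update lookup_add lookup_single when_def in_keys_iff)
  then show ?case using assms update by simp
qed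

lemma mpoly_pderiv_mult:
  "mpoly_pderiv i (p * q) = mpoly_pderiv i p * q + p * mpoly_pderiv i q"
proof (induction p rule: mpoly_induct)
  case (single m c)
  show ?case
  proof (induction q rule: mpoly_induct)
    case (single n d)
    show ?case by (rule mpoly_pderiv_mult_single)
  next
    case (sum p q)
    then show ?case by (simp add: mpoly_pderiv_add algebra_simps)
  qed
next
  case (sum p q)
  then show ?case by (simp add: mpoly_pderiv_add algebra_simps)
qed

lemma quotient_rule_aux:
  fixes a b c d a' b' c' d' :: "'a::idom"
  assumes "a * d = c * b" and "a' * d + a * d' = c' * b + c * b'"
  shows "(a' * b - a * b') * (d * d) = (c' * d - c * d') * (b * b)"
  using assms by algebra

lift_definition ratfun_pderiv :: "nat \<Rightarrow> ratfun \<Rightarrow> ratfun"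
  is "\<lambda>i (a, b). (mpoly_pderiv i a * b - a * mpoly_pderiv i b, b * b)"
proof -
  fix i :: nat and x y :: "mpoly \<times> mpoly"
  assume A: "fractrel x y"
  obtain a b c d where xy: "x = (a, b)" "y = (c, d)" by (metis surj_pair)
  let ?D = "mpoly_pderiv i"
  have nz: "b \<noteq> 0" "d \<noteq> 0" and eq: "a * d = c * b" using A by (auto simp: xy)
  have "?D (a * d) = ?D (c * b)" using eq by simp
  then have eq': "?D a * d + a * ?D d = ?D c * b + c * ?D b"
    by (simp add: mpoly_pderiv_mult)
  have "(?D a * b - a * ?D b) * (d * d) = (?D c * d - c * ?D d) * (b * b)"
    by (rule quotient_rule_aux[OF eq eq'])
  then show "fractrel (case x of (a, b) \<Rightarrow> (?D a * b - a * ?D b, b * b))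
      (case y of (a, b) \<Rightarrow> (?D a * b - a * ?D b, b * b))"
    using nz by (simp add: xy)
qed

lemma ratfun_pderiv_Fract:
  "b \<noteq> 0 \<Longrightarrow> ratfun_pderiv i (Fract a b) =
    Fract (mpoly_pderiv i a * b - a * mpoly_pderiv i b) (b * b)"
  by (simp add: Fract.abs_eq ratfun_pderiv.abs_eq eq_onp_def)

text \<open>The componentwise product \<open>(a \<otimes> b) \<cdot> (c \<otimes> d) = ac \<otimes> bd\<close>.\<close>

definition ratfun_tensor_mult :: "(ratfun, ratfun) tensor \<Rightarrow> (ratfun, ratfun) tensor \<Rightarrow> (ratfun, ratfun) tensor"
  where "ratfun_tensor_mult s t = tensor_lift (\<lambda>a b. tensor_lift (\<lambda>c d. (a * c) \<otimes> (b * d)) t) s"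


section \<open>Chen fractions\<close>

definition chen_index :: "nat list \<Rightarrow> nat list \<Rightarrow> bool"
  where "chen_index is ss \<longleftrightarrow>
    length ss = length is \<and> distinct is \<and> (\<forall>i\<in>set is. 1 \<le> i) \<and> (\<forall>s\<in>set ss. 1 \<le> s)"

text \<open>List positions start at 0. For the empty lists the value is 1.\<close>

definition chen_fraction :: "nat list \<Rightarrow> nat list \<Rightarrow> ratfun"
  where "chen_fraction is ss =
    1 / (\<Prod>j<length is. (\<Sum>l\<in>{j..<length is}. xvar (is ! l)) ^ (ss ! j))"

definition chen_fractions :: "ratfun set"
  where "chen_fractions = insert 1 {chen_fraction is ss | is ss. is \<noteq> [] \<and> chen_index is ss}"

typedef chen = "ratvec.span chen_fractions" morphisms ratfun_of chen_of
  using ratvec.span_zero by blast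

setup_lifting type_definition_chen

instantiation chen :: rat_vector
begin

lift_definition zero_chen :: chen is 0
  by (rule ratvec.span_zero)
lift_definition plus_chen :: "chen \<Rightarrow> chen \<Rightarrow> chen" is "(+)"
  by (rule ratvec.span_add)
lift_definition uminus_chen :: "chen \<Rightarrow> chen" is uminus
  by (rule ratvec.span_neg)
lift_definition minus_chen :: "chen \<Rightarrow> chen \<Rightarrow> chen" is "(-)"
  by (rule ratvec.span_diff)
lift_definition scaleQ_chen :: "rat \<Rightarrow> chen \<Rightarrow> chen" is scaleQ
  by (rule ratvec.span_scale)

instance
  by standard
    (transfer; simp add: algebra_simps scaleQ_add_right scaleQ_add_left scaleQ_scaleQ scaleQ_one)+

end

definition chen_one :: chen
  where "chen_one = chen_of 1"

definition Phi :: "nat list \<Rightarrow> nat list \<Rightarrow> chen"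
  where "Phi is ss = chen_of (chen_fraction is ss)"

abbreviation Phi1 :: "nat list \<Rightarrow> chen"
  where "Phi1 is \<equiv> Phi is (replicate (length is) 1)"

definition chen_basis :: "chen set"
  where "chen_basis = insert chen_one {Phi is ss | is ss. is \<noteq> [] \<and> chen_index is ss}"

text \<open>Values are meaningful where the product of rational functions lies again in the span of
  the Chen fractions.\<close>

definition chen_mult :: "chen \<Rightarrow> chen \<Rightarrow> chen"
  where "chen_mult f g = chen_of (ratfun_of f * ratfun_of g)"

text \<open>The operator \<open>- \<partial>/\<partial>x\<^sub>i\<close>.\<close>

definition chen_pd :: "nat \<Rightarrow> chen \<Rightarrow> chen"
  where "chen_pd i f = chen_of (- ratfun_pderiv i (ratfun_of f))"

definition chen_basis_loc :: "chen \<Rightarrow> chen \<Rightarrow> bool"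
  where "chen_basis_loc f g \<longleftrightarrow>
    f = chen_one \<or> g = chen_one \<or>
    (\<exists>is ss js ts. chen_index is ss \<and> chen_index js ts \<and>
       f = Phi is ss \<and> g = Phi js ts \<and> set is \<inter> set js = {})"

definition chen_loc :: "chen \<Rightarrow> chen \<Rightarrow> bool"
  where "chen_loc u v \<longleftrightarrow>
    (\<forall>f\<in>chen_basis. \<forall>g\<in>chen_basis.
       ratvec.representation chen_basis u f \<noteq> 0 \<longrightarrow> ratvec.representation chen_basis v g \<noteq> 0 \<longrightarrow>
       chen_basis_loc f g)"

definition chen_counit :: "chen \<Rightarrow> rat"
  where "chen_counit u = ratvec.representation chen_basis u chen_one"

definition chen_d :: "nat list \<Rightarrow> nat \<Rightarrow> chen \<Rightarrow> chen"
  where "chen_d is j f =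
    (if j = 0 then chen_pd (is ! 0) f else chen_pd (is ! j) f - chen_pd (is ! (j - 1)) f)"

definition coderiv :: "('v::rat_vector \<Rightarrow> 'v) \<Rightarrow> ('v, 'v) tensor \<Rightarrow> ('v, 'v) tensor"
  where "coderiv d t = tensor_map id d t + tensor_map d id t"

definition is_chen_coproduct :: "(chen \<Rightarrow> (chen, chen) tensor) \<Rightarrow> bool"
  where "is_chen_coproduct D \<longleftrightarrow>
    linearQ D \<and>
    D chen_one = chen_one \<otimes> chen_one \<and>
    (\<forall>is. is \<noteq> [] \<and> chen_index is (replicate (length is) 1) \<longrightarrow>
       D (Phi1 is) = (\<Sum>j\<le>length is. Phi1 (take j is) \<otimes> Phi1 (drop j is))) \<and>
    (\<forall>is ss j. chen_index is ss \<and> j < length is \<longrightarrow>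
       D (Phi is (ss[j := ss ! j + 1])) = (1 / of_nat (ss ! j)) *\<^sub>Q coderiv (chen_d is j) (D (Phi is ss)))"

definition chen_coproduct :: "chen \<Rightarrow> (chen, chen) tensor"
  where "chen_coproduct = (THE D. is_chen_coproduct D)"

definition chen_degree_part :: "nat \<Rightarrow> chen set"
  where "chen_degree_part m = ratvec.span
    (if m = 0 then {chen_one}
     else {Phi is ss | is ss. is \<noteq> [] \<and> chen_index is ss \<and> sum_list ss = m})"

text \<open>Tensors of Chen fractions can be multiplied componentwise only inside the tensor square of
  the field of all rational functions, since the span of the Chen fractions is not closed
  under products. The embedding below is injective.\<close>

definition chen_tensor_embed :: "(chen, chen) tensor \<Rightarrow> (ratfun, ratfun) tensor"
  where "chen_tensor_embed = tensor_map ratfun_of ratfun_of"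

lemma linearQ_ratfun_of: "linearQ ratfun_of"
  by (rule linearQI) (simp_all add: plus_chen.rep_eq scaleQ_chen.rep_eq)

lemma inj_chen_tensor_embed: "inj chen_tensor_embed"
proof -
  have "inj ratfun_of"
    by (simp add: inj_on_def ratfun_of_inject)
  then obtain g where g: "linearQ g" "g \<circ> ratfun_of = id"
    using ratvec_pair.linear_injective_left_inverse[OF linearQ_ratfun_of] by auto
  have "tensor_map g g (tensor_map ratfun_of ratfun_of t) = t" for t
  proof -
    have "linearQ (\<lambda>t. tensor_map g g (tensor_map ratfun_of ratfun_of t))"
      using Vector_Spaces.linear_compose[OF linearQ_tensor_map[OF linearQ_ratfun_of linearQ_ratfun_of]
          linearQ_tensor_map[OF g(1) g(1)]] by (simp add: o_def)
    moreover have "tensor_map g g (tensor_map ratfun_of ratfun_of (a \<otimes> b)) = a \<otimes> b" for a b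
      using g by (simp add: tensor_map_pure linearQ_ratfun_of pointfree_idE)
    ultimately show ?thesis
      using tensor_linear_eq[OF _ ratvec.linear_ident] by blast
  qed
  then show ?thesis
    unfolding chen_tensor_embed_def by (rule inj_on_inverseI)
qed

text \<open>For the same reason the convolution product takes values in the rational functions.\<close>

definition chen_convolution :: "(chen \<Rightarrow> chen) \<Rightarrow> (chen \<Rightarrow> chen) \<Rightarrow> chen \<Rightarrow> ratfun"
  where "chen_convolution \<phi> \<psi> a =
    tensor_lift (*) (chen_tensor_embed (tensor_map \<phi> \<psi> (chen_coproduct a)))"

end

theory Submission
  imports Defs
begin

text \<open>
  Linear independence of the Chen fractions follows by evaluating at positive reals and reading off
  the most singular part as one variable tends to \<open>0\<close>. Since
  \<open>d\<^sub>j \<Phi>(s) = s\<^sub>j \<Phi>(s + e\<^sub>j)\<close>, every Chen fraction arises from one with all exponents \<open>1\<close> by applying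
  the commuting operators \<open>\<partial>\<^sub>i\<close>; hence a linear map commuting with these operators is determined by its
  values on the \<open>\<Phi>\<close> with exponents \<open>1\<close>, and conversely values killed by the \<open>\<partial>\<^sub>i\<close> of foreign variables
  always extend. This yields the coproduct and the antipode \<open>\<Phi>(i\<^sub>1,\<dots>,i\<^sub>k) \<mapsto> (-1)\<^sup>k \<Phi>(i\<^sub>k,\<dots>,i\<^sub>1)\<close>, and
  reduces all identities to exponents \<open>1\<close>, where the product is the shuffle product and the coproduct is
  deconcatenation.
\<close>

section \<open>Linear maps\<close>

text \<open>The obstacle is that the product is only partial: the span of the Chen fractions is not
  closed under multiplication. Products are therefore computed in the field of rational functions,
  and multiplicativity of the coproduct and the convolution identities are verified there or in its
  tensor square. The differences of derivations come from the shape of the denominators: the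
  variable with index \<open>is ! p\<close> occurs exactly in the factors at positions up to
  \<open>p\<close>, so subtracting neighbouring derivatives isolates the effect on a single factor.
  Prescribed values extend for the converse reason: the differences telescope back to a single
  derivation, and the vanishing of foreign derivatives is the only further constraint on
  \<open>Phi1 is\<close>. Locality turns into disjointness of sets of variables. A polar set is then
  spanned by the Chen fractions in the complementary variables, so locality amounts to introducing
  no new variables and, for the coproduct, to sharing the old ones between the two tensor factors
  without overlap.\<close>

lemma linearQ_zero: "linearQ f \<Longrightarrow> f 0 = 0"
  by (rule ratvec_pair.linear_0)

lemma linearQ_sum: "linearQ f \<Longrightarrow> f (sum g A) = (\<Sum>x\<in>A. f (g x))"
  by (rule ratvec_pair.linear_sum)

lemma linearQ_diff: "linearQ f \<Longrightarrow> f (x - y) = f x - f y"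
  by (rule ratvec_pair.linear_diff)

lemma linearQ_comp: "linearQ f \<Longrightarrow> linearQ g \<Longrightarrow> linearQ (\<lambda>x. g (f x))"
  by (rule linearQI) (simp_all add: linearQ_add linearQ_scale)

lemma linearQ_plus: "linearQ f \<Longrightarrow> linearQ g \<Longrightarrow> linearQ (\<lambda>x. f x + g x)"
  by (rule linearQI) (simp_all add: linearQ_add linearQ_scale scaleQ_add_right)

lemma linearQ_minus: "linearQ f \<Longrightarrow> linearQ g \<Longrightarrow> linearQ (\<lambda>x. f x - g x)"
  by (rule linearQI) (simp_all add: linearQ_add linearQ_scale ratvec.scale_right_diff_distrib)

lemma linearQ_id: "linearQ id"
  by (rule linearQI) simp_all

lemma linearQ_funpow: "linearQ (f :: 'v::rat_vector \<Rightarrow> 'v) \<Longrightarrow> linearQ (f ^^ n)"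
proof (induction n)
  case 0
  show ?case by (rule linearQI) simp_all
next
  case (Suc n)
  then show ?case using linearQ_comp[of "f ^^ n" f] by (simp add: comp_def)
qed

lemma linearQ_scaleQ: "linearQ (\<lambda>x. c *\<^sub>Q x)"
  by (rule linearQI) (simp_all add: scaleQ_add_right scaleQ_scaleQ mult.commute)

lemma bilinearQI:
  assumes "\<And>b. linearQ (\<lambda>a. f a b)" and "\<And>a. linearQ (f a)"
  shows "bilinearQ f"
  using assms by (simp add: bilinearQ_def)

lemma bilinearQ_left: "bilinearQ f \<Longrightarrow> linearQ (\<lambda>a. f a b)"
  by (simp add: bilinearQ_def)

lemma bilinearQ_right: "bilinearQ f \<Longrightarrow> linearQ (f a)"
  by (simp add: bilinearQ_def)

lemmas linearQ_pure_left = bilinearQ_left[OF bilinearQ_pure_tensor]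
lemmas linearQ_pure_right = bilinearQ_right[OF bilinearQ_pure_tensor]

lemma linearQ_span_induct:
  assumes "linearQ f" "x \<in> ratvec.span S" "ratvec.subspace W" "\<And>y. y \<in> S \<Longrightarrow> f y \<in> W"
  shows "f x \<in> W"
proof -
  have "ratvec.subspace {x. f x \<in> W}"
    using assms(1,3)
    by (auto simp: ratvec.subspace_def linearQ_zero linearQ_add linearQ_scale)
  then show ?thesis
    using ratvec.span_minimal[of S "{x. f x \<in> W}"] assms(2,4) by blast
qed

lemma linearQ_span_eq:
  assumes "linearQ f" "linearQ g" "x \<in> ratvec.span S" "\<And>y. y \<in> S \<Longrightarrow> f y = g y"
  shows "f x = g x"
proof -
  have "f x - g x \<in> {0}"
    by (rule linearQ_span_induct[OF linearQ_minus[OF assms(1,2)] assms(3)])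
      (simp_all add: assms(4) ratvec.subspace_single_0)
  then show ?thesis by simp
qed

lemma bilinearQ_span_eq:
  assumes "bilinearQ f" "bilinearQ g" "x \<in> ratvec.span S" "y \<in> ratvec.span R"
    and "\<And>s r. s \<in> S \<Longrightarrow> r \<in> R \<Longrightarrow> f s r = g s r"
  shows "f x y = g x y"
proof -
  have "f s y = g s y" if "s \<in> S" for s
    by (rule linearQ_span_eq[OF _ _ assms(4)])
      (simp_all add: assms bilinearQ_right that)
  then show ?thesis
    using linearQ_span_eq[OF bilinearQ_left[OF assms(1)] bilinearQ_left[OF assms(2)] assms(3)] by blast
qed

text \<open>Applying the projection \<open>\<pi> i\<close> to a vanishing sum leaves only its
  component in \<open>G i\<close>. Directness of the degree grading and of the bigrading of tensors
  is obtained this way.\<close>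

lemma direct_family_projections:
  fixes \<pi> :: "'i \<Rightarrow> 'v::rat_vector \<Rightarrow> 'v"
  assumes "\<And>i. i \<in> I \<Longrightarrow> linearQ (\<pi> i)"
    and "\<And>i x. i \<in> I \<Longrightarrow> x \<in> G i \<Longrightarrow> \<pi> i x = x"
    and "\<And>i j x. i \<in> I \<Longrightarrow> j \<in> I \<Longrightarrow> i \<noteq> j \<Longrightarrow> x \<in> G j \<Longrightarrow> \<pi> i x = 0"
  shows "direct_family I G"
  unfolding direct_family_def
proof (intro allI impI ballI, elim conjE)
  fix J c i
  assume J: "finite J" "J \<subseteq> I" "\<forall>i\<in>J. c i \<in> G i" "sum c J = 0" and i: "i \<in> J"
  have "i \<in> I" using i J by blast
  have "0 = \<pi> i (sum c J)"
    using linearQ_zero[OF assms(1)[OF \<open>i \<in> I\<close>]] J(4) by simp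
  also have "\<dots> = (\<Sum>j\<in>J. \<pi> i (c j))"
    by (rule linearQ_sum) (rule assms(1)[OF \<open>i \<in> I\<close>])
  also have "\<dots> = (\<Sum>j\<in>J. if j = i then c i else 0)"
    using J assms(2,3) \<open>i \<in> I\<close> by (intro sum.cong) (auto simp: subset_iff)
  also have "\<dots> = c i"
    using J(1) i by simp
  finally show "c i = 0" by simp
qed


section \<open>Derivations on rational functions\<close>

lemma scaleQ_ratfun: "c *\<^sub>Q (f::ratfun) = of_rat c * f"
  by (rule scaleQ_fract_def)

lemma bilinearQ_ratfun_times: "bilinearQ ((*) :: ratfun \<Rightarrow> ratfun \<Rightarrow> ratfun)"
  by (intro bilinearQI linearQI) (simp_all add: scaleQ_ratfun algebra_simps)

lemma mpoly_pderiv_commute: "mpoly_pderiv i (mpoly_pderiv j p) = mpoly_pderiv j (mpoly_pderiv i p)"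
proof (induction p rule: mpoly_induct)
  case (single m c)
  show ?case
  proof (cases "i = j")
    case False
    have "m - Poly_Mapping.single j 1 - Poly_Mapping.single i 1 = m - Poly_Mapping.single i 1 - Poly_Mapping.single j (1::nat)"
      by (rule poly_mapping_eqI) (simp add: lookup_minus)
    then show ?thesis
      using False by (simp add: mpoly_pderiv_single lookup_minus lookup_single mult_ac)
  qed simp
qed (simp add: mpoly_pderiv_add)

lemma ratfun_pderiv_add: "ratfun_pderiv i (f + g) = ratfun_pderiv i f + ratfun_pderiv i g"
proof -
  obtain a b where f: "f = Fract a b" "b \<noteq> 0" by (cases f)
  obtain c d where g: "g = Fract c d" "d \<noteq> 0" by (cases g)
  show ?thesis
    using f(2) g(2)
    by (simp add: f(1) g(1) ratfun_pderiv_Fract mpoly_pderiv_add mpoly_pderiv_mult eq_fract algebra_simps)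
qed

lemma ratfun_pderiv_mult: "ratfun_pderiv i (f * g) = ratfun_pderiv i f * g + f * ratfun_pderiv i g"
proof -
  obtain a b where f: "f = Fract a b" "b \<noteq> 0" by (cases f)
  obtain c d where g: "g = Fract c d" "d \<noteq> 0" by (cases g)
  show ?thesis
    using f(2) g(2)
    by (simp add: f(1) g(1) ratfun_pderiv_Fract mpoly_pderiv_add mpoly_pderiv_mult eq_fract algebra_simps)
qed

lemma ratfun_pderiv_one [simp]: "ratfun_pderiv i 1 = 0"
  using ratfun_pderiv_mult[of i 1 1] by simp

lemma ratfun_pderiv_zero [simp]: "ratfun_pderiv i 0 = 0"
  using ratfun_pderiv_add[of i 0 0] by simp

lemma ratfun_pderiv_minus: "ratfun_pderiv i (- f) = - ratfun_pderiv i f"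
  using ratfun_pderiv_add[of i f "- f"] by (simp add: add_eq_0_iff)

lemma ratfun_pderiv_of_nat [simp]: "ratfun_pderiv i (of_nat n) = 0"
  by (induction n) (simp_all add: ratfun_pderiv_add)

lemma ratfun_pderiv_of_int [simp]: "ratfun_pderiv i (of_int n) = 0"
  by (cases n rule: int_cases2) (simp_all add: ratfun_pderiv_minus)

lemma ratfun_pderiv_of_rat [simp]: "ratfun_pderiv i (of_rat c) = 0"
proof (cases c)
  case (Fract a b)
  have "(of_rat c :: ratfun) * of_int b = of_int a"
    using Fract by (simp add: of_rat_rat)
  then have "ratfun_pderiv i (of_rat c * of_int b) = 0" by simp
  then show ?thesis using Fract by (simp add: ratfun_pderiv_mult)
qed

lemma linearQ_ratfun_pderiv: "linearQ (ratfun_pderiv i)"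
  by (rule linearQI) (simp_all add: ratfun_pderiv_add ratfun_pderiv_mult scaleQ_ratfun)

lemma ratfun_pderiv_Fract_one: "ratfun_pderiv i (Fract p 1) = Fract (mpoly_pderiv i p) 1"
proof -
  have "mpoly_pderiv i 1 = 0"
    using mpoly_pderiv_mult[of i 1 1] by simp
  then show ?thesis by (simp add: ratfun_pderiv_Fract)
qed

text \<open>With \<open>f\<close> a quotient of polynomials \<open>A\<close> and \<open>B\<close>,
  the mixed derivatives agree on \<open>A = f * B\<close> and on \<open>B\<close>. In the expansion
  of \<open>A\<close> by the product rule all remaining cross terms are symmetric in
  \<open>i\<close> and \<open>j\<close>, which leaves the claim multiplied by
  \<open>B\<close>.\<close>

lemma ratfun_pderiv_commute:
  "ratfun_pderiv i (ratfun_pderiv j f) = ratfun_pderiv j (ratfun_pderiv i f)"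
proof -
  obtain a b where f: "f = Fract a b" "b \<noteq> 0" by (cases f)
  define A B where "A = Fract a 1" and "B = Fract b 1"
  have B: "B \<noteq> 0" using f(2) by (simp add: B_def Zero_fract_def eq_fract)
  have A: "A = f * B" by (simp add: f A_def B_def eq_fract)
  have "ratfun_pderiv i (ratfun_pderiv j A) = ratfun_pderiv j (ratfun_pderiv i A)"
    "ratfun_pderiv i (ratfun_pderiv j B) = ratfun_pderiv j (ratfun_pderiv i B)"
    by (simp_all add: A_def B_def ratfun_pderiv_Fract_one mpoly_pderiv_commute)
  then have "ratfun_pderiv i (ratfun_pderiv j f) * B = ratfun_pderiv j (ratfun_pderiv i f) * B"
    unfolding A by (simp add: ratfun_pderiv_mult ratfun_pderiv_add algebra_simps)
  then show ?thesis using B by simp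
qed

lemma ratfun_pderiv_xvar: "ratfun_pderiv i (xvar k) = (if i = k then 1 else 0)"
proof -
  have "ratfun_pderiv i (xvar k) =
      Fract (Poly_Mapping.single (Poly_Mapping.single k 1 - Poly_Mapping.single i 1) (if i = k then 1 else 0)) 1"
    unfolding xvar_def ratfun_pderiv_Fract_one mpoly_pderiv_single
    by (auto simp: lookup_single)
  then show ?thesis
    by (auto simp: One_fract_def Zero_fract_def one_poly_mapping_def)
qed

lemma ratfun_pderiv_inverse_power:
  assumes "f \<noteq> 0"
  shows "ratfun_pderiv i (1 / f ^ n) = - (of_nat n * ratfun_pderiv i f / f ^ Suc n)"
proof (induction n)
  case (Suc n)
  \<comment> \<open>Differentiating this equation yields the derivative of the inverse.\<close>
  have "1 = f * (1 / f)" using assms by simp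
  then have "ratfun_pderiv i f * (1 / f) + f * ratfun_pderiv i (1 / f) = 0"
    by (metis ratfun_pderiv_one ratfun_pderiv_mult)
  then have "ratfun_pderiv i (1 / f) = - ratfun_pderiv i f / f ^ 2"
    using assms by (simp add: field_simps power2_eq_square add_eq_0_iff)
  moreover have "1 / f ^ Suc n = (1 / f ^ n) * (1 / f)" by simp
  ultimately have "ratfun_pderiv i (1 / f ^ Suc n) =
      - (of_nat n * ratfun_pderiv i f / f ^ Suc n) * (1 / f) + (1 / f ^ n) * (- ratfun_pderiv i f / f ^ 2)"
    using Suc by (simp only: ratfun_pderiv_mult)
  also have "\<dots> = - (of_nat (Suc n) * ratfun_pderiv i f / f ^ Suc (Suc n))"
    using assms by (simp add: field_simps power2_eq_square)
  finally show ?case .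
qed simp

section \<open>Evaluation of rational functions\<close>

definition monomial_value :: "(nat \<Rightarrow> real) \<Rightarrow> (nat \<Rightarrow>\<^sub>0 nat) \<Rightarrow> real"
  where "monomial_value \<rho> m = (\<Prod>i\<in>Poly_Mapping.keys m. \<rho> i ^ Poly_Mapping.lookup m i)"

definition mpoly_value :: "(nat \<Rightarrow> real) \<Rightarrow> mpoly \<Rightarrow> real"
  where "mpoly_value \<rho> p =
    (\<Sum>m\<in>Poly_Mapping.keys p. of_rat (Poly_Mapping.lookup p m) * monomial_value \<rho> m)"

lemma monomial_value_add: "monomial_value \<rho> (m + n) = monomial_value \<rho> m * monomial_value \<rho> n"
proof -
  have *: "monomial_value \<rho> k =
      (\<Prod>i\<in>Poly_Mapping.keys m \<union> Poly_Mapping.keys n. \<rho> i ^ Poly_Mapping.lookup k i)"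
    if "Poly_Mapping.keys k \<subseteq> Poly_Mapping.keys m \<union> Poly_Mapping.keys n" for k
    unfolding monomial_value_def
    by (rule prod.mono_neutral_left) (use that in \<open>auto simp: in_keys_iff\<close>)
  show ?thesis
    using *[of "m + n"] *[of m] *[of n] Poly_Mapping.keys_add[of m n]
    by (simp add: lookup_add power_add prod.distrib)
qed

lemma mpoly_value_superset:
  assumes "finite A" "Poly_Mapping.keys p \<subseteq> A"
  shows "mpoly_value \<rho> p = (\<Sum>m\<in>A. of_rat (Poly_Mapping.lookup p m) * monomial_value \<rho> m)"
  unfolding mpoly_value_def
  by (rule sum.mono_neutral_left) (use assms in \<open>auto simp: in_keys_iff\<close>)

lemma mpoly_value_add: "mpoly_value \<rho> (p + q) = mpoly_value \<rho> p + mpoly_value \<rho> q"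
proof -
  have A: "finite (Poly_Mapping.keys p \<union> Poly_Mapping.keys q)" by simp
  have "Poly_Mapping.keys (p + q) \<subseteq> Poly_Mapping.keys p \<union> Poly_Mapping.keys q" by (rule Poly_Mapping.keys_add)
  then show ?thesis
    by (simp add: mpoly_value_superset[OF A] lookup_add of_rat_add algebra_simps sum.distrib)
qed

lemma mpoly_value_single:
  "mpoly_value \<rho> (Poly_Mapping.single m c) = of_rat c * monomial_value \<rho> m"
  by (cases "c = 0") (simp_all add: mpoly_value_def)

lemma mpoly_value_mult: "mpoly_value \<rho> (p * q) = mpoly_value \<rho> p * mpoly_value \<rho> q"
proof (induction p rule: mpoly_induct)
  case (single m c)
  show ?case
    by (induction q rule: mpoly_induct)
      (simp_all add: mult_single mpoly_value_single monomial_value_add of_rat_mult mpoly_value_add algebra_simps)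
qed (simp add: mpoly_value_add algebra_simps)

lemma mpoly_value_zero: "mpoly_value \<rho> 0 = 0"
  by (simp add: mpoly_value_def)

lemma mpoly_value_one: "mpoly_value \<rho> 1 = 1"
  using mpoly_value_single[of \<rho> 0 1] by (simp add: monomial_value_def)

text \<open>A relation and not a function: a value exists only if some representative has a
  nonvanishing denominator at \<rho>. All such representatives give the same value by
  \<open>ratfun_value_unique\<close>.\<close>

definition ratfun_value :: "(nat \<Rightarrow> real) \<Rightarrow> ratfun \<Rightarrow> real \<Rightarrow> bool"
  where "ratfun_value \<rho> f v \<longleftrightarrow>
    (\<exists>a b. f = Fract a b \<and> mpoly_value \<rho> b \<noteq> 0 \<and> v = mpoly_value \<rho> a / mpoly_value \<rho> b)"

lemma ratfun_valueE:
  assumes "ratfun_value \<rho> f v"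
  obtains a b where "f = Fract a b" "b \<noteq> 0" "mpoly_value \<rho> b \<noteq> 0"
    "v = mpoly_value \<rho> a / mpoly_value \<rho> b"
  using assms unfolding ratfun_value_def by (metis mpoly_value_zero)

lemma ratfun_valueI:
  "f = Fract a b \<Longrightarrow> mpoly_value \<rho> b \<noteq> 0 \<Longrightarrow> v = mpoly_value \<rho> a / mpoly_value \<rho> b \<Longrightarrow> ratfun_value \<rho> f v"
  unfolding ratfun_value_def by blast

lemma ratfun_value_unique:
  assumes "ratfun_value \<rho> f v" "ratfun_value \<rho> f w"
  shows "v = w"
proof -
  obtain a b where f: "f = Fract a b" "b \<noteq> 0" "mpoly_value \<rho> b \<noteq> 0"
    "v = mpoly_value \<rho> a / mpoly_value \<rho> b" by (rule ratfun_valueE[OF assms(1)])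
  obtain c d where g: "f = Fract c d" "d \<noteq> 0" "mpoly_value \<rho> d \<noteq> 0"
    "w = mpoly_value \<rho> c / mpoly_value \<rho> d" by (rule ratfun_valueE[OF assms(2)])
  have "a * d = c * b"
    using f(1,2) g(1,2) by (simp add: eq_fract)
  then have "mpoly_value \<rho> a * mpoly_value \<rho> d = mpoly_value \<rho> c * mpoly_value \<rho> b"
    by (metis mpoly_value_mult)
  then show ?thesis unfolding f(4) g(4) using f(3) g(3) by (simp add: frac_eq_eq)
qed

lemma ratfun_value_add:
  assumes "ratfun_value \<rho> f v" "ratfun_value \<rho> g w"
  shows "ratfun_value \<rho> (f + g) (v + w)"
proof -
  obtain a b where f: "f = Fract a b" "b \<noteq> 0" "mpoly_value \<rho> b \<noteq> 0"
    "v = mpoly_value \<rho> a / mpoly_value \<rho> b" by (rule ratfun_valueE[OF assms(1)])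
  obtain c d where g: "g = Fract c d" "d \<noteq> 0" "mpoly_value \<rho> d \<noteq> 0"
    "w = mpoly_value \<rho> c / mpoly_value \<rho> d" by (rule ratfun_valueE[OF assms(2)])
  show ?thesis
    by (rule ratfun_valueI[of _ "a * d + c * b" "b * d"])
      (use f g in \<open>simp_all add: mpoly_value_mult mpoly_value_add add_frac_eq\<close>)
qed

lemma ratfun_value_mult:
  assumes "ratfun_value \<rho> f v" "ratfun_value \<rho> g w"
  shows "ratfun_value \<rho> (f * g) (v * w)"
proof -
  obtain a b where f: "f = Fract a b" "b \<noteq> 0" "mpoly_value \<rho> b \<noteq> 0"
    "v = mpoly_value \<rho> a / mpoly_value \<rho> b" by (rule ratfun_valueE[OF assms(1)])
  obtain c d where g: "g = Fract c d" "d \<noteq> 0" "mpoly_value \<rho> d \<noteq> 0"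
    "w = mpoly_value \<rho> c / mpoly_value \<rho> d" by (rule ratfun_valueE[OF assms(2)])
  show ?thesis
    by (rule ratfun_valueI[of _ "a * c" "b * d"])
      (use f g in \<open>simp_all add: mpoly_value_mult\<close>)
qed

lemma ratfun_value_zero: "ratfun_value \<rho> 0 0"
  by (rule ratfun_valueI[of _ 0 1]) (simp_all add: mpoly_value_one mpoly_value_zero Zero_fract_def)

lemma ratfun_value_one: "ratfun_value \<rho> 1 1"
  by (rule ratfun_valueI[of _ 1 1]) (simp_all add: mpoly_value_one One_fract_def)

lemma ratfun_value_inverse:
  assumes "ratfun_value \<rho> f v" "v \<noteq> 0"
  shows "ratfun_value \<rho> (1 / f) (1 / v)"
proof -
  obtain a b where f: "f = Fract a b" "b \<noteq> 0" "mpoly_value \<rho> b \<noteq> 0"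
    "v = mpoly_value \<rho> a / mpoly_value \<rho> b" by (rule ratfun_valueE[OF assms(1)])
  show ?thesis
    by (rule ratfun_valueI[of _ b a]) (use f assms(2) in \<open>auto simp: One_fract_def\<close>)
qed

lemma ratfun_value_power: "ratfun_value \<rho> f v \<Longrightarrow> ratfun_value \<rho> (f ^ n) (v ^ n)"
  by (induction n) (simp_all add: ratfun_value_one ratfun_value_mult)

lemma ratfun_value_xvar: "ratfun_value \<rho> (xvar i) (\<rho> i)"
  by (rule ratfun_valueI[OF xvar_def]) (simp_all add: mpoly_value_single mpoly_value_one monomial_value_def)

lemma ratfun_value_scaleQ:
  assumes "ratfun_value \<rho> f v"
  shows "ratfun_value \<rho> (c *\<^sub>Q f) (of_rat c * v)"
proof -
  have n: "ratfun_value \<rho> (of_nat n) (of_nat n)" for n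
    by (induction n) (simp_all add: ratfun_value_zero ratfun_value_one ratfun_value_add)
  have m: "ratfun_value \<rho> (- 1) (- 1)"
    using mpoly_value_add[of \<rho> 1 "- 1"]
    by (intro ratfun_valueI[of _ "- 1" 1]) (simp_all add: mpoly_value_zero mpoly_value_one One_fract_def)
  have z: "ratfun_value \<rho> (of_int k) (of_int k)" for k
    by (cases k rule: int_cases2) (use n ratfun_value_mult[OF m n] in simp_all)
  obtain a b where c: "c = Rat.Fract a b" "b > 0" by (cases c) 
  have "ratfun_value \<rho> (of_int a * (1 / of_int b)) (of_int a * (1 / of_int b))"
    using c(2) by (intro ratfun_value_mult z ratfun_value_inverse) simp
  then have "ratfun_value \<rho> (of_rat c) (of_rat c)"
    using c by (simp add: of_rat_rat)
  then show ?thesis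
    unfolding scaleQ_ratfun by (rule ratfun_value_mult) (rule assms)
qed

lemma ratfun_value_sum:
  "(\<And>x. x \<in> A \<Longrightarrow> ratfun_value \<rho> (f x) (v x)) \<Longrightarrow> ratfun_value \<rho> (sum f A) (sum v A)"
  by (induction A rule: infinite_finite_induct) (simp_all add: ratfun_value_zero ratfun_value_add)

lemma ratfun_value_sum_list: "ratfun_value \<rho> (sum_list (map xvar is)) (sum_list (map \<rho> is))"
  by (induction "is") (simp_all add: ratfun_value_zero ratfun_value_add ratfun_value_xvar)

text \<open>Evaluated with all variables equal to 1, the sum is the length of the list.\<close>

lemma sum_xvar_nonzero:
  assumes "is \<noteq> []"
  shows "sum_list (map xvar is) \<noteq> 0"
proof
  assume "sum_list (map xvar is) = 0"
  then have "sum_list (map (\<lambda>_. 1::real) is) = 0"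
    using ratfun_value_unique ratfun_value_zero ratfun_value_sum_list by metis
  then show False using assms by (simp add: sum_list_triv)
qed


section \<open>Linear independence of Chen fractions\<close>

lemma chen_fraction_Nil [simp]: "chen_fraction [] ss = 1"
  by (simp add: chen_fraction_def)

lemma chen_fraction_Cons:
  "chen_fraction (i # is) (s # ss) = 1 / sum_list (map xvar (i # is)) ^ s * chen_fraction is ss"
proof -
  have 1: "(\<Sum>l\<in>{j..<length xs}. xvar (xs ! l)) = sum_list (map xvar (drop j xs))" for j xs
  proof -
    have "sum_list (map xvar (drop j xs)) = (\<Sum>l<length (drop j xs). xvar (drop j xs ! l))"
      by (simp add: sum_list_sum_nth atLeast0LessThan)
    also have "\<dots> = (\<Sum>l\<in>{j..<length xs}. xvar (xs ! l))"
      by (rule sum.reindex_bij_witness[of _ "\<lambda>l. l - j" "\<lambda>l. l + j"]) (auto simp: add.commute)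
    finally show ?thesis by simp
  qed
  show ?thesis
    unfolding chen_fraction_def 1 unfolding length_Cons prod.lessThan_Suc_shift by simp
qed

text \<open>The shift \<open>c\<close> plays the value of one further innermost variable, which
  would occur in every partial sum. With it, a fraction whose last index has been split off is still
  of this form.\<close>

fun chen_value :: "(nat \<Rightarrow> real) \<Rightarrow> real \<Rightarrow> nat list \<Rightarrow> nat list \<Rightarrow> real" where
  "chen_value \<rho> c (i # is) (s # ss) = 1 / (sum_list (map \<rho> (i # is)) + c) ^ s * chen_value \<rho> c is ss"
| "chen_value \<rho> c _ _ = 1"

lemma sum_list_map_pos: "(\<And>i. \<rho> i > (0::real)) \<Longrightarrow> is \<noteq> [] \<Longrightarrow> sum_list (map \<rho> is) > 0"
proof (induction "is")
  case (Cons i "is")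
  then show ?case by (cases "is = []") (simp_all add: add_pos_pos)
qed simp

lemma ratfun_value_chen_fraction:
  assumes "\<And>i. \<rho> i > 0" "length is = length ss"
  shows "ratfun_value \<rho> (chen_fraction is ss) (chen_value \<rho> 0 is ss)"
  using assms(2)
proof (induction "is" ss rule: list_induct2)
  case Nil
  show ?case by (simp add: ratfun_value_one)
next
  case (Cons i "is" s ss)
  have "sum_list (map \<rho> (i # is)) > 0"
    using assms(1) by (intro sum_list_map_pos) auto
  then show ?case
    unfolding chen_fraction_Cons chen_value.simps add_0_right
    by (intro ratfun_value_mult ratfun_value_inverse ratfun_value_power ratfun_value_sum_list Cons.IH) simp
qed

lemma tendsto_chen_value:
  assumes "\<And>i. ((\<lambda>t. \<sigma> t i) \<longlongrightarrow> \<tau> i) F" "(k \<longlongrightarrow> c) F"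
    and "\<And>n. n < length is \<Longrightarrow> sum_list (map \<tau> (drop n is)) + c \<noteq> 0"
  shows "((\<lambda>t. chen_value (\<sigma> t) (k t) is ss) \<longlongrightarrow> chen_value \<tau> c is ss) F"
  using assms(3)
proof (induction "is" arbitrary: ss)
  case (Cons i "is")
  show ?case
  proof (cases ss)
    case (Cons s ts)
    have s: "((\<lambda>t. sum_list (map (\<sigma> t) js)) \<longlongrightarrow> sum_list (map \<tau> js)) F" for js
      by (induction js) (auto intro!: tendsto_add assms(1))
    have "((\<lambda>t. chen_value (\<sigma> t) (k t) is ts) \<longlongrightarrow> chen_value \<tau> c is ts) F"
      using Cons.prems[of "Suc _"] by (intro Cons.IH) simp
    moreover have "sum_list (map \<tau> (i # is)) + c \<noteq> 0"
      using Cons.prems[of 0] by simp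
    ultimately show ?thesis
      unfolding Cons chen_value.simps
      by (intro tendsto_mult tendsto_divide tendsto_power tendsto_add s assms(2) tendsto_const) simp_all
  qed simp
qed simp

text \<open>The index \<open>a\<close> is a summand of every partial sum, so its value
  \<open>t\<close> acts as the shift on the earlier factors and contributes \<open>1 / t ^ s\<close>
  as the innermost one.\<close>

lemma chen_value_snoc:
  "length is = length ss \<Longrightarrow> a \<notin> set is \<Longrightarrow>
    chen_value (\<rho>(a := t)) 0 (is @ [a]) (ss @ [s]) = chen_value \<rho> t is ss / t ^ s"
  by (induction "is" ss rule: list_induct2) (simp_all add: add.assoc)

text \<open>Letting the variable \<open>x\<^sub>a\<close> tend to \<open>0\<close> after multiplication by \<open>x\<^sub>a ^ s\<close> isolates the
  fractions whose innermost factor is \<open>x\<^sub>a ^ s\<close>, when \<open>s\<close> is the maximal such exponent.\<close>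

lemma chen_value_tail_limit:
  assumes "\<And>i. \<rho> i > 0" "chen_index is ss" "s \<ge> 1"
    and "is \<noteq> [] \<Longrightarrow> last is = a \<Longrightarrow> last ss \<le> s"
  shows "((\<lambda>t. t ^ s * chen_value (\<rho>(a := t)) 0 is ss) \<longlongrightarrow>
    (if is \<noteq> [] \<and> last is = a \<and> last ss = s then chen_value \<rho> 0 (butlast is) (butlast ss) else 0)) (at_right 0)"
proof (cases "is \<noteq> [] \<and> last is = a")
  case False
  have "((\<lambda>t. chen_value (\<rho>(a := t)) 0 is ss) \<longlongrightarrow> chen_value (\<rho>(a := 0)) 0 is ss) (at_right 0)"
  proof (rule tendsto_chen_value)
    show "((\<lambda>t. (\<rho>(a := t)) i) \<longlongrightarrow> (\<rho>(a := 0)) i) (at_right 0)" for i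
      by (cases "i = a") auto
    fix n assume n: "n < length is"
    \<comment> \<open>Setting one variable to 0 is harmless as long as the innermost summand of each
      partial sum is another variable, which stays positive.\<close>
    have "sum_list (map (\<rho>(a := 0)) js) > 0" if "js \<noteq> []" "last js \<noteq> a" for js
      using that
    proof (induction js)
      case (Cons j js)
      then show ?case using assms(1)[of j]
        by (cases "js = []") (auto intro: add_nonneg_pos add_pos_pos)
    qed simp
    from this[of "drop n is"] show "sum_list (map (\<rho>(a := 0)) (drop n is)) + 0 \<noteq> 0"
      using n False by (cases "is = []") auto
  qed simp
  moreover have "((\<lambda>t::real. t ^ s) \<longlongrightarrow> 0) (at_right 0)"
    using assms(3) by (intro tendsto_eq_intros) auto
  ultimately have "((\<lambda>t. t ^ s * chen_value (\<rho>(a := t)) 0 is ss) \<longlongrightarrow> 0 * chen_value (\<rho>(a := 0)) 0 is ss) (at_right 0)"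
    by (rule tendsto_mult[rotated])
  then show ?thesis using False by auto
next
  case True
  define js ts r where "js = butlast is" and "ts = butlast ss" and "r = last ss"
  have len: "length is = length ss" "distinct is" using assms(2) by (auto simp: chen_index_def)
  have "ss \<noteq> []" using True len by auto
  then have is': "is = js @ [a]" and ss': "ss = ts @ [r]"
    using True by (auto simp: js_def ts_def r_def)
  have r: "r \<le> s" using assms(4) True by (simp add: r_def)
  have eq: "t ^ s * chen_value (\<rho>(a := t)) 0 is ss = t ^ (s - r) * chen_value \<rho> t js ts" if "t > 0" for t
  proof -
    have "chen_value (\<rho>(a := t)) 0 is ss = chen_value \<rho> t js ts / t ^ r"
      unfolding is' ss' using len by (intro chen_value_snoc) (auto simp: is' ss')
    moreover have "t ^ s = t ^ (s - r) * t ^ r" using r by (simp flip: power_add)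
    ultimately show ?thesis using that by simp
  qed
  have "((\<lambda>t. chen_value \<rho> t js ts) \<longlongrightarrow> chen_value \<rho> 0 js ts) (at_right 0)"
  proof (rule tendsto_chen_value)
    fix n assume "n < length js"
    then have "sum_list (map \<rho> (drop n js)) > 0" using assms(1) by (intro sum_list_map_pos) auto
    then show "sum_list (map \<rho> (drop n js)) + 0 \<noteq> 0" by simp
  qed auto
  \<comment> \<open>An exponent \<open>r < s\<close> leaves a positive power of \<open>t\<close>,
    which kills the term in the limit.\<close>
  moreover have "((\<lambda>t::real. t ^ (s - r)) \<longlongrightarrow> (if r = s then 1 else 0)) (at_right 0)"
    using r by (cases "r = s") (auto intro!: tendsto_eq_intros)
  ultimately have "((\<lambda>t. t ^ (s - r) * chen_value \<rho> t js ts) \<longlongrightarrow> (if r = s then 1 else 0) * chen_value \<rho> 0 js ts) (at_right 0)"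
    by (rule tendsto_mult[rotated])
  then have "((\<lambda>t. t ^ s * chen_value (\<rho>(a := t)) 0 is ss) \<longlongrightarrow> (if r = s then 1 else 0) * chen_value \<rho> 0 js ts) (at_right 0)"
  proof (rule Lim_transform_eventually)
    show "\<forall>\<^sub>F t in at_right 0. t ^ (s - r) * chen_value \<rho> t js ts = t ^ s * chen_value (\<rho>(a := t)) 0 is ss"
      using eventually_at_right_less[of "0::real"] by eventually_elim (simp add: eq)
  qed
  then show ?thesis using True by (auto simp: js_def ts_def r_def)
qed

text \<open>By the limit argument the terms with the most singular innermost factor satisfy a
  relation among themselves once their last entries are removed. Induction disposes of this shorter
  relation and then of the remaining terms.\<close>

lemma chen_value_independent:
  fixes c :: "nat list \<times> nat list \<Rightarrow> real"
  assumes "finite A" "\<And>is ss. (is, ss) \<in> A \<Longrightarrow> chen_index is ss"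
    and "\<And>\<rho>. (\<And>i. \<rho> i > 0) \<Longrightarrow> (\<Sum>(is, ss)\<in>A. c (is, ss) * chen_value \<rho> 0 is ss) = 0"
  shows "\<forall>x\<in>A. c x = 0"
  using assms
\<comment> \<open>The measure drops both when a nonempty set of terms is discarded and when lists
  are shortened; both kinds of descent occur below.\<close>
proof (induction "\<Sum>(is, ss)\<in>A. Suc (length is)" arbitrary: A c rule: less_induct)
  case (less A c)
  let ?w = "\<lambda>A :: (nat list \<times> nat list) set. \<Sum>(is, ss)\<in>A. Suc (length is)"
  show ?case
  proof (cases "\<exists>is ss. (is, ss) \<in> A \<and> is \<noteq> []")
    case False
    have "x = ([], [])" if "x \<in> A" for x
      using False that less.prems(2)[of "fst x" "snd x"] by (cases x) (auto simp: chen_index_def)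
    then have "A = {} \<or> A = {([], [])}" by auto
    then show ?thesis
      using less.prems(3)[of "\<lambda>_. 1"] by auto
  next
    case True
    then obtain is0 ss0 where 0: "(is0, ss0) \<in> A" "is0 \<noteq> []" by blast
    \<comment> \<open>Any index that ends some list of \<open>A\<close> may serve as the variable
      tending to 0. The largest exponent attached to it in last position fixes the order of the
      singularity.\<close>
    define a where "a = last is0"
    define E where "E = {last ss | is ss. (is, ss) \<in> A \<and> is \<noteq> [] \<and> last is = a}"
    define s where "s = Max E"
    have "E \<subseteq> (\<lambda>(is, ss). last ss) ` A" by (force simp: E_def)
    then have finE: "finite E" by (rule finite_subset) (simp add: less.prems(1))
    have "E \<noteq> {}" using 0 by (auto simp: E_def a_def)
    then have "s \<in> E" unfolding s_def using finE by (rule Max_in[rotated])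
    then obtain is1 ss1 where 1: "(is1, ss1) \<in> A" "is1 \<noteq> []" "last is1 = a" "last ss1 = s"
      by (auto simp: E_def)
    have s1: "s \<ge> 1"
    proof -
      have "ss1 \<noteq> []" using less.prems(2)[OF 1(1)] 1(2) by (auto simp: chen_index_def)
      then show ?thesis using less.prems(2)[OF 1(1)] 1(4) last_in_set[of ss1] by (auto simp: chen_index_def)
    qed
    have max: "last ss \<le> s" if "(is, ss) \<in> A" "is \<noteq> []" "last is = a" for "is" ss
      unfolding s_def using finE that by (intro Max_ge) (auto simp: E_def)
    \<comment> \<open>The terms of highest order in the innermost variable \<open>a\<close>, which
      are the ones that survive the limit.\<close>
    define B where "B = {(is, ss). (is, ss) \<in> A \<and> is \<noteq> [] \<and> last is = a \<and> last ss = s}"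
    have BA: "B \<subseteq> A" by (auto simp: B_def)
    have finB: "finite B" using BA less.prems(1) finite_subset by blast
    have "B \<noteq> {}" using 1 by (auto simp: B_def)
    have Bform: "is = butlast is @ [a] \<and> ss = butlast ss @ [s]" if "(is, ss) \<in> B" for "is" ss
    proof -
      have "ss \<noteq> []" using less.prems(2)[of "is" ss] that by (auto simp: B_def chen_index_def)
      then show ?thesis using that by (auto simp: B_def snoc_eq_iff_butlast)
    qed
    define f :: "nat list \<times> nat list \<Rightarrow> nat list \<times> nat list"
      where "f = (\<lambda>(is, ss). (butlast is, butlast ss))"
    define g :: "nat list \<times> nat list \<Rightarrow> nat list \<times> nat list"
      where "g = (\<lambda>(is, ss). (is @ [a], ss @ [s]))"
    have gf: "g (f x) = x" if "x \<in> B" for x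
      using Bform that by (cases x) (auto simp: f_def g_def)
    have inj: "inj_on f B" by (rule inj_on_inverseI) (rule gf)
    have sumB: "(\<Sum>(is, ss)\<in>B. c (is, ss) * chen_value \<rho> 0 (butlast is) (butlast ss)) = 0"
      if \<rho>: "\<And>i. \<rho> i > 0" for \<rho>
    proof -
      let ?L = "\<lambda>is ss. if is \<noteq> [] \<and> last is = a \<and> last ss = s then chen_value \<rho> 0 (butlast is) (butlast ss) else 0"
      have "((\<lambda>t. \<Sum>(is, ss)\<in>A. c (is, ss) * (t ^ s * chen_value (\<rho>(a := t)) 0 is ss)) \<longlongrightarrow>
          (\<Sum>(is, ss)\<in>A. c (is, ss) * ?L is ss)) (at_right 0)"
        unfolding case_prod_unfold
      proof (intro tendsto_sum tendsto_mult tendsto_const)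
        fix x assume x: "x \<in> A"
        show "((\<lambda>t. t ^ s * chen_value (\<rho>(a := t)) 0 (fst x) (snd x)) \<longlongrightarrow> ?L (fst x) (snd x)) (at_right 0)"
          using x less.prems(2)[of "fst x" "snd x"] max[of "fst x" "snd x"]
          by (intro chen_value_tail_limit \<rho> s1) auto
      qed
      moreover have "\<forall>\<^sub>F t in at_right 0. (\<Sum>(is, ss)\<in>A. c (is, ss) * (t ^ s * chen_value (\<rho>(a := t)) 0 is ss)) = 0"
        using eventually_at_right_less[of "0::real"]
      proof eventually_elim
        case (elim t)
        have "(\<Sum>(is, ss)\<in>A. c (is, ss) * (t ^ s * chen_value (\<rho>(a := t)) 0 is ss)) =
            t ^ s * (\<Sum>(is, ss)\<in>A. c (is, ss) * chen_value (\<rho>(a := t)) 0 is ss)"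
          by (simp add: sum_distrib_left case_prod_unfold mult_ac)
        also have "\<dots> = 0"
          using less.prems(3)[of "\<rho>(a := t)"] \<rho> elim by simp
        finally show ?case .
      qed
      ultimately have "((\<lambda>t. 0) \<longlongrightarrow> (\<Sum>(is, ss)\<in>A. c (is, ss) * ?L is ss)) (at_right (0::real))"
        by (rule Lim_transform_eventually)
      then have "(\<Sum>(is, ss)\<in>A. c (is, ss) * ?L is ss) = 0"
        by (rule tendsto_unique[OF trivial_limit_at_right_real _ tendsto_const])
      moreover have "(\<Sum>(is, ss)\<in>A. c (is, ss) * ?L is ss) =
          (\<Sum>(is, ss)\<in>B. c (is, ss) * chen_value \<rho> 0 (butlast is) (butlast ss))"
      proof (rule sum.mono_neutral_cong_right[OF less.prems(1) BA])
        show "\<forall>x\<in>A - B. (case x of (is, ss) \<Rightarrow> c (is, ss) * ?L is ss) = 0"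
        proof
          fix x assume x: "x \<in> A - B"
          obtain js ts where "x = (js, ts)" by force
          then show "(case x of (is, ss) \<Rightarrow> c (is, ss) * ?L is ss) = 0"
            using x by (simp add: B_def) blast
        qed
      qed (auto simp: B_def)
      ultimately show ?thesis by simp
    qed
    have wle: "?w B \<le> ?w A" using BA less.prems(1) by (intro sum_mono2) auto
    have "?w (f ` B) = (\<Sum>x\<in>B. Suc (length (fst (f x))))"
      by (subst sum.reindex[OF inj]) (simp add: case_prod_unfold)
    also have "\<dots> < (\<Sum>x\<in>B. Suc (length (fst x)))"
      using finB \<open>B \<noteq> {}\<close> by (rule sum_strict_mono) (auto simp: f_def B_def)
    finally have wB: "?w (f ` B) < ?w A" using wle by (simp add: case_prod_unfold)
    \<comment> \<open>First use of induction, for the survivors without their last entries. The map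
      \<open>g\<close> can restore these entries because they are the same \<open>a\<close> and
      \<open>s\<close> for all of \<open>B\<close>.\<close>
    have "\<forall>x\<in>f ` B. (c \<circ> g) x = 0"
    proof (rule less.hyps[OF wB])
      show "finite (f ` B)" using finB by simp
      show "chen_index is ss" if B: "(is, ss) \<in> f ` B" for "is" ss
      proof -
        obtain js ts where jt: "(js, ts) \<in> B" "is = butlast js" "ss = butlast ts"
          using B by (auto simp: f_def)
        have "chen_index js ts" using jt(1) BA less.prems(2) by blast
        then show ?thesis using jt by (auto simp: chen_index_def distinct_butlast dest: in_set_butlastD)
      qed
      fix \<rho> :: "nat \<Rightarrow> real" assume \<rho>: "\<And>i. \<rho> i > 0"
      have "(\<Sum>(is, ss)\<in>f ` B. (c \<circ> g) (is, ss) * chen_value \<rho> 0 is ss) =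
          (\<Sum>x\<in>B. c (g (f x)) * chen_value \<rho> 0 (fst (f x)) (snd (f x)))"
        by (subst sum.reindex[OF inj]) (simp add: case_prod_unfold)
      also have "\<dots> = (\<Sum>(is, ss)\<in>B. c (is, ss) * chen_value \<rho> 0 (butlast is) (butlast ss))"
      proof (rule sum.cong[OF refl])
        fix x assume x: "x \<in> B"
        show "c (g (f x)) * chen_value \<rho> 0 (fst (f x)) (snd (f x)) =
            (case x of (is, ss) \<Rightarrow> c (is, ss) * chen_value \<rho> 0 (butlast is) (butlast ss))"
          unfolding gf[OF x] by (cases x) (simp add: f_def)
      qed
      also have "\<dots> = 0" by (rule sumB[OF \<rho>])
      finally show "(\<Sum>(is, ss)\<in>f ` B. (c \<circ> g) (is, ss) * chen_value \<rho> 0 is ss) = 0" .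
    qed
    then have cB: "c x = 0" if "x \<in> B" for x using that gf by fastforce
    have "?w (A - B) < ?w A"
    proof -
      have "?w A = ?w (A - B) + ?w B"
        using BA less.prems(1) by (simp add: sum.subset_diff)
      moreover have "?w B > 0" using finB \<open>B \<noteq> {}\<close> by (intro sum_pos) auto
      ultimately show ?thesis by simp
    qed
    \<comment> \<open>Second use of induction: with the coefficients on \<open>B\<close> gone, the
      other terms satisfy the relation alone.\<close>
    then have "\<forall>x\<in>A - B. c x = 0"
    proof (rule less.hyps)
      show "finite (A - B)" using less.prems(1) by simp
      show "chen_index is ss" if "(is, ss) \<in> A - B" for "is" ss using that less.prems(2) by blast
      fix \<rho> :: "nat \<Rightarrow> real" assume \<rho>: "\<And>i. \<rho> i > 0"
      have "(\<Sum>(is, ss)\<in>A - B. c (is, ss) * chen_value \<rho> 0 is ss) = (\<Sum>(is, ss)\<in>A. c (is, ss) * chen_value \<rho> 0 is ss)"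
        by (rule sum.mono_neutral_left) (use less.prems(1) cB in auto)
      then show "(\<Sum>(is, ss)\<in>A - B. c (is, ss) * chen_value \<rho> 0 is ss) = 0"
        using less.prems(3)[OF \<rho>] by simp
    qed
    then show ?thesis using cB by blast
  qed
qed

text \<open>Evaluation at positive points, where no partial sum vanishes, turns a relation of
  rational functions into one of real functions.\<close>

lemma chen_fraction_independent:
  assumes "finite A" "\<And>is ss. (is, ss) \<in> A \<Longrightarrow> chen_index is ss"
    and "(\<Sum>(is, ss)\<in>A. c (is, ss) *\<^sub>Q chen_fraction is ss) = 0"
  shows "\<forall>x\<in>A. c x = 0"
proof -
  have "\<forall>x\<in>A. (of_rat (c x) :: real) = 0"
  proof (rule chen_value_independent[OF assms(1,2)])
    fix \<rho> :: "nat \<Rightarrow> real" assume \<rho>: "\<And>i. \<rho> i > 0"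
    have "ratfun_value \<rho> (\<Sum>(is, ss)\<in>A. c (is, ss) *\<^sub>Q chen_fraction is ss)
        (\<Sum>(is, ss)\<in>A. of_rat (c (is, ss)) * chen_value \<rho> 0 is ss)"
      unfolding case_prod_unfold
      using assms(2) \<rho>
      by (intro ratfun_value_sum ratfun_value_scaleQ ratfun_value_chen_fraction) (auto simp: chen_index_def)
    then show "(\<Sum>(is, ss)\<in>A. of_rat (c (is, ss)) * chen_value \<rho> 0 is ss) = 0"
      unfolding assms(3) using ratfun_value_unique ratfun_value_zero by blast
  qed
  then show ?thesis by simp
qed

section \<open>The basis of Chen fractions\<close>

lemma chen_index_Nil [simp]: "chen_index [] []"
  by (simp add: chen_index_def)

lemma chen_index_length: "chen_index is ss \<Longrightarrow> length ss = length is"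
  by (simp add: chen_index_def)

lemma chen_fraction_in_span: "chen_index is ss \<Longrightarrow> chen_fraction is ss \<in> ratvec.span chen_fractions"
  by (rule ratvec.span_base) (cases "is", auto simp: chen_fractions_def)

lemma ratfun_of_Phi: "chen_index is ss \<Longrightarrow> ratfun_of (Phi is ss) = chen_fraction is ss"
  unfolding Phi_def by (rule chen_of_inverse) (rule chen_fraction_in_span)

lemma Phi_Nil: "Phi [] [] = chen_one"
  by (simp add: Phi_def chen_one_def)

lemma ratfun_of_one: "ratfun_of chen_one = 1"
  using ratfun_of_Phi[of "[]" "[]"] by (simp add: Phi_Nil)

lemma chen_basis_eq: "chen_basis = {Phi is ss | is ss. chen_index is ss}"
proof -
  have "\<exists>is ss. chen_one = Phi is ss \<and> chen_index is ss"
    using Phi_Nil chen_index_Nil by metis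
  moreover have "Phi is ss = chen_one" if "chen_index is ss" "is = []" for "is" ss
    using that by (simp add: chen_index_def Phi_Nil)
  ultimately show ?thesis unfolding chen_basis_def by blast
qed

text \<open>If two different index pairs gave the same fraction, the coefficients 1 and -1 would
  form a nontrivial relation.\<close>

lemma Phi_inject:
  assumes "chen_index is ss" "chen_index js ts" "Phi is ss = Phi js ts"
  shows "is = js \<and> ss = ts"
proof (rule ccontr)
  assume neq: "\<not> (is = js \<and> ss = ts)"
  have ne: "(is, ss) \<noteq> (js, ts)" using neq by blast
  have eq: "chen_fraction is ss = chen_fraction js ts"
    using assms ratfun_of_Phi by metis
  have "(\<Sum>(ks, us)\<in>{(is, ss), (js, ts)}. (if (ks, us) = (is, ss) then 1 else - 1) *\<^sub>Q chen_fraction ks us) = 0"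
    unfolding case_prod_unfold using ne ne[symmetric] eq
    by (simp del: prod.inject)
  then have "\<forall>x\<in>{(is, ss), (js, ts)}. (if x = (is, ss) then 1 else - 1 :: rat) = 0"
    by (intro chen_fraction_independent) (use assms in auto)
  then show False by simp
qed

lemma inj_on_Phi: "inj_on (\<lambda>(is, ss). Phi is ss) {(is, ss). chen_index is ss}"
  by (rule inj_onI) (auto dest: Phi_inject)

text \<open>Index pairs and basis elements correspond bijectively, so a relation between basis
  elements can be rewritten as one indexed by pairs.\<close>

lemma chen_basis_independent: "ratvec.independent chen_basis"
  unfolding ratvec.independent_explicit_finite_subsets
proof (intro allI impI ballI)
  fix S u v
  assume S: "S \<subseteq> chen_basis" "finite S" and 0: "(\<Sum>v\<in>S. u v *\<^sub>Q v) = 0" and v: "v \<in> S"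
  define A where "A = {(is, ss). chen_index is ss \<and> Phi is ss \<in> S}"
  let ?P = "\<lambda>(is, ss). Phi is ss"
  have inj: "inj_on ?P A" by (rule inj_on_subset[OF inj_on_Phi]) (auto simp: A_def)
  have SA: "S = ?P ` A" using S(1) by (auto simp: A_def chen_basis_eq image_iff)
  then have fin: "finite A" using S(2) inj finite_image_iff by metis
  have "(\<Sum>(is, ss)\<in>A. u (Phi is ss) *\<^sub>Q Phi is ss) = 0"
    using 0 unfolding SA sum.reindex[OF inj] by (simp add: case_prod_unfold)
  then have "ratfun_of (\<Sum>(is, ss)\<in>A. u (Phi is ss) *\<^sub>Q Phi is ss) = 0"
    by (simp add: zero_chen.rep_eq)
  then have "(\<Sum>(is, ss)\<in>A. u (Phi is ss) *\<^sub>Q ratfun_of (Phi is ss)) = 0"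
    by (simp add: linearQ_sum[OF linearQ_ratfun_of] linearQ_scale[OF linearQ_ratfun_of] case_prod_unfold)
  also have "(\<Sum>(is, ss)\<in>A. u (Phi is ss) *\<^sub>Q ratfun_of (Phi is ss)) = 
      (\<Sum>(is, ss)\<in>A. (\<lambda>(is, ss). u (Phi is ss)) (is, ss) *\<^sub>Q chen_fraction is ss)"
    by (intro sum.cong refl) (auto simp: A_def ratfun_of_Phi)
  finally have "\<forall>x\<in>A. (\<lambda>(is, ss). u (Phi is ss)) x = 0"
    by (intro chen_fraction_independent fin) (auto simp: A_def)
  then show "u v = 0" using v unfolding SA by auto
qed

lemma span_chen_basis: "ratvec.span chen_basis = UNIV"
proof -
  have im: "ratfun_of ` chen_basis = chen_fractions"
  proof -
    have "ratfun_of ` {Phi is ss | is ss. is \<noteq> [] \<and> chen_index is ss} =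
        {chen_fraction is ss | is ss. is \<noteq> [] \<and> chen_index is ss}"
    proof (intro equalityI subsetI)
      fix f assume "f \<in> {chen_fraction is ss | is ss. is \<noteq> [] \<and> chen_index is ss}"
      then obtain "is" ss where "f = chen_fraction is ss" "is \<noteq> []" "chen_index is ss" by blast
      then show "f \<in> ratfun_of ` {Phi is ss | is ss. is \<noteq> [] \<and> chen_index is ss}"
        by (intro image_eqI[of _ _ "Phi is ss"]) (auto simp: ratfun_of_Phi)
    qed (auto simp: ratfun_of_Phi, blast)
    then show ?thesis by (simp add: chen_basis_def chen_fractions_def ratfun_of_one)
  qed
  have "a \<in> ratvec.span chen_basis" for a
  proof -
    have "ratfun_of a \<in> ratvec.span (ratfun_of ` chen_basis)"
      unfolding im by (rule ratfun_of)
    then have "ratfun_of a \<in> ratfun_of ` ratvec.span chen_basis"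
      by (simp add: ratvec_pair.linear_span_image[OF linearQ_ratfun_of])
    then show ?thesis by (auto simp: ratfun_of_inject)
  qed
  then show ?thesis by blast
qed

section \<open>Coordinates and spans of subfamilies of the basis\<close>

definition chen_coeff :: "chen \<Rightarrow> nat list \<Rightarrow> nat list \<Rightarrow> rat"
  where "chen_coeff u is ss = ratvec.representation chen_basis u (Phi is ss)"

lemma linearQ_chen_coeff: "linearQ (\<lambda>u. chen_coeff u is ss)"
  by (rule linearQI)
    (simp_all add: chen_coeff_def ratvec.representation_add ratvec.representation_scale
      chen_basis_independent span_chen_basis scaleQ_rat_def)

lemma chen_coeff_Phi:
  assumes "chen_index is ss" "chen_index js ts"
  shows "chen_coeff (Phi js ts) is ss = (if is = js \<and> ss = ts then 1 else 0)"
proof -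
  have "Phi js ts \<in> chen_basis" using assms by (auto simp: chen_basis_eq)
  then show ?thesis
    using Phi_inject[OF assms]
    by (auto simp: chen_coeff_def ratvec.representation_basis chen_basis_independent)
qed

text \<open>Polars, degree parts and their intersections are all spans of subsets of the basis.
  Encoding the subset by a predicate on indices reduces inclusions, intersections and sums of such
  spans to logic.\<close>

definition chen_span :: "(nat list \<Rightarrow> nat list \<Rightarrow> bool) \<Rightarrow> chen set"
  where "chen_span P = ratvec.span {Phi is ss | is ss. chen_index is ss \<and> P is ss}"

lemma subspace_chen_span: "ratvec.subspace (chen_span P)"
  by (simp add: chen_span_def ratvec.subspace_span)

lemma Phi_in_chen_span: "chen_index is ss \<Longrightarrow> P is ss \<Longrightarrow> Phi is ss \<in> chen_span P"
  unfolding chen_span_def by (rule ratvec.span_base) blast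

text \<open>Independence of the basis is what lets membership be read off the coordinates.\<close>

lemma chen_span_iff:
  "u \<in> chen_span P \<longleftrightarrow> (\<forall>is ss. chen_index is ss \<longrightarrow> chen_coeff u is ss \<noteq> 0 \<longrightarrow> P is ss)"
proof
  assume u: "u \<in> chen_span P"
  show "\<forall>is ss. chen_index is ss \<longrightarrow> chen_coeff u is ss \<noteq> 0 \<longrightarrow> P is ss"
  proof (intro allI impI, rule ccontr)
    fix "is" ss assume i: "chen_index is ss" and nz: "chen_coeff u is ss \<noteq> 0" and P: "\<not> P is ss"
    have "chen_coeff u is ss \<in> {0}"
    proof (rule linearQ_span_induct[OF linearQ_chen_coeff u[unfolded chen_span_def] ratvec.subspace_single_0])
      fix y assume "y \<in> {Phi is ss |is ss. chen_index is ss \<and> P is ss}"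
      then obtain js ts where "y = Phi js ts" "chen_index js ts" "P js ts" by blast
      then show "chen_coeff y is ss \<in> {0}" using i P by (auto simp: chen_coeff_Phi)
    qed
    then show False using nz by simp
  qed
next
  assume *: "\<forall>is ss. chen_index is ss \<longrightarrow> chen_coeff u is ss \<noteq> 0 \<longrightarrow> P is ss"
  have "(\<Sum>b | ratvec.representation chen_basis u b \<noteq> 0. ratvec.representation chen_basis u b *\<^sub>Q b) = u"
    by (rule ratvec.sum_nonzero_representation_eq) (simp_all add: chen_basis_independent span_chen_basis)
  moreover have "b \<in> chen_span P" if b: "ratvec.representation chen_basis u b \<noteq> 0" for b
  proof -
    have "b \<in> chen_basis" using b by (rule ratvec.representation_ne_zero)
    then obtain "is" ss where "b = Phi is ss" "chen_index is ss" by (auto simp: chen_basis_eq)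
    then show ?thesis using b * by (simp add: Phi_in_chen_span chen_coeff_def)
  qed
  ultimately show "u \<in> chen_span P"
    using ratvec.subspace_sum[OF subspace_chen_span, of "{b. ratvec.representation chen_basis u b \<noteq> 0}"
        "\<lambda>b. ratvec.representation chen_basis u b *\<^sub>Q b" P]
    by (simp add: ratvec.subspace_scale[OF subspace_chen_span])
qed

lemma chen_span_mono:
  "u \<in> chen_span P \<Longrightarrow> (\<And>is ss. chen_index is ss \<Longrightarrow> P is ss \<Longrightarrow> Q is ss) \<Longrightarrow> u \<in> chen_span Q"
  unfolding chen_span_iff by blast

lemma chen_span_inter: "chen_span P \<inter> chen_span Q = chen_span (\<lambda>is ss. P is ss \<and> Q is ss)"
  by (auto simp: chen_span_iff)

lemma chen_span_UNIV: "u \<in> chen_span (\<lambda>_ _. True)"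
  by (simp add: chen_span_iff)

lemma subspace_sum_chen_span:
  "subspace_sum I (\<lambda>i. chen_span (P i)) = chen_span (\<lambda>is ss. \<exists>i\<in>I. P i is ss)"
proof
  show "subspace_sum I (\<lambda>i. chen_span (P i)) \<subseteq> chen_span (\<lambda>is ss. \<exists>i\<in>I. P i is ss)"
    unfolding subspace_sum_def
    by (rule ratvec.span_minimal) (auto simp: subspace_chen_span elim: chen_span_mono)
  show "chen_span (\<lambda>is ss. \<exists>i\<in>I. P i is ss) \<subseteq> subspace_sum I (\<lambda>i. chen_span (P i))"
    unfolding subspace_sum_def chen_span_def[of "\<lambda>is ss. \<exists>i\<in>I. P i is ss"]
    by (rule ratvec.span_minimal)
      (auto intro!: ratvec.span_base Phi_in_chen_span)
qed

lemma chen_span_linear: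
  assumes "linearQ f" "u \<in> chen_span P" "ratvec.subspace W"
    and "\<And>is ss. chen_index is ss \<Longrightarrow> P is ss \<Longrightarrow> f (Phi is ss) \<in> W"
  shows "f u \<in> W"
  using assms(2) unfolding chen_span_def
  by (rule linearQ_span_induct[OF assms(1) _ assms(3)]) (use assms(4) in blast)

lemma chen_span_linear_eq:
  assumes "linearQ f" "linearQ g" "u \<in> chen_span P"
    and "\<And>is ss. chen_index is ss \<Longrightarrow> P is ss \<Longrightarrow> f (Phi is ss) = g (Phi is ss)"
  shows "f u = g u"
  using assms(3) unfolding chen_span_def
  by (rule linearQ_span_eq[OF assms(1,2)]) (use assms(4) in blast)

lemmas chen_linear_eq = chen_span_linear_eq[OF _ _ chen_span_UNIV]

lemma chen_span_bilinear_eq: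
  assumes "bilinearQ f" "bilinearQ g" "u \<in> chen_span P" "v \<in> chen_span Q"
    and "\<And>is ss js ts. chen_index is ss \<Longrightarrow> P is ss \<Longrightarrow> chen_index js ts \<Longrightarrow> Q js ts \<Longrightarrow>
      f (Phi is ss) (Phi js ts) = g (Phi is ss) (Phi js ts)"
  shows "f u v = g u v"
  using assms(3,4) unfolding chen_span_def
  by (rule bilinearQ_span_eq[OF assms(1,2)]) (use assms(5) in blast)

lemma chen_linear_exists:
  obtains f :: "chen \<Rightarrow> 'v::rat_vector"
  where "linearQ f" "\<And>is ss. chen_index is ss \<Longrightarrow> f (Phi is ss) = \<phi> is ss"
proof -
  \<comment> \<open>Since \<open>Phi\<close> is injective on admissible index pairs, a prescription
    in terms of indices is a well-defined function on the basis.\<close>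
  define g where "g b = (let x = inv_into {(is, ss). chen_index is ss} (\<lambda>(is, ss). Phi is ss) b
    in \<phi> (fst x) (snd x))" for b
  obtain f where f: "\<forall>x\<in>chen_basis. f x = g x" "linearQ f"
    using ratvec_pair.linear_independent_extend[OF chen_basis_independent] by blast
  have "f (Phi is ss) = \<phi> is ss" if i: "chen_index is ss" for "is" ss
  proof -
    have "Phi is ss \<in> chen_basis" using i by (auto simp: chen_basis_eq)
    moreover have "g (Phi is ss) = \<phi> is ss"
      using inv_into_f_f[OF inj_on_Phi, of "(is, ss)"] i by (simp add: g_def)
    ultimately show ?thesis using f(1) by simp
  qed
  then show ?thesis using that f(2) by blast
qed


section \<open>Locality and grading\<close>

text \<open>Two elements are local to each other exactly when these sets are disjoint, see
  \<open>chen_loc_iff\<close>; locality claims become inclusions of sets of variables.\<close>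

definition chen_vars :: "chen \<Rightarrow> nat set"
  where "chen_vars u = \<Union>{set is | is ss. chen_index is ss \<and> chen_coeff u is ss \<noteq> 0}"

definition chen_over :: "nat set \<Rightarrow> chen set"
  where "chen_over A = chen_span (\<lambda>is ss. set is \<subseteq> A)"

lemma chen_over_iff: "u \<in> chen_over A \<longleftrightarrow> chen_vars u \<subseteq> A"
  by (auto simp: chen_over_def chen_span_iff chen_vars_def)

lemma subspace_chen_over: "ratvec.subspace (chen_over A)"
  by (simp add: chen_over_def subspace_chen_span)

lemma chen_over_vars: "u \<in> chen_over (chen_vars u)"
  by (simp add: chen_over_iff)

text \<open>By \<open>Phi_inject\<close> the index lists hidden in the definition are the given
  ones. The constant 1 needs no separate treatment once it is read as \<open>Phi [] []\<close>,
  which has no variables.\<close>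

lemma chen_basis_loc_Phi:
  assumes "chen_index is ss" "chen_index js ts"
  shows "chen_basis_loc (Phi is ss) (Phi js ts) \<longleftrightarrow> set is \<inter> set js = {}"
proof
  assume "chen_basis_loc (Phi is ss) (Phi js ts)"
  then consider "Phi is ss = Phi [] []" | "Phi js ts = Phi [] []"
    | is' ss' js' ts' where "chen_index is' ss'" "chen_index js' ts'"
       "Phi is ss = Phi is' ss'" "Phi js ts = Phi js' ts'" "set is' \<inter> set js' = {}"
    unfolding chen_basis_loc_def Phi_Nil by blast
  then show "set is \<inter> set js = {}"
  proof cases
    case 1 then show ?thesis using Phi_inject[OF assms(1) chen_index_Nil] by simp
  next
    case 2 then show ?thesis using Phi_inject[OF assms(2) chen_index_Nil] by simp
  next
    case 3 then show ?thesis
      using Phi_inject[OF assms(1) 3(1,3)] Phi_inject[OF assms(2) 3(2,4)] by simp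
  qed
qed (use assms in \<open>auto simp: chen_basis_loc_def\<close>)

lemma chen_loc_iff: "chen_loc u v \<longleftrightarrow> chen_vars u \<inter> chen_vars v = {}"
proof -
  have "chen_loc u v \<longleftrightarrow> (\<forall>is ss js ts. chen_index is ss \<longrightarrow> chen_index js ts \<longrightarrow>
      chen_coeff u is ss \<noteq> 0 \<longrightarrow> chen_coeff v js ts \<noteq> 0 \<longrightarrow> chen_basis_loc (Phi is ss) (Phi js ts))"
    unfolding chen_loc_def chen_basis_eq chen_coeff_def by blast
  also have "\<dots> \<longleftrightarrow> (\<forall>is ss js ts. chen_index is ss \<longrightarrow> chen_index js ts \<longrightarrow>
      chen_coeff u is ss \<noteq> 0 \<longrightarrow> chen_coeff v js ts \<noteq> 0 \<longrightarrow> set is \<inter> set js = {})"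
    by (simp add: chen_basis_loc_Phi)
  also have "\<dots> \<longleftrightarrow> chen_vars u \<inter> chen_vars v = {}"
    unfolding chen_vars_def by blast
  finally show ?thesis .
qed

lemma chen_vars_Phi: "chen_index is ss \<Longrightarrow> chen_vars (Phi is ss) = set is"
proof -
  assume i: "chen_index is ss"
  have "{set js | js ts. chen_index js ts \<and> chen_coeff (Phi is ss) js ts \<noteq> 0} = {set is}"
    using i chen_coeff_Phi[OF i i] chen_coeff_Phi[OF _ i] by (auto split: if_split_asm) force
  then show ?thesis by (simp add: chen_vars_def)
qed

text \<open>Being related to \<open>u\<close> constrains the basis terms one at a time, so a polar
  is again a span of basis elements, namely those avoiding all variables of
  \<open>U\<close>.\<close>

lemma polar_chen_loc: "polar chen_loc U = chen_over (- (\<Union>u\<in>U. chen_vars u))"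
  unfolding polar_def chen_loc_iff set_eq_iff mem_Collect_eq chen_over_iff by blast

lemma locality_space_chen: "locality_space chen_loc"
  by (auto simp: locality_space_def polar_chen_loc subspace_chen_over symp_def chen_loc_iff)

section \<open>The counit and the degree grading\<close>

lemma chen_counit_coeff: "chen_counit u = chen_coeff u [] []"
  by (simp add: chen_counit_def chen_coeff_def Phi_Nil)

lemma linearQ_chen_counit: "linearQ chen_counit"
  using linearQ_chen_coeff[of "[]" "[]"] by (simp add: chen_counit_coeff[abs_def])

lemma chen_counit_Phi: "chen_index is ss \<Longrightarrow> chen_counit (Phi is ss) = (if is = [] then 1 else 0)"
  by (auto simp: chen_counit_coeff chen_coeff_Phi chen_index_def)

lemma chen_degree_part_eq: "chen_degree_part m = chen_span (\<lambda>is ss. sum_list ss = m)"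
proof -
  have *: "sum_list ss = 0 \<longleftrightarrow> is = []" if "chen_index is ss" for "is" ss
    using that by (cases ss) (auto simp: chen_index_def)
  show ?thesis
  proof (cases "m = 0")
    case True
    have "{chen_one} = {Phi is ss |is ss. chen_index is ss \<and> sum_list ss = m}"
      using True * by (auto simp: Phi_Nil[symmetric] chen_index_def intro!: exI[of _ "[]"])
    then show ?thesis using True by (simp add: chen_degree_part_def chen_span_def)
  next
    case False
    have "(is \<noteq> [] \<and> chen_index is ss \<and> sum_list ss = m) \<longleftrightarrow> (chen_index is ss \<and> sum_list ss = m)" for "is" ss
      using False *[of "is" ss] by metis
    then show ?thesis using False by (simp add: chen_degree_part_def chen_span_def)
  qed
qed

lemma chen_degree_projections:
  obtains \<pi> :: "nat \<Rightarrow> chen \<Rightarrow> chen"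
  where "\<And>m. linearQ (\<pi> m)" "\<And>m u. u \<in> chen_degree_part m \<Longrightarrow> \<pi> m u = u"
    "\<And>m n u. m \<noteq> n \<Longrightarrow> u \<in> chen_degree_part n \<Longrightarrow> \<pi> m u = 0"
proof -
  have "\<exists>f. linearQ f \<and> (\<forall>u\<in>chen_degree_part m. f u = u) \<and> (\<forall>n\<noteq>m. \<forall>u\<in>chen_degree_part n. f u = 0)" for m
  proof -
    obtain f :: "chen \<Rightarrow> chen" where f: "linearQ f"
      "\<And>is ss. chen_index is ss \<Longrightarrow> f (Phi is ss) = (if sum_list ss = m then Phi is ss else 0)"
      using chen_linear_exists[of "\<lambda>is ss. if sum_list ss = m then Phi is ss else 0"] by blast
    have "f u = id u" if "u \<in> chen_degree_part m" for u
      using that unfolding chen_degree_part_eq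
      by (rule chen_span_linear_eq[OF f(1) linearQ_id]) (simp add: f(2))
    moreover have "f u = (\<lambda>_. 0) u" if "u \<in> chen_degree_part n" "n \<noteq> m" for u n
      using that(1) unfolding chen_degree_part_eq
      by (rule chen_span_linear_eq[OF f(1), rotated]) (use that(2) in \<open>simp_all add: f(2) linearQI\<close>)
    ultimately show ?thesis using f(1) by (intro exI[of _ f]) auto
  qed
  then obtain \<pi> where "\<forall>m. linearQ (\<pi> m) \<and> (\<forall>u\<in>chen_degree_part m. \<pi> m u = u) \<and>
      (\<forall>n\<noteq>m. \<forall>u\<in>chen_degree_part n. \<pi> m u = 0)"
    by metis
  then show ?thesis using that[of \<pi>] by metis
qed

lemma chen_degree_direct: "direct_family UNIV chen_degree_part"
proof -
  obtain \<pi> :: "nat \<Rightarrow> chen \<Rightarrow> chen" where "\<And>m. linearQ (\<pi> m)" "\<And>m u. u \<in> chen_degree_part m \<Longrightarrow> \<pi> m u = u"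
    "\<And>m n u. m \<noteq> n \<Longrightarrow> u \<in> chen_degree_part n \<Longrightarrow> \<pi> m u = 0"
    by (rule chen_degree_projections) blast
  then show ?thesis by (intro direct_family_projections)
qed

lemma chen_degree_sum: "subspace_sum UNIV chen_degree_part = UNIV"
  unfolding chen_degree_part_eq[abs_def] subspace_sum_chen_span by (auto simp: chen_span_UNIV)

text \<open>All exponents are at least 1, so degree 0 singles out the constant 1.\<close>

lemma chen_counit_kernel: "{f. chen_counit f = 0} = subspace_sum {1..} chen_degree_part"
proof -
  have *: "sum_list ss \<ge> 1 \<longleftrightarrow> is \<noteq> []" if "chen_index is ss" for "is" ss
    using that by (cases ss) (auto simp: chen_index_def)
  have "f \<in> chen_span (\<lambda>is ss. sum_list ss \<ge> 1) \<longleftrightarrow> chen_counit f = 0" for f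
    unfolding chen_span_iff chen_counit_coeff using * by (metis chen_index_Nil chen_index_length length_0_conv)
  then show ?thesis
    unfolding chen_degree_part_eq[abs_def] subspace_sum_chen_span by auto
qed

text \<open>Tensor products of two degree projections act as the identity in their own bidegree and
  as 0 in every other one.\<close>

lemma chen_tensor_degree_direct:
  "direct_family {(p, q). p + q = m}
     (\<lambda>(p, q). locality_tensor T (chen_degree_part p \<inter> X) (chen_degree_part q \<inter> X))"
proof -
  obtain \<pi> :: "nat \<Rightarrow> chen \<Rightarrow> chen" where \<pi>: "\<And>m. linearQ (\<pi> m)" "\<And>m u. u \<in> chen_degree_part m \<Longrightarrow> \<pi> m u = u"
    "\<And>m n u. m \<noteq> n \<Longrightarrow> u \<in> chen_degree_part n \<Longrightarrow> \<pi> m u = 0"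
    by (rule chen_degree_projections) blast
  define \<Pi> where "\<Pi> = (\<lambda>(p, q). tensor_map (\<pi> p) (\<pi> q))"
  show ?thesis
  proof (rule direct_family_projections)
    show lin: "linearQ (\<Pi> x)" for x
      by (cases x) (simp add: \<Pi>_def linearQ_tensor_map \<pi>(1))
    fix x t assume "t \<in> (\<lambda>(p, q). locality_tensor T (chen_degree_part p \<inter> X) (chen_degree_part q \<inter> X)) x"
    then have t: "t \<in> locality_tensor T (chen_degree_part (fst x) \<inter> X) (chen_degree_part (snd x) \<inter> X)"
      by (cases x) simp
    have "\<Pi> x t = id t"
      using t unfolding locality_tensor_def
      by (rule linearQ_span_eq[OF lin linearQ_id])
        (auto simp: \<Pi>_def case_prod_unfold tensor_map_pure \<pi>)
    then show "\<Pi> x t = t" by simp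
  next
    fix y x :: "nat \<times> nat" and t
    assume "y \<noteq> x" and "t \<in> (\<lambda>(p, q). locality_tensor T (chen_degree_part p \<inter> X) (chen_degree_part q \<inter> X)) x"
    then have t: "t \<in> locality_tensor T (chen_degree_part (fst x) \<inter> X) (chen_degree_part (snd x) \<inter> X)"
      by (cases x) simp
    have lin: "linearQ (\<Pi> y)"
      by (cases y) (simp add: \<Pi>_def linearQ_tensor_map \<pi>(1))
    have "\<Pi> y t = (\<lambda>_. 0) t"
      using t unfolding locality_tensor_def
    proof (rule linearQ_span_eq[OF lin, rotated])
      show "linearQ (\<lambda>_ :: (chen, chen) tensor. 0 :: (chen, chen) tensor)" by (simp add: linearQI)
      fix s assume "s \<in> {v \<otimes> w |v w. v \<in> chen_degree_part (fst x) \<inter> X \<and> w \<in> chen_degree_part (snd x) \<inter> X \<and> T v w}"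
      then obtain v w where s: "s = v \<otimes> w" "v \<in> chen_degree_part (fst x)" "w \<in> chen_degree_part (snd x)" by blast
      have "fst y \<noteq> fst x \<or> snd y \<noteq> snd x" using \<open>y \<noteq> x\<close> by (simp add: prod_eq_iff)
      then have "\<pi> (fst y) v = 0 \<or> \<pi> (snd y) w = 0" using \<pi>(3) s by blast
      then show "\<Pi> y s = 0"
        by (auto simp: s(1) \<Pi>_def case_prod_unfold tensor_map_pure \<pi>(1)
            linearQ_zero[OF linearQ_pure_left] linearQ_zero[OF linearQ_pure_right])
    qed
    then show "\<Pi> y t = 0" by simp
  qed
qed

section \<open>Derivatives of Chen fractions\<close>

lemma ratfun_pderiv_sum_xvar:
  "ratfun_pderiv i (sum_list (map xvar is)) = of_nat (count_list is i)"
  by (induction "is") (simp_all add: ratfun_pderiv_add ratfun_pderiv_xvar)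

lemma count_list_distinct: "distinct xs \<Longrightarrow> x \<in> set xs \<Longrightarrow> count_list xs x = 1"
  by (induction xs) (auto simp: count_list_0_iff)

lemma ratfun_pderiv_chen_fraction_notin:
  "length is = length ss \<Longrightarrow> i \<notin> set is \<Longrightarrow> ratfun_pderiv i (chen_fraction is ss) = 0"
proof (induction "is" ss rule: list_induct2)
  case (Cons k "is" s ss)
  have "count_list (k # is) i = 0" using Cons.prems by (simp add: count_list_0_iff)
  then show ?case
    using Cons unfolding chen_fraction_Cons ratfun_pderiv_mult
    by (subst ratfun_pderiv_inverse_power[OF sum_xvar_nonzero])
      (simp_all add: ratfun_pderiv_sum_xvar del: list.map count_list.simps)
qed simp

text \<open>The variable at position \<open>p\<close> is a summand, with coefficient 1, of exactly
  the partial sums at positions up to \<open>p\<close>. Each of these factors contributes one term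
  to the product rule.\<close>

lemma ratfun_pderiv_chen_fraction:
  "length is = length ss \<Longrightarrow> distinct is \<Longrightarrow> p < length is \<Longrightarrow>
    - ratfun_pderiv (is ! p) (chen_fraction is ss) =
      (\<Sum>l\<le>p. of_nat (ss ! l) * chen_fraction is (ss[l := ss ! l + 1]))"
proof (induction "is" ss arbitrary: p rule: list_induct2)
  case (Cons k "is" s ss)
  let ?i = "(k # is) ! p" and ?X = "sum_list (map xvar (k # is))"
  have X: "?X \<noteq> 0" by (rule sum_xvar_nonzero) simp
  have "count_list (k # is) ?i = 1"
    using Cons.prems by (intro count_list_distinct nth_mem) auto
  then have dX: "ratfun_pderiv ?i ?X = 1" unfolding ratfun_pderiv_sum_xvar by simp
  have A: "- ratfun_pderiv ?i (chen_fraction (k # is) (s # ss)) =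
      of_nat s * chen_fraction (k # is) (Suc s # ss) + 1 / ?X ^ s * (- ratfun_pderiv ?i (chen_fraction is ss))"
    unfolding chen_fraction_Cons ratfun_pderiv_mult ratfun_pderiv_inverse_power[OF X] dX by simp
  show ?case
  proof (cases p)
    case 0
    have "ratfun_pderiv k (chen_fraction is ss) = 0"
      using Cons by (intro ratfun_pderiv_chen_fraction_notin) auto
    then show ?thesis using A 0 by simp
  next
    case (Suc q)
    have IH: "- ratfun_pderiv (is ! q) (chen_fraction is ss) =
        (\<Sum>l\<le>q. of_nat (ss ! l) * chen_fraction is (ss[l := ss ! l + 1]))"
      using Cons.IH[of q] Cons.prems Suc by simp
    have "(\<Sum>l\<le>p. of_nat ((s # ss) ! l) * chen_fraction (k # is) ((s # ss)[l := (s # ss) ! l + 1])) =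
        of_nat s * chen_fraction (k # is) (Suc s # ss) +
        (\<Sum>l\<le>q. of_nat (ss ! l) * (1 / ?X ^ s * chen_fraction is (ss[l := ss ! l + 1])))"
      unfolding Suc by (subst sum.atMost_Suc_shift) (simp add: chen_fraction_Cons)
    then show ?thesis
      using A IH Suc by (simp add: sum_distrib_left mult_ac)
  qed
qed simp

lemma chen_index_update: "chen_index is ss \<Longrightarrow> j < length is \<Longrightarrow> chen_index is (ss[j := ss ! j + 1])"
  using set_update_subset_insert[of ss j "ss ! j + 1"] by (auto simp: chen_index_def)

lemma uminus_pderiv_chen_fraction_in_span:
  assumes "chen_index is ss"
  shows "- ratfun_pderiv i (chen_fraction is ss) \<in> ratvec.span chen_fractions"
proof (cases "i \<in> set is")
  case False
  then show ?thesis using assms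
    by (simp add: ratfun_pderiv_chen_fraction_notin chen_index_def ratvec.span_zero)
next
  case True
  then obtain p where p: "p < length is" "i = is ! p" by (auto simp: in_set_conv_nth)
  have s: "of_nat n * f \<in> ratvec.span chen_fractions" if "f \<in> ratvec.span chen_fractions" for n and f :: ratfun
    using ratvec.span_scale[OF that, of "of_nat n"] by (simp add: scaleQ_ratfun)
  have "- ratfun_pderiv i (chen_fraction is ss) =
      (\<Sum>l\<le>p. of_nat (ss ! l) * chen_fraction is (ss[l := ss ! l + 1]))"
    unfolding p(2) using assms p(1) by (intro ratfun_pderiv_chen_fraction) (auto simp: chen_index_def)
  also have "\<dots> \<in> ratvec.span chen_fractions"
    using assms p(1) by (intro ratvec.span_sum s chen_fraction_in_span chen_index_update) auto
  finally show ?thesis .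
qed

lemma linearQ_uminus_pderiv: "linearQ (\<lambda>f. - ratfun_pderiv i (ratfun_of f))"
  using linearQ_comp[OF linearQ_comp[OF linearQ_ratfun_of linearQ_ratfun_pderiv] linearQ_scaleQ[of "- 1"]]
  by (simp add: ratvec.scale_minus_left)

lemma uminus_pderiv_in_span: "- ratfun_pderiv i (ratfun_of f) \<in> ratvec.span chen_fractions"
  by (rule chen_span_linear[OF linearQ_uminus_pderiv chen_span_UNIV ratvec.subspace_span])
    (simp add: ratfun_of_Phi uminus_pderiv_chen_fraction_in_span)

lemma ratfun_of_chen_pd: "ratfun_of (chen_pd i f) = - ratfun_pderiv i (ratfun_of f)"
  unfolding chen_pd_def by (rule chen_of_inverse) (rule uminus_pderiv_in_span)

lemma linearQ_chen_pd: "linearQ (chen_pd i)"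
proof (rule linearQI)
  show "chen_pd i (x + y) = chen_pd i x + chen_pd i y" for x y
    by (simp add: ratfun_of_inject[symmetric] ratfun_of_chen_pd plus_chen.rep_eq ratfun_pderiv_add)
  show "chen_pd i (c *\<^sub>Q x) = c *\<^sub>Q chen_pd i x" for c x
    by (simp add: ratfun_of_inject[symmetric] ratfun_of_chen_pd scaleQ_chen.rep_eq
        linearQ_scale[OF linearQ_ratfun_pderiv])
qed

lemma chen_pd_commute: "chen_pd i (chen_pd j f) = chen_pd j (chen_pd i f)"
  by (simp add: ratfun_of_inject[symmetric] ratfun_of_chen_pd ratfun_pderiv_minus ratfun_pderiv_commute)

lemma chen_pd_Phi_notin: "chen_index is ss \<Longrightarrow> i \<notin> set is \<Longrightarrow> chen_pd i (Phi is ss) = 0"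
  by (simp add: ratfun_of_inject[symmetric] ratfun_of_chen_pd ratfun_of_Phi zero_chen.rep_eq
      ratfun_pderiv_chen_fraction_notin chen_index_length)

lemma chen_pd_Phi:
  assumes "chen_index is ss" "p < length is"
  shows "chen_pd (is ! p) (Phi is ss) = (\<Sum>l\<le>p. of_nat (ss ! l) *\<^sub>Q Phi is (ss[l := ss ! l + 1]))"
proof -
  have "ratfun_of (\<Sum>l\<le>p. of_nat (ss ! l) *\<^sub>Q Phi is (ss[l := ss ! l + 1])) =
      (\<Sum>l\<le>p. of_nat (ss ! l) * chen_fraction is (ss[l := ss ! l + 1]))"
    unfolding linearQ_sum[OF linearQ_ratfun_of] linearQ_scale[OF linearQ_ratfun_of] scaleQ_ratfun
    using assms by (intro sum.cong refl) (simp only: of_rat_of_nat_eq ratfun_of_Phi[OF chen_index_update] atMost_iff)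
  then show ?thesis
    using ratfun_pderiv_chen_fraction[of "is" ss p] assms
    by (simp add: ratfun_of_inject[symmetric] ratfun_of_chen_pd ratfun_of_Phi chen_index_def)
qed

text \<open>The pattern of \<open>chen_d\<close> for an arbitrary family \<delta>, so that it also
  applies to the corresponding operators on rational functions and on tensors.\<close>

definition index_diff :: "(nat \<Rightarrow> 'v \<Rightarrow> 'v::rat_vector) \<Rightarrow> nat list \<Rightarrow> nat \<Rightarrow> 'v \<Rightarrow> 'v"
  where "index_diff \<delta> is j v = (if j = 0 then \<delta> (is ! 0) v else \<delta> (is ! j) v - \<delta> (is ! (j - 1)) v)"

lemma chen_d_eq: "chen_d is j f = index_diff chen_pd is j f"
  by (simp add: chen_d_def index_diff_def)

lemma linearQ_index_diff: "(\<And>i. linearQ (\<delta> i)) \<Longrightarrow> linearQ (index_diff \<delta> is j)"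
  unfolding index_diff_def[abs_def] by (cases "j = 0") (simp_all add: linearQ_minus)

text \<open>The sum telescopes because the term at position 0 is \<delta> itself. This recovers a
  derivation from the differences.\<close>

lemma sum_index_diff: "(\<Sum>l\<le>p. index_diff \<delta> is l v) = \<delta> (is ! p) v"
  by (induction p) (simp_all add: index_diff_def)

text \<open>Subtracting the derivative at the preceding position cancels the terms of all factors
  before the one at \<open>j\<close>.\<close>

lemma chen_d_Phi:
  assumes "chen_index is ss" "j < length is"
  shows "index_diff chen_pd is j (Phi is ss) = of_nat (ss ! j) *\<^sub>Q Phi is (ss[j := ss ! j + 1])"
  using chen_pd_Phi[OF assms] chen_pd_Phi[OF assms(1), of "j - 1"] assms(2)
  by (cases j) (simp_all add: index_diff_def)

lemma chen_index_nth_pos: "chen_index is ss \<Longrightarrow> j < length is \<Longrightarrow> ss ! j \<ge> 1"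
  by (simp add: chen_index_def)

lemma Phi_update:
  assumes "chen_index is ss" "j < length is"
  shows "Phi is (ss[j := ss ! j + 1]) = (1 / of_nat (ss ! j)) *\<^sub>Q index_diff chen_pd is j (Phi is ss)"
  using chen_index_nth_pos[OF assms] by (simp add: chen_d_Phi[OF assms])

text \<open>Lowering exponents that exceed 1 ends at the list of ones. The step raises an exponent,
  which is how the coproduct is specified and what \<open>index_diff chen_pd\<close> does up to a
  scalar.\<close>

lemma chen_exponent_induct [consumes 1, case_names ones step]:
  assumes "chen_index is ss"
    and "chen_index is (replicate (length is) 1) \<Longrightarrow> P (replicate (length is) 1)"
    and "\<And>ts j. chen_index is ts \<Longrightarrow> j < length is \<Longrightarrow> P ts \<Longrightarrow> P (ts[j := ts ! j + 1])"
  shows "P ss"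
  using assms(1)
proof (induction "sum_list ss" arbitrary: ss rule: less_induct)
  case (less ss)
  show ?case
  proof (cases "\<forall>j<length is. ss ! j = 1")
    case True
    then have "ss = replicate (length is) 1"
      using less.prems by (intro nth_equalityI) (simp_all add: chen_index_def)
    then show ?thesis using assms(2) less.prems by simp
  next
    case False
    then obtain j where j: "j < length is" "ss ! j > 1"
      using chen_index_nth_pos[OF less.prems] by (metis le_neq_implies_less)
    define ts where "ts = ss[j := ss ! j - 1]"
    have len: "length ss = length is" using less.prems by (simp add: chen_index_def)
    have i: "chen_index is ts"
      using less.prems j(2) set_update_subset_insert[of ss j "ss ! j - 1"]
      by (auto simp: chen_index_def ts_def)
    have ss: "ss = ts[j := ts ! j + 1]" using j len by (simp add: ts_def)
    have "sum_list ts < sum_list ss"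
      using j len elem_le_sum_list[of j ss] by (simp add: ts_def sum_list_update)
    then show ?thesis using less.hyps[of ts] i assms(3)[of ts j] j(1) ss by simp
  qed
qed

section \<open>Maps intertwining the derivations with given operators\<close>

lemma chen_intertwiner_index_diff:
  assumes "linearQ T" "\<And>i f. T (chen_pd i f) = \<delta> i (T f)"
  shows "T (index_diff chen_pd is j f) = index_diff \<delta> is j (T f)"
  by (simp add: index_diff_def linearQ_diff[OF assms(1)] assms(2))

lemma chen_intertwiner_Phi_update:
  assumes "linearQ T" "\<And>i f. T (chen_pd i f) = \<delta> i (T f)" "chen_index is ss" "j < length is"
  shows "T (Phi is (ss[j := ss ! j + 1])) = (1 / of_nat (ss ! j)) *\<^sub>Q index_diff \<delta> is j (T (Phi is ss))"
  unfolding Phi_update[OF assms(3,4)] linearQ_scale[OF assms(1)]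
    chen_intertwiner_index_diff[of T \<delta>, OF assms(1,2)] ..

text \<open>An intertwiner carries \<open>index_diff chen_pd\<close>, which raises exponents, to
  \<open>index_diff \<delta>\<close>, so its values on exponents 1 propagate to all others.
  Coassociativity, the counit laws and the antipode identities are proved through this
  principle.\<close>

lemma chen_intertwiner_eq:
  assumes "linearQ T" "\<And>i f. T (chen_pd i f) = \<delta> i (T f)"
    and "linearQ T'" "\<And>i f. T' (chen_pd i f) = \<delta> i (T' f)"
    and "\<And>is. chen_index is (replicate (length is) 1) \<Longrightarrow> T (Phi1 is) = T' (Phi1 is)"
  shows "T f = T' f"
proof (rule chen_linear_eq[OF assms(1,3)])
  fix "is" ss assume "chen_index is ss"
  then show "T (Phi is ss) = T' (Phi is ss)"
  proof (induction rule: chen_exponent_induct)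
    case ones
    then show ?case by (rule assms(5))
  next
    case (step ts j)
    then show ?case
      by (simp only: chen_intertwiner_Phi_update[of T \<delta>, OF assms(1,2)]
          chen_intertwiner_Phi_update[of T' \<delta>, OF assms(3,4)])
  qed
qed

text \<open>The composite of the divided powers \<open>D j ^^ (s - 1) / (s - 1)!\<close> over all
  positions \<open>j\<close>. Iterating \<open>chen_d_Phi\<close> shows that for
  \<open>D = index_diff chen_pd is\<close> it carries \<open>Phi1 is\<close> to
  \<open>Phi is ss\<close>, which dictates the extension formula in
  \<open>chen_extend\<close>.\<close>

fun divided_powers :: "(nat \<Rightarrow> 'v \<Rightarrow> 'v::rat_vector) \<Rightarrow> nat list \<Rightarrow> 'v \<Rightarrow> 'v" where
  "divided_powers D [] v = v"
| "divided_powers D (s # ss) v = (1 / fact (s - 1)) *\<^sub>Q (D 0 ^^ (s - 1)) (divided_powers (\<lambda>j. D (Suc j)) ss v)"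

lemma funpow_commute:
  assumes "\<And>v. f (g v) = g (f v)"
  shows "f ((g ^^ n) v) = (g ^^ n) (f v)"
  by (induction n) (simp_all add: assms)

text \<open>\<open>E\<close> commutes with every operator in the composite and can be moved inwards
  until it meets \<open>v\<close>.\<close>

lemma divided_powers_zero:
  assumes "linearQ E" "\<And>j. linearQ (D j)" "\<And>j v. E (D j v) = D j (E v)" "E v = 0"
  shows "E (divided_powers D ss v) = 0"
  using assms(2,3)
proof (induction ss arbitrary: D)
  case (Cons s ss)
  have "E (divided_powers (\<lambda>j. D (Suc j)) ss v) = 0"
    using Cons.prems by (intro Cons.IH) auto
  then show ?case
    using Cons.prems
    by (simp add: linearQ_scale[OF assms(1)] funpow_commute linearQ_zero[OF linearQ_funpow])
qed (simp add: assms(4))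

text \<open>\<open>D l\<close> can be moved to its own block, where a divided power satisfies
  \<open>D (D ^^ (s - 1) / (s - 1)!) = s (D ^^ s / s!)\<close>.\<close>

lemma divided_powers_update:
  assumes "\<And>j. linearQ (D j)" "\<And>i j v. D i (D j v) = D j (D i v)"
    and "l < length ss" "\<forall>s\<in>set ss. s \<ge> 1"
  shows "D l (divided_powers D ss v) = of_nat (ss ! l) *\<^sub>Q divided_powers D (ss[l := ss ! l + 1]) v"
  using assms
proof (induction ss arbitrary: D l)
  case (Cons s ss)
  let ?w = "divided_powers (\<lambda>j. D (Suc j)) ss v"
  show ?case
  proof (cases l)
    case 0
    obtain r where s: "s = Suc r" using Cons.prems(4) by (cases s) auto
    have "(1 / fact r :: rat) = of_nat (Suc r) * (1 / fact (Suc r))"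
      by (simp del: of_nat_Suc)
    then show ?thesis
      using 0 s by (simp add: linearQ_scale[OF Cons.prems(1)])
  next
    case (Suc q)
    have "D l ?w = of_nat (ss ! q) *\<^sub>Q divided_powers (\<lambda>j. D (Suc j)) (ss[q := ss ! q + 1]) v"
      unfolding Suc using Cons.prems Suc by (intro Cons.IH) auto
    then have "D l ((D 0 ^^ (s - 1)) ?w) =
        of_nat (ss ! q) *\<^sub>Q (D 0 ^^ (s - 1)) (divided_powers (\<lambda>j. D (Suc j)) (ss[q := ss ! q + 1]) v)"
      by (simp add: funpow_commute[of "D l" "D 0"] Cons.prems(2)[of l 0] linearQ_scale[OF linearQ_funpow[OF Cons.prems(1)]])
    then show ?thesis
      using Suc by (simp add: linearQ_scale[OF Cons.prems(1)] mult.commute)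
  qed
qed simp

text \<open>In the source the derivations commute and foreign ones kill \<open>Phi1 is\<close>. If
  the operators and values in the target obey the same two rules, applying divided powers there
  gives the extension. The coproduct and the antipode both arise from this construction.\<close>

lemma chen_extend:
  fixes \<delta> :: "nat \<Rightarrow> 'v \<Rightarrow> 'v::rat_vector"
  assumes lin: "\<And>i. linearQ (\<delta> i)" and comm: "\<And>i j v. \<delta> i (\<delta> j v) = \<delta> j (\<delta> i v)"
    and zero: "\<And>is i. chen_index is (replicate (length is) 1) \<Longrightarrow> i \<notin> set is \<Longrightarrow> \<delta> i (\<phi> is) = 0"
  obtains T where "linearQ T" "\<And>is. chen_index is (replicate (length is) 1) \<Longrightarrow> T (Phi1 is) = \<phi> is"
    "\<And>i f. T (chen_pd i f) = \<delta> i (T f)"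
proof -
  let ?E = "\<lambda>is ss. divided_powers (index_diff \<delta> is) ss (\<phi> is)"
  obtain T where T: "linearQ T" "\<And>is ss. chen_index is ss \<Longrightarrow> T (Phi is ss) = ?E is ss"
    using chen_linear_exists[of ?E] by blast
  have dlin: "linearQ (index_diff \<delta> is j)" for "is" j by (rule linearQ_index_diff) (rule lin)
  have dcomm: "\<delta> i (index_diff \<delta> is j v) = index_diff \<delta> is j (\<delta> i v)" for i "is" j v
    by (simp add: index_diff_def linearQ_diff[OF lin] comm[of i])
  have dcomm2: "index_diff \<delta> is i (index_diff \<delta> js j v) = index_diff \<delta> js j (index_diff \<delta> is i v)" for i "is" js j v
    unfolding index_diff_def[of _ "is" i] by (simp add: linearQ_diff[OF dlin] dcomm)
  have "T (Phi1 is) = \<phi> is" if i: "chen_index is (replicate (length is) 1)" for "is"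
  proof -
    have "divided_powers D (replicate n 1) v = v" for D n and v :: 'v
      by (induction n arbitrary: D) simp_all
    then show ?thesis using T(2)[OF i] by simp
  qed
  moreover have "T (chen_pd i f) = \<delta> i (T f)" for i f
  proof (rule chen_linear_eq[OF linearQ_comp[OF linearQ_chen_pd T(1)] linearQ_comp[OF T(1) lin]])
    fix "is" ss assume i: "chen_index is ss"
    show "T (chen_pd i (Phi is ss)) = \<delta> i (T (Phi is ss))"
    proof (cases "i \<in> set is")
      case False
      have z: "\<delta> i (\<phi> is) = 0"
        using False i by (intro zero) (auto simp: chen_index_def)
      have "\<delta> i (?E is ss) = 0"
        by (rule divided_powers_zero[OF lin dlin dcomm z])
      then show ?thesis
        using False i T(2)[OF i] by (simp add: chen_pd_Phi_notin linearQ_zero[OF T(1)])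
    next
      case True
      then obtain p where p: "p < length is" "i = is ! p" by (auto simp: in_set_conv_nth)
      \<comment> \<open>A derivative in a variable of \<open>is\<close> is the sum of the
        differences up to its position, and each of them raises one exponent.\<close>
      have "T (chen_pd i (Phi is ss)) = (\<Sum>l\<le>p. of_nat (ss ! l) *\<^sub>Q T (Phi is (ss[l := ss ! l + 1])))"
        unfolding p(2) chen_pd_Phi[OF i p(1)] by (simp only: linearQ_sum[OF T(1)] linearQ_scale[OF T(1)])
      also have "\<dots> = (\<Sum>l\<le>p. index_diff \<delta> is l (?E is ss))"
      proof (rule sum.cong[OF refl])
        fix l assume "l \<in> {..p}"
        then have l: "l < length is" using p by simp
        have "index_diff \<delta> is l (?E is ss) = of_nat (ss ! l) *\<^sub>Q ?E is (ss[l := ss ! l + 1])"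
          using i l by (intro divided_powers_update[OF dlin dcomm2]) (auto simp: chen_index_def)
        then show "of_nat (ss ! l) *\<^sub>Q T (Phi is (ss[l := ss ! l + 1])) = index_diff \<delta> is l (?E is ss)"
          by (simp only: T(2)[OF chen_index_update[OF i l]])
      qed
      also have "\<dots> = \<delta> i (T (Phi is ss))" unfolding sum_index_diff p(2) T(2)[OF i] ..
      finally show ?thesis .
    qed
  qed
  ultimately show ?thesis using that T(1) by blast
qed

text \<open>A derivative keeps the index list and produces terms with one exponent raised, so it is
  enough to follow the predicate along one increment.\<close>

lemma chen_pd_span:
  assumes "f \<in> chen_span P"
    and "\<And>is ss j. chen_index is ss \<Longrightarrow> P is ss \<Longrightarrow> j < length is \<Longrightarrow> Q is (ss[j := ss ! j + 1])"
  shows "chen_pd i f \<in> chen_span Q"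
proof (rule chen_span_linear[OF linearQ_chen_pd assms(1) subspace_chen_span])
  fix "is" ss assume a: "chen_index is ss" "P is ss"
  show "chen_pd i (Phi is ss) \<in> chen_span Q"
  proof (cases "i \<in> set is")
    case False
    then show ?thesis using a by (simp add: chen_pd_Phi_notin ratvec.subspace_0[OF subspace_chen_span])
  next
    case True
    then obtain p where p: "p < length is" "i = is ! p" by (auto simp: in_set_conv_nth)
    show ?thesis
      unfolding p(2) chen_pd_Phi[OF a(1) p(1)]
      by (intro ratvec.subspace_sum[OF subspace_chen_span] ratvec.subspace_scale[OF subspace_chen_span]
          Phi_in_chen_span chen_index_update a assms(2)) (use p in auto)
  qed
qed

lemma chen_pd_over: "f \<in> chen_over A \<Longrightarrow> chen_pd i f \<in> chen_over A"
  unfolding chen_over_def by (rule chen_pd_span)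

lemma sum_list_increment: "j < length ss \<Longrightarrow> sum_list (ss[j := ss ! j + 1]) = Suc (sum_list ss)"
  using elem_le_sum_list[of j ss] by (simp add: sum_list_update)

section \<open>Sums over shuffles and over deconcatenations\<close>

text \<open>Interleavings are counted with multiplicity, unlike in the set \<open>shuffles\<close>.
  Collecting the chosen letters inside the summand makes the recursion that of the shuffle
  product.\<close>

fun shuffle_sum :: "('a list \<Rightarrow> 'b::comm_monoid_add) \<Rightarrow> 'a list \<Rightarrow> 'a list \<Rightarrow> 'b" where
  "shuffle_sum f [] js = f js"
| "shuffle_sum f (i # is) [] = f (i # is)"
| "shuffle_sum f (i # is) (j # js) =
    shuffle_sum (\<lambda>w. f (i # w)) is (j # js) + shuffle_sum (\<lambda>w. f (j # w)) (i # is) js"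

lemma shuffle_sum_Nil2 [simp]: "shuffle_sum f is [] = f is"
  by (cases "is") simp_all

lemma shuffle_sum_add:
  "shuffle_sum (\<lambda>w. f w + g w) is js = shuffle_sum f is js + shuffle_sum g is js"
  by (induction f "is" js arbitrary: g rule: shuffle_sum.induct) (simp_all, simp add: ac_simps)

lemma shuffle_sum_hom:
  "(\<And>x y. T (x + y) = T x + T y) \<Longrightarrow> T (shuffle_sum f is js) = shuffle_sum (\<lambda>w. T (f w)) is js"
  by (induction f "is" js rule: shuffle_sum.induct) simp_all

lemma shuffle_sum_cong:
  "(\<And>w. w \<in> shuffles is js \<Longrightarrow> f w = g w) \<Longrightarrow> shuffle_sum f is js = shuffle_sum g is js"
  by (induction f "is" js arbitrary: g rule: shuffle_sum.induct) auto

lemma shuffle_sum_mem: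
  "ratvec.subspace W \<Longrightarrow> (\<And>w. w \<in> shuffles is js \<Longrightarrow> f w \<in> W) \<Longrightarrow> shuffle_sum f is js \<in> W"
  by (induction f "is" js rule: shuffle_sum.induct) (auto intro!: ratvec.subspace_add)

lemma sum_list_shuffles:
  fixes f :: "'a \<Rightarrow> 'b::comm_monoid_add"
  shows "w \<in> shuffles is js \<Longrightarrow> sum_list (map f w) = sum_list (map f is) + sum_list (map f js)"
  by (induction "is" js arbitrary: w rule: shuffles.induct) (auto simp: ac_simps)

text \<open>Interleavings can be classified by their last letter as well as by their first; this is
  what reversal in \<open>shuffle_sum_rev\<close> requires.\<close>

lemma shuffle_sum_snoc:
  "shuffle_sum f (is @ [i]) (js @ [j]) =
    shuffle_sum (\<lambda>w. f (w @ [i])) is (js @ [j]) + shuffle_sum (\<lambda>w. f (w @ [j])) (is @ [i]) js"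
proof (induction f "is" js rule: shuffle_sum.induct)
  case (1 f js)
  show ?case by (induction js arbitrary: f) (simp_all add: ac_simps)
next
  case (2 f a "is")
  have "shuffle_sum f (xs @ [i]) [j] = shuffle_sum (\<lambda>w. f (w @ [i])) xs [j] + f (xs @ [i, j])" for xs
    by (induction xs arbitrary: f) (simp_all add: ac_simps)
  from this[of "a # is"] show ?case by simp
next
  case (3 f a "is" b js)
  then show ?case by (simp add: ac_simps)
qed

lemma shuffle_sum_rev: "shuffle_sum f (rev is) (rev js) = shuffle_sum (\<lambda>w. f (rev w)) is js"
  by (induction "\<lambda>w. f (rev w)" "is" js arbitrary: f rule: shuffle_sum.induct)
    (simp_all add: shuffle_sum_snoc)

section \<open>Sums over deconcatenations\<close>

fun cut_sum :: "('a list \<Rightarrow> 'a list \<Rightarrow> 'b::comm_monoid_add) \<Rightarrow> 'a list \<Rightarrow> 'b" where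
  "cut_sum G [] = G [] []"
| "cut_sum G (i # w) = G [] (i # w) + cut_sum (\<lambda>u v. G (i # u) v) w"

lemma cut_sum_eq: "cut_sum G w = (\<Sum>j\<le>length w. G (take j w) (drop j w))"
  by (induction G w rule: cut_sum.induct) (simp_all add: sum.atMost_Suc_shift del: sum.atMost_Suc)

lemma cut_sum_add: "cut_sum (\<lambda>u v. F u v + G u v) w = cut_sum F w + cut_sum G w"
  by (simp add: cut_sum_eq sum.distrib)

lemma cut_sum_hom:
  assumes "\<And>x y. T (x + y) = T x + T y"
  shows "T (cut_sum G w) = cut_sum (\<lambda>u v. T (G u v)) w"
  using assms by (induction G w rule: cut_sum.induct) simp_all

lemma cut_sum_cong: "(\<And>u v. u @ v = w \<Longrightarrow> F u v = G u v) \<Longrightarrow> cut_sum F w = cut_sum G w"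
  unfolding cut_sum_eq by (rule sum.cong) simp_all

text \<open>Both sides run over the ways of writing \<open>w\<close> as a concatenation of three
  lists.\<close>

lemma cut_sum_assoc:
  "cut_sum (\<lambda>u v. cut_sum (\<lambda>a b. G a b v) u) w = cut_sum (\<lambda>a v. cut_sum (\<lambda>b c. G a b c) v) w"
  by (induction w arbitrary: G) (simp_all add: cut_sum_add add.assoc)

text \<open>Cutting an interleaving cuts both lists, and its prefix and suffix interleave the
  respective pieces. This compatibility of shuffle and deconcatenation is the combinatorial core of
  multiplicativity of the coproduct.\<close>

lemma shuffle_sum_cut_sum:
  "shuffle_sum (cut_sum G) is js =
    cut_sum (\<lambda>a b. cut_sum (\<lambda>c d. shuffle_sum (\<lambda>u. shuffle_sum (G u) b d) a c) js) is"
proof (induction "is" arbitrary: G js)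
  case Nil
  have "shuffle_sum (G c) [] = G c" for c by (rule ext) simp
  then show ?case by simp
next
  case (Cons i "is")
  note IH = this
  show ?case
  proof (induction js arbitrary: G)
    case (Cons j js)
    show ?case
      by (simp add: shuffle_sum_add IH Cons cut_sum_add) (simp add: ac_simps)
  qed simp
qed

text \<open>The alternating sum telescopes: the two summands of the shuffle recursion cancel between
  consecutive cuts.\<close>

lemma alternating_shuffle_sum_Cons:
  fixes f :: "'a list \<Rightarrow> 'b::comm_ring_1"
  shows "cut_sum (\<lambda>u v. (- 1) ^ length u * shuffle_sum f (rev u @ (a # r)) v) w = shuffle_sum (\<lambda>w. f (a # w)) r w"
proof (induction w arbitrary: a r)
  case (Cons b w)
  have "cut_sum (\<lambda>u v. (- 1) ^ length (b # u) * shuffle_sum f (rev (b # u) @ (a # r)) v) w =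
      - cut_sum (\<lambda>u v. (- 1) ^ length u * shuffle_sum f (rev u @ (b # a # r)) v) w"
    by (simp add: cut_sum_eq sum_negf)
  then show ?case by (simp add: Cons)
qed simp

text \<open>The empty prefix contributes \<open>f w\<close>. All other prefixes begin with the first
  letter of \<open>w\<close>, and their alternating sum is \<open>- f w\<close> by
  \<open>alternating_shuffle_sum_Cons\<close> with empty \<open>r\<close>.\<close>

lemma alternating_shuffle_sum:
  fixes f :: "'a list \<Rightarrow> 'b::comm_ring_1"
  assumes "w \<noteq> []"
  shows "cut_sum (\<lambda>u v. (- 1) ^ length u * shuffle_sum f (rev u) v) w = 0"
proof -
  obtain b v where w: "w = b # v" using assms by (cases w) auto
  have "cut_sum (\<lambda>u v. (- 1) ^ length (b # u) * shuffle_sum f (rev (b # u)) v) v =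
      - cut_sum (\<lambda>u v. (- 1) ^ length u * shuffle_sum f (rev u @ [b]) v) v"
    by (simp add: cut_sum_eq sum_negf)
  then show ?thesis using alternating_shuffle_sum_Cons[of f b "[]" v] by (simp add: w)
qed


section \<open>Products of Chen fractions\<close>

text \<open>With \<open>X\<close> and \<open>Y\<close> the total sums of the two lists, every
  shuffle has outermost factor \<open>1 / (X + Y)\<close>. The identity
  \<open>1 / (X * Y) = (1 / X + 1 / Y) / (X + Y)\<close> is then the shuffle recursion.\<close>

lemma chen_fraction_ones_mult:
  "chen_fraction is (replicate (length is) 1) * chen_fraction js (replicate (length js) 1) =
    shuffle_sum (\<lambda>w. chen_fraction w (replicate (length w) 1)) is js"
proof (induction "is" arbitrary: js)
  case (Cons i "is")
  note IH = this
  let ?F = "\<lambda>w. chen_fraction w (replicate (length w) 1)"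
  show ?case
  proof (induction js)
    case (Cons j js)
    let ?X = "sum_list (map xvar (i # is))" and ?Y = "sum_list (map xvar (j # js))"
    have nz: "?X \<noteq> 0" "?Y \<noteq> 0" "?X + ?Y \<noteq> 0"
      using sum_xvar_nonzero[of "i # is"] sum_xvar_nonzero[of "j # js"] sum_xvar_nonzero[of "(i # is) @ (j # js)"]
      by (simp_all add: add.assoc)
    have F: "?F (k # w) = 1 / sum_list (map xvar (k # w)) * ?F w" for k w
      by (simp add: chen_fraction_Cons)
    have "shuffle_sum (\<lambda>w. ?F (i # w)) is (j # js) = shuffle_sum (\<lambda>w. 1 / (?X + ?Y) * ?F w) is (j # js)"
      unfolding F by (rule shuffle_sum_cong) (simp add: sum_list_shuffles[where f = xvar] add.assoc)
    also have "\<dots> = 1 / (?X + ?Y) * shuffle_sum ?F is (j # js)"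
      by (rule shuffle_sum_hom[symmetric]) (rule distrib_left)
    finally have 1: "shuffle_sum (\<lambda>w. ?F (i # w)) is (j # js) = 1 / (?X + ?Y) * (?F is * ?F (j # js))"
      using IH[of "j # js"] by simp
    have "shuffle_sum (\<lambda>w. ?F (j # w)) (i # is) js = shuffle_sum (\<lambda>w. 1 / (?X + ?Y) * ?F w) (i # is) js"
      unfolding F by (rule shuffle_sum_cong) (simp add: sum_list_shuffles[where f = xvar] ac_simps)
    also have "\<dots> = 1 / (?X + ?Y) * shuffle_sum ?F (i # is) js"
      by (rule shuffle_sum_hom[symmetric]) (rule distrib_left)
    finally have 2: "shuffle_sum (\<lambda>w. ?F (j # w)) (i # is) js = 1 / (?X + ?Y) * (?F (i # is) * ?F js)"
      using Cons by simp
    have "?F (i # is) * ?F (j # js) = 1 / (?X + ?Y) * (?F is * ?F (j # js)) + 1 / (?X + ?Y) * (?F (i # is) * ?F js)"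
    proof -
      have "a / X * (b / Y) = 1 / (X + Y) * (a * (b / Y)) + 1 / (X + Y) * (a / X * b)"
        if "X \<noteq> 0" "Y \<noteq> 0" "X + Y \<noteq> 0" for a b X Y :: ratfun
        using that by (simp add: divide_simps) (simp add: algebra_simps)
      from this[OF nz, of "?F is" "?F js"] show ?thesis unfolding F[of i "is"] F[of j js] by (simp only: times_divide_eq_left mult_1)
    qed
    then show ?case by (simp only: shuffle_sum.simps 1 2)
  qed simp
qed simp

lemma chen_pair_induct [consumes 2, case_names ones left right]:
  assumes "chen_index is ss" "chen_index js ts"
    and "chen_index is (replicate (length is) 1) \<Longrightarrow> chen_index js (replicate (length js) 1) \<Longrightarrow>
      R (replicate (length is) 1) (replicate (length js) 1)"
    and "\<And>ss ts j. chen_index is ss \<Longrightarrow> chen_index js ts \<Longrightarrow> j < length is \<Longrightarrow> R ss ts \<Longrightarrow> R (ss[j := ss ! j + 1]) ts"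
    and "\<And>ss ts j. chen_index is ss \<Longrightarrow> chen_index js ts \<Longrightarrow> j < length js \<Longrightarrow> R ss ts \<Longrightarrow> R ss (ts[j := ts ! j + 1])"
  shows "R ss ts"
  using assms(2)
proof (induction rule: chen_exponent_induct)
  case ones
  note js = this
  show ?case
    using assms(1)
  proof (induction rule: chen_exponent_induct)
    case ones then show ?case using js by (rule assms(3))
  next
    case (step us j) then show ?case using js by (intro assms(4))
  qed
next
  case (step us j)
  then show ?case by (intro assms(5) assms(1))
qed

abbreviation (input) ratfun_nd :: "nat \<Rightarrow> ratfun \<Rightarrow> ratfun"
  where "ratfun_nd i f \<equiv> - ratfun_pderiv i f"

text \<open>The operators differentiate only in variables of \<open>is\<close>, which the second
  factor does not contain, so the product rule leaves it untouched. Exponents in a product can thus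
  be raised one at a time.\<close>

lemma chen_fraction_update_mult:
  assumes "chen_index is ss" "chen_index js ts" "set is \<inter> set js = {}" "j < length is"
  shows "chen_fraction is (ss[j := ss ! j + 1]) * chen_fraction js ts =
    (1 / of_nat (ss ! j)) *\<^sub>Q index_diff ratfun_nd is j (chen_fraction is ss * chen_fraction js ts)"
proof -
  have 1: "chen_fraction is (ss[j := ss ! j + 1]) =
      (1 / of_nat (ss ! j)) *\<^sub>Q index_diff ratfun_nd is j (chen_fraction is ss)"
    using chen_intertwiner_Phi_update[of ratfun_of ratfun_nd, OF linearQ_ratfun_of ratfun_of_chen_pd assms(1,4)]
    by (simp only: ratfun_of_Phi[OF assms(1)] ratfun_of_Phi[OF chen_index_update[OF assms(1,4)]])
  have z: "ratfun_pderiv (is ! l) (chen_fraction js ts) = 0" if "l < length is" for l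
  proof (rule ratfun_pderiv_chen_fraction_notin)
    show "is ! l \<notin> set js" using nth_mem[OF that] assms(3) by blast
  qed (use assms(2) in \<open>simp add: chen_index_def\<close>)
  have "index_diff ratfun_nd is j (chen_fraction is ss * chen_fraction js ts) =
      index_diff ratfun_nd is j (chen_fraction is ss) * chen_fraction js ts"
    using z[of j] z[of "j - 1"] assms(4)
    by (cases "j = 0") (simp_all add: index_diff_def ratfun_pderiv_mult algebra_simps)
  then show ?thesis unfolding 1 by (simp add: scaleQ_ratfun)
qed

lemma subspace_ratfun_of_chen_span: "ratvec.subspace (ratfun_of ` chen_span P)"
  by (rule ratvec_pair.linear_subspace_image[OF linearQ_ratfun_of subspace_chen_span])

lemma chen_fraction_update_mult_span:
  assumes "chen_index is ss" "chen_index js ts" "set is \<inter> set js = {}" "j < length is"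
    and "chen_fraction is ss * chen_fraction js ts \<in> ratfun_of ` chen_span (\<lambda>ks us. set ks = A \<and> sum_list us = n)"
  shows "chen_fraction is (ss[j := ss ! j + 1]) * chen_fraction js ts \<in>
    ratfun_of ` chen_span (\<lambda>ks us. set ks = A \<and> sum_list us = Suc n)"
proof -
  obtain f where f: "f \<in> chen_span (\<lambda>ks us. set ks = A \<and> sum_list us = n)"
    "chen_fraction is ss * chen_fraction js ts = ratfun_of f" using assms(5) by blast
  have pd: "chen_pd i f \<in> chen_span (\<lambda>ks us. set ks = A \<and> sum_list us = Suc n)" for i
    by (rule chen_pd_span[OF f(1)]) (simp add: sum_list_increment[unfolded Suc_eq_plus1[symmetric]] chen_index_length)
  have "index_diff chen_pd is j f \<in> chen_span (\<lambda>ks us. set ks = A \<and> sum_list us = Suc n)"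
    unfolding index_diff_def using pd by (auto intro: ratvec.subspace_diff[OF subspace_chen_span])
  moreover have "index_diff ratfun_nd is j (ratfun_of f) = ratfun_of (index_diff chen_pd is j f)"
    by (rule chen_intertwiner_index_diff[symmetric, OF linearQ_ratfun_of ratfun_of_chen_pd])
  ultimately show ?thesis
    unfolding chen_fraction_update_mult[OF assms(1-4)] f(2)
    by (auto intro!: ratvec.subspace_scale[OF subspace_ratfun_of_chen_span])
qed

text \<open>For exponents 1 the terms are indexed by shuffles, which have no repetitions because the
  variables are disjoint. Raising an exponent means applying derivatives, which keep the variables
  and increase the degree by 1.\<close>

lemma chen_fraction_mult_span:
  assumes "chen_index is ss" "chen_index js ts" "set is \<inter> set js = {}"
  shows "chen_fraction is ss * chen_fraction js ts \<in>
    ratfun_of ` chen_span (\<lambda>ks us. set ks = set is \<union> set js \<and> sum_list us = sum_list ss + sum_list ts)"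
  using assms(1,2)
proof (induction rule: chen_pair_induct)
  case ones
  show ?case
    unfolding chen_fraction_ones_mult
  proof (rule shuffle_sum_mem[OF subspace_ratfun_of_chen_span])
    fix w assume w: "w \<in> shuffles is js"
    have "chen_index w (replicate (length w) 1)"
      using ones assms(3) w distinct_disjoint_shuffles[of "is" js w] set_shuffles[OF w] by (auto simp: chen_index_def)
    then show "chen_fraction w (replicate (length w) 1) \<in> ratfun_of ` chen_span (\<lambda>ks us.
        set ks = set is \<union> set js \<and> sum_list us = sum_list (replicate (length is) 1) + sum_list (replicate (length js) 1))"
      using set_shuffles[OF w] length_shuffles[OF w]
      by (intro image_eqI[of _ _ "Phi1 w"] Phi_in_chen_span) (simp_all add: ratfun_of_Phi sum_list_replicate)
  qed
next
  case (left ss ts j)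
  then show ?case
    using chen_fraction_update_mult_span[OF left(1,2) assms(3) left(3) left(4)]
    by (simp only: sum_list_increment chen_index_length add_Suc)
next
  case (right ss ts j)
  have "set js \<inter> set is = {}" using assms(3) by blast
  from chen_fraction_update_mult_span[OF right(2,1) this right(3)] right
  show ?case
    by (simp only: sum_list_increment chen_index_length add_Suc_right mult.commute)
qed

text \<open>Tracking variables and degree through predicates lets one bilinear extension serve both
  locality and the grading.\<close>

lemma chen_product_span:
  assumes "f \<in> chen_span P" "g \<in> chen_span Q"
    and "\<And>is ss js ts. chen_index is ss \<Longrightarrow> P is ss \<Longrightarrow> chen_index js ts \<Longrightarrow> Q js ts \<Longrightarrow> set is \<inter> set js = {}"
    and "\<And>is ss js ts ks us. chen_index is ss \<Longrightarrow> P is ss \<Longrightarrow> chen_index js ts \<Longrightarrow> Q js ts \<Longrightarrow>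
      chen_index ks us \<Longrightarrow> set ks = set is \<union> set js \<Longrightarrow> sum_list us = sum_list ss + sum_list ts \<Longrightarrow> R ks us"
  shows "ratfun_of f * ratfun_of g \<in> ratfun_of ` chen_span R"
proof (rule chen_span_linear[OF _ assms(1) subspace_ratfun_of_chen_span])
  show "linearQ (\<lambda>f. ratfun_of f * ratfun_of g)"
    by (rule linearQ_comp[OF linearQ_ratfun_of bilinearQ_left[OF bilinearQ_ratfun_times]])
  fix "is" ss assume i: "chen_index is ss" "P is ss"
  show "ratfun_of (Phi is ss) * ratfun_of g \<in> ratfun_of ` chen_span R"
  proof (rule chen_span_linear[OF _ assms(2) subspace_ratfun_of_chen_span])
    show "linearQ (\<lambda>g. ratfun_of (Phi is ss) * ratfun_of g)"
      by (rule linearQ_comp[OF linearQ_ratfun_of bilinearQ_right[OF bilinearQ_ratfun_times]])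
    fix js ts assume j: "chen_index js ts" "Q js ts"
    have "ratfun_of (Phi is ss) * ratfun_of (Phi js ts) \<in>
        ratfun_of ` chen_span (\<lambda>ks us. set ks = set is \<union> set js \<and> sum_list us = sum_list ss + sum_list ts)"
      unfolding ratfun_of_Phi[OF i(1)] ratfun_of_Phi[OF j(1)]
      by (rule chen_fraction_mult_span[OF i(1) j(1) assms(3)[OF i j]])
    then obtain h where h: "ratfun_of (Phi is ss) * ratfun_of (Phi js ts) = ratfun_of h"
      "h \<in> chen_span (\<lambda>ks us. set ks = set is \<union> set js \<and> sum_list us = sum_list ss + sum_list ts)"
      by blast
    have "h \<in> chen_span R"
      by (rule chen_span_mono[OF h(2)]) (elim conjE, rule assms(4)[OF i j])
    then show "ratfun_of (Phi is ss) * ratfun_of (Phi js ts) \<in> ratfun_of ` chen_span R"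
      unfolding h(1) by (rule imageI)
  qed
qed

lemma chen_loc_product_over:
  assumes "f \<in> chen_over A" "g \<in> chen_over B" "A \<inter> B = {}"
  shows "ratfun_of f * ratfun_of g \<in> ratfun_of ` chen_over (A \<union> B)"
  using assms(1,2) unfolding chen_over_def
  by (rule chen_product_span) (use assms(3) in blast)+

lemma chen_loc_product_in_span:
  assumes "chen_loc f g"
  shows "ratfun_of f * ratfun_of g \<in> ratvec.span chen_fractions"
  using chen_loc_product_over[OF chen_over_vars chen_over_vars assms[unfolded chen_loc_iff]] ratfun_of by auto

lemma ratfun_of_chen_mult: "chen_loc f g \<Longrightarrow> ratfun_of (chen_mult f g) = ratfun_of f * ratfun_of g"
  unfolding chen_mult_def by (rule chen_of_inverse) (rule chen_loc_product_in_span)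

text \<open>\<open>chen_of\<close> is specified only on the span. Exhibiting \<open>h\<close> proves
  membership of the product and computes it at the same time.\<close>

lemma chen_multI: "ratfun_of h = ratfun_of f * ratfun_of g \<Longrightarrow> chen_mult f g = h"
  unfolding chen_mult_def by (drule sym) (simp add: ratfun_of_inverse)

lemma chen_mult_vars:
  assumes "chen_loc f g"
  shows "chen_vars (chen_mult f g) \<subseteq> chen_vars f \<union> chen_vars g"
  using chen_loc_product_over[OF chen_over_vars chen_over_vars assms[unfolded chen_loc_iff]]
    chen_multI chen_over_iff by (metis imageE)

section \<open>The locality algebra and its derivations\<close>

lemma chen_vars_one: "chen_vars chen_one = {}"
  using chen_vars_Phi[of "[]" "[]"] by (simp add: Phi_Nil)

lemma chen_loc_mono: "chen_loc f g \<Longrightarrow> chen_vars f' \<subseteq> chen_vars f \<Longrightarrow> chen_vars g' \<subseteq> chen_vars g \<Longrightarrow> chen_loc f' g'"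
  unfolding chen_loc_iff by blast

lemma locality_algebra_chen: "locality_algebra chen_loc chen_mult chen_one"
  unfolding locality_algebra_def
proof (intro conjI allI impI)
  show "locality_space chen_loc" by (rule locality_space_chen)
  show "chen_mult (u + v) w = chen_mult u w + chen_mult v w" if "chen_loc u w" "chen_loc v w" for u v w
    using that by (intro chen_multI) (simp add: plus_chen.rep_eq ratfun_of_chen_mult algebra_simps)
  show "chen_mult w (u + v) = chen_mult w u + chen_mult w v" if "chen_loc w u" "chen_loc w v" for u v w
    using that by (intro chen_multI) (simp add: plus_chen.rep_eq ratfun_of_chen_mult algebra_simps)
  show "chen_mult (c *\<^sub>Q u) w = c *\<^sub>Q chen_mult u w" "chen_mult u (c *\<^sub>Q w) = c *\<^sub>Q chen_mult u w"
    if "chen_loc u w" for c u w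
    using that by (intro chen_multI; simp add: scaleQ_chen.rep_eq ratfun_of_chen_mult scaleQ_ratfun)+
  fix u v w assume l: "chen_loc u v" "chen_loc v w" "chen_loc u w"
  show 1: "chen_loc (chen_mult u v) w"
    using chen_mult_vars[OF l(1)] l unfolding chen_loc_iff by blast
  show 2: "chen_loc u (chen_mult v w)"
    using chen_mult_vars[OF l(2)] l unfolding chen_loc_iff by blast
  show "chen_mult (chen_mult u v) w = chen_mult u (chen_mult v w)"
    by (rule chen_multI) (simp add: ratfun_of_chen_mult l 2 mult.assoc)
next
  fix u
  show "chen_loc chen_one u" "chen_loc u chen_one" by (simp_all add: chen_loc_iff chen_vars_one)
  show "chen_mult chen_one u = u" "chen_mult u chen_one = u" by (intro chen_multI; simp add: ratfun_of_one)+
qed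

lemma chen_pd_vars: "chen_vars (chen_pd i f) \<subseteq> chen_vars f"
  using chen_pd_over[OF chen_over_vars] by (simp add: chen_over_iff)

lemma chen_pd_derivation: "locality_derivation chen_loc chen_mult (chen_pd i)"
  unfolding locality_derivation_def
proof (intro conjI allI impI linearQ_chen_pd)
  fix x y assume l: "chen_loc x y"
  show 1: "chen_loc (chen_pd i x) y" and 2: "chen_loc x (chen_pd i y)"
    using chen_pd_vars l chen_loc_mono by blast+
  show "chen_pd i (chen_mult x y) = chen_mult (chen_pd i x) y + chen_mult x (chen_pd i y)"
    by (simp add: ratfun_of_inject[symmetric] ratfun_of_chen_pd plus_chen.rep_eq
        ratfun_of_chen_mult l 1 2 ratfun_pderiv_mult)
qed

lemma chen_mult_degree:
  assumes "f \<in> chen_degree_part m" "g \<in> chen_degree_part n" "chen_loc f g"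
  shows "chen_mult f g \<in> chen_degree_part (m + n)"
proof -
  \<comment> \<open>Restricting each factor to its own variables makes disjointness available for
    every pair of basis terms.\<close>
  have f: "f \<in> chen_span (\<lambda>is ss. sum_list ss = m \<and> set is \<subseteq> chen_vars f)"
    using assms(1) chen_over_vars[of f]
    unfolding chen_degree_part_eq chen_over_def chen_span_inter[symmetric] by simp
  have g: "g \<in> chen_span (\<lambda>is ss. sum_list ss = n \<and> set is \<subseteq> chen_vars g)"
    using assms(2) chen_over_vars[of g]
    unfolding chen_degree_part_eq chen_over_def chen_span_inter[symmetric] by simp
  have "chen_vars f \<inter> chen_vars g = {}" using assms(3) by (simp add: chen_loc_iff)
  then have "ratfun_of f * ratfun_of g \<in> ratfun_of ` chen_span (\<lambda>is ss. sum_list ss = m + n)"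
    by (intro chen_product_span[OF f g]) auto
  then show ?thesis unfolding chen_degree_part_eq using chen_multI by (metis imageE)
qed

text \<open>A linear retraction of the rational functions onto the span of the Chen fractions turns the
  partially defined product into a bilinear map.\<close>

lemma chen_bilinear_product:
  obtains m :: "chen \<Rightarrow> chen \<Rightarrow> chen"
  where "bilinearQ m" "\<And>f g. chen_loc f g \<Longrightarrow> m f g = chen_mult f g"
proof -
  have "inj ratfun_of" by (simp add: inj_on_def ratfun_of_inject)
  then obtain r where r: "linearQ r" "r \<circ> ratfun_of = id"
    using ratvec_pair.linear_injective_left_inverse[OF linearQ_ratfun_of] by auto
  let ?m = "\<lambda>f g. r (ratfun_of f * ratfun_of g)"
  have "bilinearQ ?m"
    by (intro bilinearQI linearQ_comp[OF _ r(1)] linearQ_comp[OF linearQ_ratfun_of]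
        bilinearQ_left[OF bilinearQ_ratfun_times] bilinearQ_right[OF bilinearQ_ratfun_times])
  moreover have "?m f g = chen_mult f g" if "chen_loc f g" for f g
    unfolding ratfun_of_chen_mult[OF that, symmetric] using r(2) by (simp add: pointfree_idE)
  ultimately show ?thesis using that by blast
qed

lemma bilinearQ_comp: "bilinearQ m \<Longrightarrow> linearQ h \<Longrightarrow> bilinearQ (\<lambda>f g. h (m f g))"
  by (rule bilinearQI) (erule linearQ_comp[OF bilinearQ_left] linearQ_comp[OF bilinearQ_right], assumption)+

text \<open>For local arguments every pair of basis terms has disjoint variables, so identities
  involving the product can be checked on disjoint Chen fractions.\<close>

lemma chen_loc_bilinear_eq:
  assumes "chen_loc f g" "linearQ h" "bilinearQ B"
    and "\<And>is ss js ts. chen_index is ss \<Longrightarrow> chen_index js ts \<Longrightarrow> set is \<inter> set js = {} \<Longrightarrow>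
      h (chen_mult (Phi is ss) (Phi js ts)) = B (Phi is ss) (Phi js ts)"
  shows "h (chen_mult f g) = B f g"
proof -
  obtain m :: "chen \<Rightarrow> chen \<Rightarrow> chen" where m: "bilinearQ m" "\<And>f g. chen_loc f g \<Longrightarrow> m f g = chen_mult f g"
    using chen_bilinear_product by blast
  have "h (m f g) = B f g"
    using chen_over_vars[of f] chen_over_vars[of g] unfolding chen_over_def
  proof (rule chen_span_bilinear_eq[OF bilinearQ_comp[OF m(1) assms(2)] assms(3)])
    fix "is" ss js ts
    assume i: "chen_index is ss" "set is \<subseteq> chen_vars f" and j: "chen_index js ts" "set js \<subseteq> chen_vars g"
    have d: "set is \<inter> set js = {}" using assms(1) i j unfolding chen_loc_iff by blast
    then have "chen_loc (Phi is ss) (Phi js ts)" by (simp add: chen_loc_iff chen_vars_Phi i j)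
    then show "h (m (Phi is ss) (Phi js ts)) = B (Phi is ss) (Phi js ts)"
      using assms(4)[OF i(1) j(1) d] m(2) by simp
  qed
  then show ?thesis using m(2)[OF assms(1)] by simp
qed

lemma chen_counit_mult:
  assumes "chen_loc f g"
  shows "chen_counit (chen_mult f g) = chen_counit f * chen_counit g"
proof (rule chen_loc_bilinear_eq[OF assms linearQ_chen_counit])
  show "bilinearQ (\<lambda>f g. chen_counit f * chen_counit g)"
    by (intro bilinearQI linearQI)
      (simp_all add: linearQ_add[OF linearQ_chen_counit] linearQ_scale[OF linearQ_chen_counit] scaleQ_rat_def algebra_simps)
  fix "is" ss js ts assume a: "chen_index is ss" "chen_index js ts" "set is \<inter> set js = {}"
  have l: "chen_loc (Phi is ss) (Phi js ts)" using a by (simp add: chen_loc_iff chen_vars_Phi)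
  show "chen_counit (chen_mult (Phi is ss) (Phi js ts)) = chen_counit (Phi is ss) * chen_counit (Phi js ts)"
  proof (cases "is = [] \<and> js = []")
    case True
    then have [simp]: "ss = []" "ts = []" using a by (simp_all add: chen_index_def)
    have "chen_mult chen_one chen_one = chen_one" by (rule chen_multI) (simp add: ratfun_of_one)
    then show ?thesis using True chen_counit_Phi[of "[]" "[]"] by (simp add: Phi_Nil)
  next
    case False
    \<comment> \<open>The product has positive degree and therefore lies in the kernel of the
      counit.\<close>
    have "chen_mult (Phi is ss) (Phi js ts) \<in> chen_degree_part (sum_list ss + sum_list ts)"
      by (intro chen_mult_degree l) (simp_all add: chen_degree_part_eq Phi_in_chen_span a)
    moreover have "sum_list ss + sum_list ts \<ge> 1"
      using False a by (cases ss; cases ts) (auto simp: chen_index_def)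
    ultimately have "chen_mult (Phi is ss) (Phi js ts) \<in> subspace_sum {1..} chen_degree_part"
      unfolding subspace_sum_def by (intro ratvec.span_base) auto
    then have "chen_counit (chen_mult (Phi is ss) (Phi js ts)) = 0"
      unfolding chen_counit_kernel[symmetric] by simp
    then show ?thesis using False by (auto simp: chen_counit_Phi a)
  qed
qed

section \<open>The coproduct\<close>

lemma linearQ_coderiv: "linearQ d \<Longrightarrow> linearQ (coderiv d)"
  unfolding coderiv_def[abs_def] by (intro linearQ_plus linearQ_tensor_map linearQ_id)

lemma coderiv_pure: "linearQ d \<Longrightarrow> coderiv d (a \<otimes> b) = a \<otimes> d b + d a \<otimes> b"
  by (simp add: coderiv_def tensor_map_pure linearQ_id)

lemma coderiv_commute:
  assumes "linearQ d" "linearQ e" "\<And>a. d (e a) = e (d a)"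
  shows "coderiv d (coderiv e t) = coderiv e (coderiv d t)"
proof (rule tensor_linear_eq[of _ _ t])
  show "linearQ (\<lambda>t. coderiv d (coderiv e t))" "linearQ (\<lambda>t. coderiv e (coderiv d t))"
    by (rule linearQ_comp[OF linearQ_coderiv linearQ_coderiv]; fact)+
  show "coderiv d (coderiv e (a \<otimes> b)) = coderiv e (coderiv d (a \<otimes> b))" for a b
    by (simp add: coderiv_pure assms(1,2) linearQ_add[OF linearQ_coderiv] assms(3))
qed

lemma coderiv_index_diff:
  assumes "\<And>i. linearQ (d i)"
  shows "coderiv (index_diff d is j) t = index_diff (\<lambda>i. coderiv (d i)) is j t"
proof (rule tensor_linear_eq[of _ _ t])
  have l: "linearQ (index_diff d is j)" by (rule linearQ_index_diff) (rule assms)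
  then show "linearQ (coderiv (index_diff d is j))" by (rule linearQ_coderiv)
  show "linearQ (index_diff (\<lambda>i. coderiv (d i)) is j)" by (intro linearQ_index_diff linearQ_coderiv assms)
  show "coderiv (index_diff d is j) (a \<otimes> b) = index_diff (\<lambda>i. coderiv (d i)) is j (a \<otimes> b)" for a b
    unfolding coderiv_pure[OF l]
    by (simp add: index_diff_def coderiv_pure assms linearQ_diff[OF linearQ_pure_left] linearQ_diff[OF linearQ_pure_right])
qed

lemma chen_index_append:
  "chen_index (u @ v) (replicate (length (u @ v)) 1) \<Longrightarrow>
    chen_index u (replicate (length u) 1) \<and> chen_index v (replicate (length v) 1) \<and> set u \<inter> set v = {}"
  by (auto simp: chen_index_def)

lemma cut_sum_zero: "(\<And>u v. u @ v = w \<Longrightarrow> G u v = 0) \<Longrightarrow> cut_sum G w = 0"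
  by (simp add: cut_sum_eq)

text \<open>The pieces of a cut of \<open>is\<close> contain only variables of \<open>is\<close>, so
  foreign derivations kill the prescribed value, as \<open>chen_extend\<close> demands. Intertwining
  with \<open>coderiv\<close> then gives the recursion on exponents.\<close>

lemma chen_coproduct_exists:
  obtains D where "is_chen_coproduct D" "\<And>i f. D (chen_pd i f) = coderiv (chen_pd i) (D f)"
    "\<And>is. chen_index is (replicate (length is) 1) \<Longrightarrow> D (Phi1 is) = cut_sum (\<lambda>u v. Phi1 u \<otimes> Phi1 v) is"
proof -
  have lin: "linearQ (coderiv (chen_pd i))" for i by (intro linearQ_coderiv linearQ_chen_pd)
  have zero: "coderiv (chen_pd i) (cut_sum (\<lambda>u v. Phi1 u \<otimes> Phi1 v) is) = 0"
    if "chen_index is (replicate (length is) 1)" "i \<notin> set is" for "is" i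
    unfolding cut_sum_hom[of "coderiv (chen_pd i)", OF linearQ_add[OF lin]]
  proof (rule cut_sum_zero)
    fix u v assume uv: "u @ v = is"
    have "chen_pd i (Phi1 u) = 0" "chen_pd i (Phi1 v) = 0"
      using that chen_index_append[of u v] uv by (auto intro!: chen_pd_Phi_notin)
    then show "coderiv (chen_pd i) (Phi1 u \<otimes> Phi1 v) = 0"
      by (simp add: coderiv_pure linearQ_chen_pd linearQ_zero[OF linearQ_pure_left] linearQ_zero[OF linearQ_pure_right])
  qed
  have comm: "coderiv (chen_pd i) (coderiv (chen_pd j) t) = coderiv (chen_pd j) (coderiv (chen_pd i) t)" for i j t
    by (rule coderiv_commute[of "chen_pd i" "chen_pd j"]) (rule linearQ_chen_pd chen_pd_commute)+
  obtain D where D: "linearQ D"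
    "\<And>is. chen_index is (replicate (length is) 1) \<Longrightarrow> D (Phi1 is) = cut_sum (\<lambda>u v. Phi1 u \<otimes> Phi1 v) is"
    "\<And>i f. D (chen_pd i f) = coderiv (chen_pd i) (D f)"
    by (rule chen_extend[of "\<lambda>i. coderiv (chen_pd i)" "cut_sum (\<lambda>u v. Phi1 u \<otimes> Phi1 v)", OF lin comm zero]) auto
  have "is_chen_coproduct D"
    unfolding is_chen_coproduct_def
  proof (intro conjI allI impI; (elim conjE)?)
    show "linearQ D" by (rule D(1))
    show "D chen_one = chen_one \<otimes> chen_one" using D(2)[of "[]"] by (simp add: Phi_Nil)
    show "D (Phi1 is) = (\<Sum>j\<le>length is. Phi1 (take j is) \<otimes> Phi1 (drop j is))"
      if "chen_index is (replicate (length is) 1)" for "is"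
      using D(2)[OF that] by (simp add: cut_sum_eq)
    fix "is" ss j assume a: "chen_index is ss" "j < length is"
    show "D (Phi is (ss[j := ss ! j + 1])) = (1 / of_nat (ss ! j)) *\<^sub>Q coderiv (chen_d is j) (D (Phi is ss))"
      unfolding chen_intertwiner_Phi_update[of D "\<lambda>i. coderiv (chen_pd i)", OF D(1,3) a]
        chen_d_eq[abs_def] coderiv_index_diff[OF linearQ_chen_pd] ..
  qed
  then show ?thesis using that D by blast
qed

lemma chen_coproduct_unique:
  assumes "is_chen_coproduct D" "is_chen_coproduct E"
  shows "D = E"
proof
  fix f
  have D: "linearQ D" "D (Phi [] []) = Phi [] [] \<otimes> Phi [] []"
    "\<And>is. is \<noteq> [] \<Longrightarrow> chen_index is (replicate (length is) 1) \<Longrightarrow>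
       D (Phi1 is) = (\<Sum>j\<le>length is. Phi1 (take j is) \<otimes> Phi1 (drop j is))"
    "\<And>is ss j. chen_index is ss \<Longrightarrow> j < length is \<Longrightarrow>
       D (Phi is (ss[j := ss ! j + 1])) = (1 / of_nat (ss ! j)) *\<^sub>Q coderiv (chen_d is j) (D (Phi is ss))"
    using assms(1) unfolding is_chen_coproduct_def Phi_Nil by blast+
  have E: "linearQ E" "E (Phi [] []) = Phi [] [] \<otimes> Phi [] []"
    "\<And>is. is \<noteq> [] \<Longrightarrow> chen_index is (replicate (length is) 1) \<Longrightarrow>
       E (Phi1 is) = (\<Sum>j\<le>length is. Phi1 (take j is) \<otimes> Phi1 (drop j is))"
    "\<And>is ss j. chen_index is ss \<Longrightarrow> j < length is \<Longrightarrow>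
       E (Phi is (ss[j := ss ! j + 1])) = (1 / of_nat (ss ! j)) *\<^sub>Q coderiv (chen_d is j) (E (Phi is ss))"
    using assms(2) unfolding is_chen_coproduct_def Phi_Nil by blast+
  show "D f = E f"
  proof (rule chen_linear_eq[OF D(1) E(1)])
    fix "is" ss assume "chen_index is ss"
    then show "D (Phi is ss) = E (Phi is ss)"
    proof (induction rule: chen_exponent_induct)
      case ones
      then show ?case using D(2,3) E(2,3) by (cases "is = []") simp_all
    next
      case (step ts j)
      then show ?case by (simp only: D(4) E(4))
    qed
  qed
qed

lemma ex1_chen_coproduct: "\<exists>!D. is_chen_coproduct D"
  using chen_coproduct_exists chen_coproduct_unique by metis

lemma is_chen_coproduct_chen_coproduct: "is_chen_coproduct chen_coproduct"
  unfolding chen_coproduct_def by (rule theI'[OF ex1_chen_coproduct])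

lemma linearQ_chen_coproduct: "linearQ chen_coproduct"
  using is_chen_coproduct_chen_coproduct by (simp add: is_chen_coproduct_def)

lemma chen_coproduct_one: "chen_coproduct chen_one = chen_one \<otimes> chen_one"
  using is_chen_coproduct_chen_coproduct by (simp add: is_chen_coproduct_def)

text \<open>The specification prescribes a recursion on exponents; compatibility with each single
  derivation is inherited from the constructed map by uniqueness.\<close>

lemma
  shows chen_coproduct_pd: "chen_coproduct (chen_pd i f) = coderiv (chen_pd i) (chen_coproduct f)"
    and chen_coproduct_Phi1: "chen_index is (replicate (length is) 1) \<Longrightarrow>
      chen_coproduct (Phi1 is) = cut_sum (\<lambda>u v. Phi1 u \<otimes> Phi1 v) is"
proof -
  obtain D where D: "is_chen_coproduct D" "\<And>i f. D (chen_pd i f) = coderiv (chen_pd i) (D f)"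
    "\<And>is. chen_index is (replicate (length is) 1) \<Longrightarrow> D (Phi1 is) = cut_sum (\<lambda>u v. Phi1 u \<otimes> Phi1 v) is"
    by (rule chen_coproduct_exists) auto
  have "chen_coproduct = D"
    by (rule chen_coproduct_unique[OF is_chen_coproduct_chen_coproduct D(1)])
  then show "chen_coproduct (chen_pd i f) = coderiv (chen_pd i) (chen_coproduct f)"
    and "chen_index is (replicate (length is) 1) \<Longrightarrow>
      chen_coproduct (Phi1 is) = cut_sum (\<lambda>u v. Phi1 u \<otimes> Phi1 v) is"
    using D(2,3) by simp_all
qed

text \<open>One invariant for locality and grading together. It is phrased with tensors of basis
  elements, where both conditions can be read off the indices, and \<open>coderiv\<close> preserves
  it up to a shift of degree.\<close>

definition chen_local_tensors :: "nat set \<Rightarrow> nat \<Rightarrow> (chen, chen) tensor set"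
  where "chen_local_tensors A n = ratvec.span {Phi js ts \<otimes> Phi ks us | js ts ks us.
    chen_index js ts \<and> chen_index ks us \<and> set js \<inter> set ks = {} \<and> set js \<union> set ks \<subseteq> A \<and>
    sum_list ts + sum_list us = n}"

lemma subspace_chen_local_tensors: "ratvec.subspace (chen_local_tensors A n)"
  by (simp add: chen_local_tensors_def ratvec.subspace_span)

lemma chen_local_tensorsI:
  "chen_index js ts \<Longrightarrow> chen_index ks us \<Longrightarrow> set js \<inter> set ks = {} \<Longrightarrow> set js \<union> set ks \<subseteq> A \<Longrightarrow>
    sum_list ts + sum_list us = n \<Longrightarrow> Phi js ts \<otimes> Phi ks us \<in> chen_local_tensors A n"
  unfolding chen_local_tensors_def by (rule ratvec.span_base) blast

lemma coderiv_chen_local_tensors: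
  assumes "t \<in> chen_local_tensors A n"
  shows "coderiv (chen_pd i) t \<in> chen_local_tensors A (Suc n)"
  using assms unfolding chen_local_tensors_def[of A n]
proof (rule linearQ_span_induct[OF linearQ_coderiv[OF linearQ_chen_pd] _ subspace_chen_local_tensors])
  fix y assume "y \<in> {Phi js ts \<otimes> Phi ks us | js ts ks us.
    chen_index js ts \<and> chen_index ks us \<and> set js \<inter> set ks = {} \<and> set js \<union> set ks \<subseteq> A \<and>
    sum_list ts + sum_list us = n}"
  then obtain js ts ks us where y: "y = Phi js ts \<otimes> Phi ks us" and j: "chen_index js ts" and k: "chen_index ks us"
    and a: "set js \<inter> set ks = {}" "set js \<union> set ks \<subseteq> A" "sum_list ts + sum_list us = n" by blast
  \<comment> \<open>A derivative leaves the index list alone, so the two tensor factors stay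
    disjoint.\<close>
  have pd: "chen_pd i (Phi is ss) \<in> chen_span (\<lambda>is' ss'. is' = is \<and> sum_list ss' = Suc (sum_list ss))"
    if "chen_index is ss" for "is" ss
  proof (rule chen_pd_span[OF Phi_in_chen_span[of _ _ "\<lambda>is' ss'. is' = is \<and> ss' = ss"]])
    show "chen_index is ss" by (rule that)
    fix is' ss' l assume b: "is' = is \<and> ss' = ss" "l < length is'"
    have "l < length ss" using b chen_index_length[OF that] by simp
    from sum_list_increment[OF this] b(1)
    show "is' = is \<and> sum_list (ss'[l := ss' ! l + 1]) = Suc (sum_list ss)" by blast
  qed simp
  have "Phi js ts \<otimes> chen_pd i (Phi ks us) \<in> chen_local_tensors A (Suc n)"
    by (rule chen_span_linear[OF linearQ_pure_right pd[OF k] subspace_chen_local_tensors],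
        rule chen_local_tensorsI) (use j a in auto)
  moreover have "chen_pd i (Phi js ts) \<otimes> Phi ks us \<in> chen_local_tensors A (Suc n)"
    by (rule chen_span_linear[OF linearQ_pure_left pd[OF j] subspace_chen_local_tensors],
        rule chen_local_tensorsI) (use k a in auto)
  ultimately show "coderiv (chen_pd i) y \<in> chen_local_tensors A (Suc n)"
    unfolding y coderiv_pure[OF linearQ_chen_pd] by (rule ratvec.subspace_add[OF subspace_chen_local_tensors])
qed

text \<open>Deconcatenation distributes distinct indices over the two factors, and each raised
  exponent then adds 1 to the total degree.\<close>

lemma chen_coproduct_Phi_local:
  assumes "chen_index is ss" "set is \<subseteq> A"
  shows "chen_coproduct (Phi is ss) \<in> chen_local_tensors A (sum_list ss)"
  using assms(1)
proof (induction rule: chen_exponent_induct)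
  case ones
  have "Phi1 (take j is) \<otimes> Phi1 (drop j is) \<in> chen_local_tensors A (sum_list (replicate (length is) 1))"
    if "j \<le> length is" for j
  proof -
    have "chen_index (take j is @ drop j is) (replicate (length (take j is @ drop j is)) 1)"
      unfolding append_take_drop_id by (rule ones)
    from chen_index_append[OF this] show ?thesis
      using assms(2) that set_take_subset[of j "is"] set_drop_subset[of j "is"]
      by (intro chen_local_tensorsI) (auto simp: sum_list_replicate)
  qed
  then show ?case
    unfolding chen_coproduct_Phi1[OF ones] cut_sum_eq
    by (intro ratvec.subspace_sum[OF subspace_chen_local_tensors]) simp
next
  case (step ts j)
  have l: "j < length ts" using step chen_index_length by simp
  have "index_diff (\<lambda>i. coderiv (chen_pd i)) is j (chen_coproduct (Phi is ts)) \<in> chen_local_tensors A (Suc (sum_list ts))"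
    using coderiv_chen_local_tensors[OF step(3)]
    by (auto simp: index_diff_def intro: ratvec.subspace_diff[OF subspace_chen_local_tensors])
  then show ?case
    unfolding sum_list_increment[OF l]
      chen_intertwiner_Phi_update[of _ "\<lambda>i. coderiv (chen_pd i)", OF linearQ_chen_coproduct chen_coproduct_pd step(1,2)]
    by (rule ratvec.subspace_scale[OF subspace_chen_local_tensors])
qed

lemma subspace_locality_tensor: "ratvec.subspace (locality_tensor T V W)"
  by (simp add: locality_tensor_def ratvec.subspace_span)

lemma chen_coproduct_locality:
  assumes "u \<in> chen_over A"
  shows "chen_coproduct u \<in> locality_tensor chen_loc (chen_over A) (chen_over A)"
  using assms unfolding chen_over_def[of A]
proof (rule chen_span_linear[OF linearQ_chen_coproduct _ subspace_locality_tensor])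
  fix "is" ss assume a: "chen_index is ss" "set is \<subseteq> A"
  have "chen_local_tensors A (sum_list ss) \<subseteq> locality_tensor chen_loc (chen_over A) (chen_over A)"
    unfolding chen_local_tensors_def
  proof (rule ratvec.span_minimal[OF _ subspace_locality_tensor], rule subsetI)
    fix y assume "y \<in> {Phi js ts \<otimes> Phi ks us | js ts ks us.
      chen_index js ts \<and> chen_index ks us \<and> set js \<inter> set ks = {} \<and> set js \<union> set ks \<subseteq> A \<and>
      sum_list ts + sum_list us = sum_list ss}"
    then obtain js ts ks us where y: "y = Phi js ts \<otimes> Phi ks us" "chen_index js ts" "chen_index ks us"
      "set js \<inter> set ks = {}" "set js \<union> set ks \<subseteq> A" by blast
    have "Phi js ts \<in> chen_over A" "Phi ks us \<in> chen_over A" "chen_loc (Phi js ts) (Phi ks us)"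
      using y by (simp_all add: chen_over_iff chen_loc_iff chen_vars_Phi)
    then show "y \<in> locality_tensor chen_loc (chen_over A) (chen_over A)"
      unfolding y(1) locality_tensor_def by (intro ratvec.span_base) blast
  qed
  then show "chen_coproduct (Phi is ss) \<in> locality_tensor chen_loc
      (chen_span (\<lambda>is ss. set is \<subseteq> A)) (chen_span (\<lambda>is ss. set is \<subseteq> A))"
    using chen_coproduct_Phi_local[OF a] unfolding chen_over_def by blast
qed

lemma chen_coproduct_graded_locality:
  assumes "u \<in> chen_degree_part m" "u \<in> chen_over A"
  shows "chen_coproduct u \<in> subspace_sum {(p, q). p + q = m}
    (\<lambda>(p, q). locality_tensor chen_loc (chen_degree_part p \<inter> chen_over A) (chen_degree_part q \<inter> chen_over A))"
    (is "_ \<in> ?S")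
proof -
  have S: "ratvec.subspace ?S" by (simp add: subspace_sum_def ratvec.subspace_span)
  have u: "u \<in> chen_span (\<lambda>is ss. sum_list ss = m \<and> set is \<subseteq> A)"
    using assms unfolding chen_degree_part_eq chen_over_def chen_span_inter[symmetric] by simp
  show ?thesis
  proof (rule chen_span_linear[OF linearQ_chen_coproduct u S])
    fix "is" ss assume a: "chen_index is ss" "sum_list ss = m \<and> set is \<subseteq> A"
    have "chen_local_tensors A m \<subseteq> ?S"
      unfolding chen_local_tensors_def
    proof (rule ratvec.span_minimal[OF _ S], rule subsetI)
      fix y assume "y \<in> {Phi js ts \<otimes> Phi ks us | js ts ks us.
        chen_index js ts \<and> chen_index ks us \<and> set js \<inter> set ks = {} \<and> set js \<union> set ks \<subseteq> A \<and>
        sum_list ts + sum_list us = m}"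
      then obtain js ts ks us where y: "y = Phi js ts \<otimes> Phi ks us" "chen_index js ts" "chen_index ks us"
        "set js \<inter> set ks = {}" "set js \<union> set ks \<subseteq> A" "sum_list ts + sum_list us = m" by blast
      have "Phi js ts \<in> chen_degree_part (sum_list ts) \<inter> chen_over A"
        "Phi ks us \<in> chen_degree_part (sum_list us) \<inter> chen_over A" "chen_loc (Phi js ts) (Phi ks us)"
        using y by (simp_all add: chen_over_iff chen_loc_iff chen_vars_Phi chen_degree_part_eq Phi_in_chen_span)
      then have "y \<in> locality_tensor chen_loc (chen_degree_part (sum_list ts) \<inter> chen_over A)
          (chen_degree_part (sum_list us) \<inter> chen_over A)"
        unfolding y(1) locality_tensor_def by (intro ratvec.span_base) blast
      then show "y \<in> ?S"
        unfolding subspace_sum_def using y(6)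
        by (intro ratvec.span_base UN_I[of "(sum_list ts, sum_list us)"]) simp_all
    qed
    then show "chen_coproduct (Phi is ss) \<in> ?S"
      using chen_coproduct_Phi_local[of "is" ss A] a by blast
  qed
qed

section \<open>Coassociativity\<close>

lemma bilinearQ_tensor_lift_param:
  assumes "\<And>c. bilinearQ (F c)" "\<And>a b. linearQ (\<lambda>c. F c a b)"
  shows "bilinearQ (\<lambda>t c. tensor_lift (F c) t)"
proof (rule bilinearQI)
  show "linearQ (\<lambda>t. tensor_lift (F c) t)" for c by (rule linearQ_tensor_lift) (rule assms(1))
  fix t
  show "linearQ (\<lambda>c. tensor_lift (F c) t)"
  proof (rule linearQI)
    show "tensor_lift (F (x + y)) t = tensor_lift (F x) t + tensor_lift (F y) t" for x y
    proof (rule tensor_linear_eq[of _ _ t])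
      show "linearQ (tensor_lift (F (x + y)))" "linearQ (\<lambda>t. tensor_lift (F x) t + tensor_lift (F y) t)"
        by (intro linearQ_plus linearQ_tensor_lift assms(1))+
    qed (simp only: tensor_lift_pure[OF assms(1)], rule linearQ_add[OF assms(2)])
    show "tensor_lift (F (k *\<^sub>Q x)) t = k *\<^sub>Q tensor_lift (F x) t" for k x
    proof (rule tensor_linear_eq[of _ _ t])
      show "linearQ (tensor_lift (F (k *\<^sub>Q x)))" by (intro linearQ_tensor_lift assms(1))
      show "linearQ (\<lambda>t. k *\<^sub>Q tensor_lift (F x) t)"
        by (rule linearQ_comp[OF linearQ_tensor_lift[OF assms(1)] linearQ_scaleQ])
    qed (simp only: tensor_lift_pure[OF assms(1)], rule linearQ_scale[OF assms(2)])
  qed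
qed

lemma bilinearQ_tensor_assoc_inner: "bilinearQ (\<lambda>a b. a \<otimes> (b \<otimes> c))"
  by (rule bilinearQ_compose[OF bilinearQ_pure_tensor ratvec.linear_ident linearQ_pure_left])

lemma bilinearQ_tensor_assoc_outer: "bilinearQ (\<lambda>t c. tensor_lift (\<lambda>a b. a \<otimes> (b \<otimes> c)) t)"
  by (rule bilinearQ_tensor_lift_param[OF bilinearQ_tensor_assoc_inner])
    (rule linearQ_comp[OF linearQ_pure_right linearQ_pure_right])

lemma linearQ_tensor_assoc: "linearQ tensor_assoc"
  unfolding tensor_assoc_def by (rule linearQ_tensor_lift[OF bilinearQ_tensor_assoc_outer])

lemma tensor_assoc_pure: "tensor_assoc ((a \<otimes> b) \<otimes> c) = a \<otimes> (b \<otimes> c)"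
  unfolding tensor_assoc_def
  by (simp add: tensor_lift_pure bilinearQ_tensor_assoc_outer bilinearQ_tensor_assoc_inner)

text \<open>Applying \<open>d\<close> to one factor of a triple tensor at a time gives the same
  three terms for either bracketing.\<close>

lemma coderiv_tensor_assoc:
  fixes d :: "'v \<Rightarrow> 'v::rat_vector"
  assumes d: "linearQ d"
  shows "tensor_assoc (s \<otimes> d b) + tensor_assoc (coderiv d s \<otimes> b) =
    tensor_map id (coderiv d) (tensor_assoc (s \<otimes> b)) + tensor_map d id (tensor_assoc (s \<otimes> b))"
proof (rule tensor_linear_eq[of _ _ s])
  note l = linearQ_comp[OF linearQ_pure_left linearQ_tensor_assoc]
  have m: "linearQ (tensor_map id (coderiv d))" "linearQ (tensor_map d id)"
    by (intro linearQ_tensor_map linearQ_id linearQ_coderiv d)+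
  show "linearQ (\<lambda>s. tensor_assoc (s \<otimes> d b) + tensor_assoc (coderiv d s \<otimes> b))"
    by (rule linearQ_plus[OF l linearQ_comp[OF linearQ_coderiv[OF d] l]])
  show "linearQ (\<lambda>s. tensor_map id (coderiv d) (tensor_assoc (s \<otimes> b)) + tensor_map d id (tensor_assoc (s \<otimes> b)))"
    by (rule linearQ_plus[OF linearQ_comp[OF l m(1)] linearQ_comp[OF l m(2)]])
  show "tensor_assoc ((x \<otimes> y) \<otimes> d b) + tensor_assoc (coderiv d (x \<otimes> y) \<otimes> b) =
      tensor_map id (coderiv d) (tensor_assoc ((x \<otimes> y) \<otimes> b)) + tensor_map d id (tensor_assoc ((x \<otimes> y) \<otimes> b))" for x y
    by (simp add: coderiv_pure[OF d] tensor_assoc_pure linearQ_add[OF linearQ_pure_left] linearQ_add[OF linearQ_pure_right]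
        linearQ_add[OF linearQ_tensor_assoc] tensor_map_pure linearQ_id linearQ_coderiv d)
qed

lemma chen_coproduct_coassoc:
  "tensor_assoc (tensor_map chen_coproduct id (chen_coproduct f)) = tensor_map id chen_coproduct (chen_coproduct f)"
proof -
  let ?D = chen_coproduct
  \<comment> \<open>The derivation induced on triple tensors. Both sides of coassociativity
    intertwine \<open>chen_pd i\<close> with it.\<close>
  define \<delta> where "\<delta> i t = tensor_map id (coderiv (chen_pd i)) t + tensor_map (chen_pd i) id t"
    for i and t :: "(chen, (chen, chen) tensor) tensor"
  have lpd: "linearQ (coderiv (chen_pd i))" for i by (intro linearQ_coderiv linearQ_chen_pd)
  have lD: "linearQ (tensor_map ?D id)" "linearQ (tensor_map id ?D)"
    by (intro linearQ_tensor_map linearQ_id linearQ_chen_coproduct)+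
  have l\<delta>: "linearQ (\<delta> i)" for i
    unfolding \<delta>_def by (intro linearQ_plus linearQ_tensor_map linearQ_id lpd linearQ_chen_pd)
  have lA: "linearQ (\<lambda>t. tensor_assoc (tensor_map ?D id t))" by (rule linearQ_comp[OF lD(1) linearQ_tensor_assoc])
  have A: "tensor_assoc (tensor_map ?D id (coderiv (chen_pd i) t)) = \<delta> i (tensor_assoc (tensor_map ?D id t))" for i t
  proof (rule tensor_linear_eq[of _ _ t])
    show "linearQ (\<lambda>t. tensor_assoc (tensor_map ?D id (coderiv (chen_pd i) t)))"
      by (rule linearQ_comp[OF lpd lA])
    show "linearQ (\<lambda>t. \<delta> i (tensor_assoc (tensor_map ?D id t)))"
      by (rule linearQ_comp[OF lA l\<delta>])
    show "tensor_assoc (tensor_map ?D id (coderiv (chen_pd i) (a \<otimes> b))) = \<delta> i (tensor_assoc (tensor_map ?D id (a \<otimes> b)))" for a b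
      by (simp add: coderiv_pure linearQ_chen_pd linearQ_add[OF lD(1)] tensor_map_pure linearQ_chen_coproduct linearQ_id
          linearQ_add[OF linearQ_tensor_assoc] chen_coproduct_pd coderiv_tensor_assoc \<delta>_def)
  qed
  have B: "tensor_map id ?D (coderiv (chen_pd i) t) = \<delta> i (tensor_map id ?D t)" for i t
  proof (rule tensor_linear_eq[of _ _ t])
    show "linearQ (\<lambda>t. tensor_map id ?D (coderiv (chen_pd i) t))"
      by (rule linearQ_comp[OF lpd lD(2)])
    show "linearQ (\<lambda>t. \<delta> i (tensor_map id ?D t))"
      by (rule linearQ_comp[OF lD(2) l\<delta>])
    show "tensor_map id ?D (coderiv (chen_pd i) (a \<otimes> b)) = \<delta> i (tensor_map id ?D (a \<otimes> b))" for a b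
      by (simp add: coderiv_pure linearQ_chen_pd linearQ_add[OF lD(2)] tensor_map_pure linearQ_chen_coproduct linearQ_id
          chen_coproduct_pd \<delta>_def lpd)
  qed
  show ?thesis
  proof (rule chen_intertwiner_eq[where \<delta> = \<delta>])
    show "linearQ (\<lambda>f. tensor_assoc (tensor_map ?D id (?D f)))" by (rule linearQ_comp[OF linearQ_chen_coproduct lA])
    show "linearQ (\<lambda>f. tensor_map id ?D (?D f))" by (rule linearQ_comp[OF linearQ_chen_coproduct lD(2)])
    show "tensor_assoc (tensor_map ?D id (?D (chen_pd i f))) = \<delta> i (tensor_assoc (tensor_map ?D id (?D f)))" for i f
      by (simp add: chen_coproduct_pd A)
    show "tensor_map id ?D (?D (chen_pd i f)) = \<delta> i (tensor_map id ?D (?D f))" for i f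
      by (simp add: chen_coproduct_pd B)
    \<comment> \<open>For exponents 1 both iterated coproducts are the sum over all cuts of
      \<open>is\<close> into three pieces.\<close>
    fix "is" assume i: "chen_index is (replicate (length is) 1)"
    have "tensor_assoc (tensor_map ?D id (?D (Phi1 is))) =
        cut_sum (\<lambda>u v. tensor_assoc (?D (Phi1 u) \<otimes> Phi1 v)) is"
      unfolding chen_coproduct_Phi1[OF i]
      by (subst cut_sum_hom[of "\<lambda>t. tensor_assoc (tensor_map ?D id t)", OF linearQ_add[OF lA]])
        (simp add: tensor_map_pure linearQ_id linearQ_chen_coproduct)
    also have "\<dots> = cut_sum (\<lambda>u v. cut_sum (\<lambda>a b. Phi1 a \<otimes> (Phi1 b \<otimes> Phi1 v)) u) is"
    proof (rule cut_sum_cong)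
      fix u v assume "u @ v = is"
      then have "chen_index u (replicate (length u) 1)" using chen_index_append[of u v] i by simp
      then have "tensor_assoc (?D (Phi1 u) \<otimes> Phi1 v) = tensor_assoc (cut_sum (\<lambda>a b. Phi1 a \<otimes> Phi1 b) u \<otimes> Phi1 v)"
        by (simp only: chen_coproduct_Phi1)
      also have "\<dots> = cut_sum (\<lambda>a b. Phi1 a \<otimes> (Phi1 b \<otimes> Phi1 v)) u"
        by (subst cut_sum_hom[of "\<lambda>t. tensor_assoc (t \<otimes> Phi1 v)", OF linearQ_add[OF linearQ_comp[OF linearQ_pure_left linearQ_tensor_assoc]]])
          (simp add: tensor_assoc_pure)
      finally show "tensor_assoc (?D (Phi1 u) \<otimes> Phi1 v) = cut_sum (\<lambda>a b. Phi1 a \<otimes> (Phi1 b \<otimes> Phi1 v)) u" .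
    qed
    also have "\<dots> = cut_sum (\<lambda>a v. cut_sum (\<lambda>b c. Phi1 a \<otimes> (Phi1 b \<otimes> Phi1 c)) v) is"
      by (rule cut_sum_assoc)
    also have "\<dots> = cut_sum (\<lambda>u v. Phi1 u \<otimes> ?D (Phi1 v)) is"
    proof (rule cut_sum_cong)
      fix u v assume "u @ v = is"
      then have "chen_index v (replicate (length v) 1)" using chen_index_append[of u v] i by simp
      then have "Phi1 u \<otimes> ?D (Phi1 v) = Phi1 u \<otimes> cut_sum (\<lambda>b c. Phi1 b \<otimes> Phi1 c) v"
        by (simp only: chen_coproduct_Phi1)
      then show "cut_sum (\<lambda>b c. Phi1 u \<otimes> (Phi1 b \<otimes> Phi1 c)) v = Phi1 u \<otimes> ?D (Phi1 v)"
        by (simp only: cut_sum_hom[of "\<lambda>t. Phi1 u \<otimes> t", OF linearQ_add[OF linearQ_pure_right]])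
    qed
    also have "\<dots> = tensor_map id ?D (?D (Phi1 is))"
      unfolding chen_coproduct_Phi1[OF i]
      by (subst cut_sum_hom[of "tensor_map id ?D", OF linearQ_add[OF lD(2)]])
        (simp add: tensor_map_pure linearQ_id linearQ_chen_coproduct)
    finally show "tensor_assoc (tensor_map ?D id (?D (Phi1 is))) = tensor_map id ?D (?D (Phi1 is))" .
  qed
qed

section \<open>The counit laws\<close>

lemma chen_counit_pd: "chen_counit (chen_pd i f) = 0"
proof -
  \<comment> \<open>Only lists with a position to increment contribute to a derivative, and they are
    kept, so no constant term appears.\<close>
  have "chen_pd i f \<in> chen_span (\<lambda>is ss. is \<noteq> [])"
    by (rule chen_pd_span[OF chen_span_UNIV]) auto
  then show ?thesis unfolding chen_span_iff chen_counit_coeff using chen_index_Nil by blast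
qed

lemma cut_sum_first: "(\<And>u v. u \<noteq> [] \<Longrightarrow> G u v = 0) \<Longrightarrow> cut_sum G w = G [] w"
  by (cases w) (simp_all add: cut_sum_zero)

lemma cut_sum_last: "(\<And>u v. v \<noteq> [] \<Longrightarrow> G u v = 0) \<Longrightarrow> cut_sum G w = G w []"
  by (induction w arbitrary: G) simp_all

text \<open>Because the counit kills derivatives, of the two terms of \<open>coderiv\<close> only
  the one acting on the second factor remains, so the left side intertwines \<open>chen_pd\<close>.
  For exponents 1 only the cut with empty prefix counts.\<close>

lemma chen_counit_left: "tensor_lift (\<lambda>a b. chen_counit a *\<^sub>Q b) (chen_coproduct f) = f"
proof -
  let ?L = "tensor_lift (\<lambda>a b :: chen. chen_counit a *\<^sub>Q b)"
  have b: "bilinearQ (\<lambda>a b :: chen. chen_counit a *\<^sub>Q b)"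
    by (intro bilinearQI linearQI)
      (simp_all add: linearQ_add[OF linearQ_chen_counit] linearQ_scale[OF linearQ_chen_counit]
        scaleQ_add_left scaleQ_add_right scaleQ_scaleQ scaleQ_rat_def mult.commute)
  have l: "linearQ ?L" by (rule linearQ_tensor_lift[OF b])
  have A: "?L (coderiv (chen_pd i) t) = chen_pd i (?L t)" for i t
  proof (rule tensor_linear_eq[of _ _ t])
    show "linearQ (\<lambda>t. ?L (coderiv (chen_pd i) t))" by (rule linearQ_comp[OF linearQ_coderiv[OF linearQ_chen_pd] l])
    show "linearQ (\<lambda>t. chen_pd i (?L t))" by (rule linearQ_comp[OF l linearQ_chen_pd])
    show "?L (coderiv (chen_pd i) (a \<otimes> b)) = chen_pd i (?L (a \<otimes> b))" for a b
      by (simp add: coderiv_pure linearQ_chen_pd linearQ_add[OF l] tensor_lift_pure[OF b] chen_counit_pd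
          linearQ_scale[OF linearQ_chen_pd])
  qed
  have "?L (chen_coproduct f) = id f"
  proof (rule chen_intertwiner_eq[where \<delta> = chen_pd and T = "\<lambda>f. ?L (chen_coproduct f)" and T' = id])
    show "linearQ (\<lambda>f. ?L (chen_coproduct f))" by (rule linearQ_comp[OF linearQ_chen_coproduct l])
    fix "is" assume i: "chen_index is (replicate (length is) 1)"
    have "?L (chen_coproduct (Phi1 is)) = cut_sum (\<lambda>u v. chen_counit (Phi1 u) *\<^sub>Q Phi1 v) is"
      unfolding chen_coproduct_Phi1[OF i]
      by (subst cut_sum_hom[of ?L, OF linearQ_add[OF l]]) (simp add: tensor_lift_pure[OF b])
    also have "\<dots> = cut_sum (\<lambda>u v. (if u = [] then 1 else 0) *\<^sub>Q Phi1 v) is"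
      using chen_index_append i by (intro cut_sum_cong) (auto simp: chen_counit_Phi)
    also have "\<dots> = Phi1 is" by (subst cut_sum_first) simp_all
    finally show "?L (chen_coproduct (Phi1 is)) = id (Phi1 is)" by simp
  qed (simp_all add: linearQ_id chen_coproduct_pd A)
  then show ?thesis by simp
qed

text \<open>Mirror image of the left law: for exponents 1 only the cut with empty suffix
  counts.\<close>

lemma chen_counit_right: "tensor_lift (\<lambda>a b. chen_counit b *\<^sub>Q a) (chen_coproduct f) = f"
proof -
  let ?L = "tensor_lift (\<lambda>a b. chen_counit b *\<^sub>Q a :: chen)"
  have b: "bilinearQ (\<lambda>a b. chen_counit b *\<^sub>Q a :: chen)"
    by (intro bilinearQI linearQI)
      (simp_all add: linearQ_add[OF linearQ_chen_counit] linearQ_scale[OF linearQ_chen_counit]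
        scaleQ_add_left scaleQ_add_right scaleQ_scaleQ scaleQ_rat_def mult.commute)
  have l: "linearQ ?L" by (rule linearQ_tensor_lift[OF b])
  have A: "?L (coderiv (chen_pd i) t) = chen_pd i (?L t)" for i t
  proof (rule tensor_linear_eq[of _ _ t])
    show "linearQ (\<lambda>t. ?L (coderiv (chen_pd i) t))" by (rule linearQ_comp[OF linearQ_coderiv[OF linearQ_chen_pd] l])
    show "linearQ (\<lambda>t. chen_pd i (?L t))" by (rule linearQ_comp[OF l linearQ_chen_pd])
    show "?L (coderiv (chen_pd i) (a \<otimes> b)) = chen_pd i (?L (a \<otimes> b))" for a b
      by (simp add: coderiv_pure linearQ_chen_pd linearQ_add[OF l] tensor_lift_pure[OF b] chen_counit_pd
          linearQ_scale[OF linearQ_chen_pd])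
  qed
  have "?L (chen_coproduct f) = id f"
  proof (rule chen_intertwiner_eq[where \<delta> = chen_pd and T = "\<lambda>f. ?L (chen_coproduct f)" and T' = id])
    show "linearQ (\<lambda>f. ?L (chen_coproduct f))" by (rule linearQ_comp[OF linearQ_chen_coproduct l])
    fix "is" assume i: "chen_index is (replicate (length is) 1)"
    have "?L (chen_coproduct (Phi1 is)) = cut_sum (\<lambda>u v. chen_counit (Phi1 v) *\<^sub>Q Phi1 u) is"
      unfolding chen_coproduct_Phi1[OF i]
      by (subst cut_sum_hom[of ?L, OF linearQ_add[OF l]]) (simp add: tensor_lift_pure[OF b])
    also have "\<dots> = cut_sum (\<lambda>u v. (if v = [] then 1 else 0) *\<^sub>Q Phi1 u) is"
      using chen_index_append i by (intro cut_sum_cong) (auto simp: chen_counit_Phi)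
    also have "\<dots> = Phi1 is" by (subst cut_sum_last) simp_all
    finally show "?L (chen_coproduct (Phi1 is)) = id (Phi1 is)" by simp
  qed (simp_all add: linearQ_id chen_coproduct_pd A)
  then show ?thesis by simp
qed

lemma locality_coalgebra_chen: "locality_coalgebra chen_loc chen_coproduct chen_counit"
  unfolding locality_coalgebra_def
proof (intro conjI allI)
  show "chen_coproduct ` polar chen_loc U \<subseteq> locality_tensor chen_loc (polar chen_loc U) (polar chen_loc U)" for U
    unfolding polar_chen_loc using chen_coproduct_locality by blast
qed (rule locality_space_chen linearQ_chen_coproduct linearQ_chen_counit chen_coproduct_coassoc
    chen_counit_left chen_counit_right)+

section \<open>Multiplicativity of the coproduct\<close>

lemma bilinearQ_ratfun_tensor_mult: "bilinearQ ratfun_tensor_mult"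
proof -
  have inner: "bilinearQ (\<lambda>c d. (a * c) \<otimes> (b * d))" for a b :: ratfun
    by (rule bilinearQ_compose[OF bilinearQ_pure_tensor bilinearQ_right[OF bilinearQ_ratfun_times]
          bilinearQ_right[OF bilinearQ_ratfun_times]])
  have left: "linearQ (\<lambda>a. (a * c) \<otimes> (b * d))" for b c d :: ratfun
    by (rule linearQ_comp[OF bilinearQ_left[OF bilinearQ_ratfun_times] linearQ_pure_left])
  have right: "linearQ (\<lambda>b. (a * c) \<otimes> (b * d))" for a c d :: ratfun
    by (rule linearQ_comp[OF bilinearQ_left[OF bilinearQ_ratfun_times] linearQ_pure_right])
  have 1: "linearQ (\<lambda>a. tensor_lift (\<lambda>c d. (a * c) \<otimes> (b * d)) t)" for b :: ratfun and t :: "(ratfun, ratfun) tensor"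
    by (rule bilinearQ_right[OF bilinearQ_tensor_lift_param[OF inner left]])
  have 2: "linearQ (\<lambda>b. tensor_lift (\<lambda>c d. (a * c) \<otimes> (b * d)) t)" for a :: ratfun and t :: "(ratfun, ratfun) tensor"
    by (rule bilinearQ_right[OF bilinearQ_tensor_lift_param[OF inner right]])
  have "bilinearQ (\<lambda>(s :: (ratfun, ratfun) tensor) (t :: (ratfun, ratfun) tensor). tensor_lift (\<lambda>a b. tensor_lift (\<lambda>c d. (a * c) \<otimes> (b * d)) t) s)"
    by (intro bilinearQ_tensor_lift_param bilinearQI 1 2 linearQ_tensor_lift[OF inner])
  then show ?thesis by (simp add: ratfun_tensor_mult_def[abs_def])
qed

lemma ratfun_tensor_mult_pure: "ratfun_tensor_mult (a \<otimes> b) (c \<otimes> d) = (a * c) \<otimes> (b * d)"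
proof -
  have inner: "bilinearQ (\<lambda>c d. (a * c) \<otimes> (b * d))" for a b :: ratfun
    by (rule bilinearQ_compose[OF bilinearQ_pure_tensor bilinearQ_right[OF bilinearQ_ratfun_times]
          bilinearQ_right[OF bilinearQ_ratfun_times]])
  have "bilinearQ (\<lambda>a b. (a * c) \<otimes> (b * d))"
    by (rule bilinearQ_compose[OF bilinearQ_pure_tensor bilinearQ_left[OF bilinearQ_ratfun_times]
          bilinearQ_left[OF bilinearQ_ratfun_times]])
  then show ?thesis
    by (simp add: ratfun_tensor_mult_def tensor_lift_pure[OF inner] tensor_lift_pure)
qed

lemma ratfun_tensor_bilinear_eq:
  assumes "bilinearQ f" "bilinearQ g" "\<And>a b c d. f (a \<otimes> b) (c \<otimes> d) = g (a \<otimes> b) (c \<otimes> d)"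
  shows "f s t = g s t"
proof (rule tensor_linear_eq[of "\<lambda>s. f s t" "\<lambda>s. g s t" s])
  show "linearQ (\<lambda>s. f s t)" "linearQ (\<lambda>s. g s t)" by (rule bilinearQ_left, fact)+
  show "f (a \<otimes> b) t = g (a \<otimes> b) t" for a b
    by (rule tensor_linear_eq[of "f (a \<otimes> b)" "g (a \<otimes> b)" t])
      (simp_all add: assms bilinearQ_right)
qed

lemma bilinearQ_flip: "bilinearQ f \<Longrightarrow> bilinearQ (\<lambda>a b. f b a)"
  by (simp add: bilinearQ_def)

lemma bilinearQ_plus: "bilinearQ f \<Longrightarrow> bilinearQ g \<Longrightarrow> bilinearQ (\<lambda>a b. f a b + g a b)"
  by (simp add: bilinearQ_def linearQ_plus)

lemma ratfun_tensor_mult_commute: "ratfun_tensor_mult s t = ratfun_tensor_mult t s"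
  by (rule ratfun_tensor_bilinear_eq[OF bilinearQ_ratfun_tensor_mult bilinearQ_flip[OF bilinearQ_ratfun_tensor_mult]])
    (simp add: ratfun_tensor_mult_pure mult.commute)

lemma linearQ_ratfun_nd: "linearQ (ratfun_nd i)"
  by (rule linearQI) (simp_all add: ratfun_pderiv_add linearQ_scale[OF linearQ_ratfun_pderiv])

text \<open>By bilinearity pure tensors suffice, and there it is the product rule in each of the two
  factors.\<close>

lemma ratfun_tensor_mult_coderiv:
  "coderiv (ratfun_nd i) (ratfun_tensor_mult s t) =
    ratfun_tensor_mult (coderiv (ratfun_nd i) s) t + ratfun_tensor_mult s (coderiv (ratfun_nd i) t)"
proof (rule ratfun_tensor_bilinear_eq[of _ _ s t])
  note M = bilinearQ_ratfun_tensor_mult and l = linearQ_coderiv[OF linearQ_ratfun_nd]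
  show "bilinearQ (\<lambda>s t. coderiv (ratfun_nd i) (ratfun_tensor_mult s t))"
    by (rule bilinearQ_comp[OF M l])
  show "bilinearQ (\<lambda>s t. ratfun_tensor_mult (coderiv (ratfun_nd i) s) t + ratfun_tensor_mult s (coderiv (ratfun_nd i) t))"
    by (rule bilinearQ_plus[OF bilinearQ_compose[OF M l ratvec.linear_ident] bilinearQ_compose[OF M ratvec.linear_ident l]])
  fix a b c d :: ratfun
  have nd: "ratfun_nd i (x * y) = ratfun_nd i x * y + x * ratfun_nd i y" for x y
    by (simp add: ratfun_pderiv_mult)
  show "coderiv (ratfun_nd i) (ratfun_tensor_mult (a \<otimes> b) (c \<otimes> d)) =
      ratfun_tensor_mult (coderiv (ratfun_nd i) (a \<otimes> b)) (c \<otimes> d) + ratfun_tensor_mult (a \<otimes> b) (coderiv (ratfun_nd i) (c \<otimes> d))"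
    unfolding coderiv_pure[OF linearQ_ratfun_nd] ratfun_tensor_mult_pure linearQ_add[OF bilinearQ_left[OF M]]
      linearQ_add[OF bilinearQ_right[OF M]] nd linearQ_add[OF linearQ_pure_left] linearQ_add[OF linearQ_pure_right]
    by (simp only: ac_simps)
qed

lemma linearQ_chen_tensor_embed: "linearQ chen_tensor_embed"
  unfolding chen_tensor_embed_def by (rule linearQ_tensor_map[OF linearQ_ratfun_of linearQ_ratfun_of])

lemma chen_tensor_embed_pure: "chen_tensor_embed (a \<otimes> b) = ratfun_of a \<otimes> ratfun_of b"
  by (simp add: chen_tensor_embed_def tensor_map_pure linearQ_ratfun_of)

lemma chen_tensor_embed_coderiv:
  "chen_tensor_embed (coderiv (chen_pd i) t) = coderiv (ratfun_nd i) (chen_tensor_embed t)"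
proof (rule tensor_linear_eq[of _ _ t])
  note e = linearQ_chen_tensor_embed
  show "linearQ (\<lambda>t. chen_tensor_embed (coderiv (chen_pd i) t))"
    by (rule linearQ_comp[OF linearQ_coderiv[OF linearQ_chen_pd] e])
  show "linearQ (\<lambda>t. coderiv (ratfun_nd i) (chen_tensor_embed t))"
    by (rule linearQ_comp[OF e linearQ_coderiv[OF linearQ_ratfun_nd]])
  show "chen_tensor_embed (coderiv (chen_pd i) (a \<otimes> b)) = coderiv (ratfun_nd i) (chen_tensor_embed (a \<otimes> b))" for a b
    unfolding coderiv_pure[OF linearQ_chen_pd] linearQ_add[OF e] chen_tensor_embed_pure
      coderiv_pure[OF linearQ_ratfun_nd] ratfun_of_chen_pd ..
qed

definition embedded_coproduct :: "chen \<Rightarrow> (ratfun, ratfun) tensor"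
  where "embedded_coproduct f = chen_tensor_embed (chen_coproduct f)"

lemma linearQ_embedded_coproduct: "linearQ embedded_coproduct"
  unfolding embedded_coproduct_def[abs_def] by (rule linearQ_comp[OF linearQ_chen_coproduct linearQ_chen_tensor_embed])

lemma embedded_coproduct_pd: "embedded_coproduct (chen_pd i f) = coderiv (ratfun_nd i) (embedded_coproduct f)"
  by (simp add: embedded_coproduct_def chen_coproduct_pd chen_tensor_embed_coderiv)

abbreviation (input) chen_fraction1 :: "nat list \<Rightarrow> ratfun"
  where "chen_fraction1 w \<equiv> chen_fraction w (replicate (length w) 1)"

lemma embedded_coproduct_Phi1:
  assumes "chen_index w (replicate (length w) 1)"
  shows "embedded_coproduct (Phi1 w) = cut_sum (\<lambda>u v. chen_fraction1 u \<otimes> chen_fraction1 v) w"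
  unfolding embedded_coproduct_def chen_coproduct_Phi1[OF assms]
    cut_sum_hom[of chen_tensor_embed, OF linearQ_add[OF linearQ_chen_tensor_embed]] chen_tensor_embed_pure
proof (rule cut_sum_cong)
  fix u v assume "u @ v = w"
  then show "ratfun_of (Phi1 u) \<otimes> ratfun_of (Phi1 v) = chen_fraction1 u \<otimes> chen_fraction1 v"
    using chen_index_append[of u v] assms by (simp only: ratfun_of_Phi)
qed

lemma chen_index_shuffles:
  assumes "chen_index is (replicate (length is) 1)" "chen_index js (replicate (length js) 1)"
    "set is \<inter> set js = {}" "w \<in> shuffles is js"
  shows "chen_index w (replicate (length w) 1)"
  using assms distinct_disjoint_shuffles[of "is" js w] set_shuffles[OF assms(4)] by (auto simp: chen_index_def)

lemma chen_mult_Phi1: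
  assumes "chen_index is (replicate (length is) 1)" "chen_index js (replicate (length js) 1)" "set is \<inter> set js = {}"
  shows "chen_mult (Phi1 is) (Phi1 js) = shuffle_sum (\<lambda>w. Phi1 w) is js"
proof (rule chen_multI)
  have "ratfun_of (shuffle_sum (\<lambda>w. Phi1 w) is js) = shuffle_sum (\<lambda>w. ratfun_of (Phi1 w)) is js"
    by (rule shuffle_sum_hom) (rule linearQ_add[OF linearQ_ratfun_of])
  also have "\<dots> = shuffle_sum chen_fraction1 is js"
    by (rule shuffle_sum_cong) (rule ratfun_of_Phi[OF chen_index_shuffles[OF assms]])
  finally show "ratfun_of (shuffle_sum (\<lambda>w. Phi1 w) is js) = ratfun_of (Phi1 is) * ratfun_of (Phi1 js)"
    by (simp only: ratfun_of_Phi assms chen_fraction_ones_mult)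
qed

text \<open>Expanding the left side gives cuts of shuffles. \<open>shuffle_sum_cut_sum\<close>
  rearranges them into shuffles of cuts, whose inner sums are products of fractions by
  \<open>chen_fraction_ones_mult\<close>.\<close>

lemma embedded_coproduct_mult_Phi1:
  assumes "chen_index is (replicate (length is) 1)" "chen_index js (replicate (length js) 1)" "set is \<inter> set js = {}"
  shows "embedded_coproduct (chen_mult (Phi1 is) (Phi1 js)) =
    ratfun_tensor_mult (embedded_coproduct (Phi1 is)) (embedded_coproduct (Phi1 js))"
proof -
  let ?F = chen_fraction1 and ?M = ratfun_tensor_mult
  note M = bilinearQ_ratfun_tensor_mult
  have "embedded_coproduct (chen_mult (Phi1 is) (Phi1 js)) = shuffle_sum (\<lambda>w. embedded_coproduct (Phi1 w)) is js"
    unfolding chen_mult_Phi1[OF assms] by (rule shuffle_sum_hom) (rule linearQ_add[OF linearQ_embedded_coproduct])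
  also have "\<dots> = shuffle_sum (cut_sum (\<lambda>u v. ?F u \<otimes> ?F v)) is js"
    by (rule shuffle_sum_cong) (rule embedded_coproduct_Phi1[OF chen_index_shuffles[OF assms]])
  also have "\<dots> = cut_sum (\<lambda>a b. cut_sum (\<lambda>c d. shuffle_sum (\<lambda>u. shuffle_sum (\<lambda>v. ?F u \<otimes> ?F v) b d) a c) js) is"
    by (rule shuffle_sum_cut_sum)
  also have "\<dots> = cut_sum (\<lambda>a b. cut_sum (\<lambda>c d. ?M (?F a \<otimes> ?F b) (?F c \<otimes> ?F d)) js) is"
  proof -
    have "shuffle_sum (\<lambda>u. shuffle_sum (\<lambda>v. ?F u \<otimes> ?F v) b d) a c = ?M (?F a \<otimes> ?F b) (?F c \<otimes> ?F d)" for a b c d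
    proof -
      have "shuffle_sum (\<lambda>v. ?F u \<otimes> ?F v) b d = ?F u \<otimes> shuffle_sum ?F b d" for u
        by (rule shuffle_sum_hom[symmetric]) (rule linearQ_add[OF linearQ_pure_right])
      moreover have "shuffle_sum (\<lambda>u. ?F u \<otimes> shuffle_sum ?F b d) a c = shuffle_sum ?F a c \<otimes> shuffle_sum ?F b d"
        by (rule shuffle_sum_hom[symmetric, of "\<lambda>x. x \<otimes> shuffle_sum ?F b d"]) (rule linearQ_add[OF linearQ_pure_left])
      ultimately show ?thesis by (simp only: ratfun_tensor_mult_pure chen_fraction_ones_mult)
    qed
    then show ?thesis by (simp only:)
  qed
  also have "\<dots> = cut_sum (\<lambda>a b. ?M (?F a \<otimes> ?F b) (cut_sum (\<lambda>c d. ?F c \<otimes> ?F d) js)) is"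
    by (rule cut_sum_cong, rule cut_sum_hom[symmetric, of "?M _"]) (rule linearQ_add[OF bilinearQ_right[OF M]])
  also have "\<dots> = ?M (cut_sum (\<lambda>a b. ?F a \<otimes> ?F b) is) (cut_sum (\<lambda>c d. ?F c \<otimes> ?F d) js)"
    by (rule cut_sum_hom[symmetric, of "\<lambda>s. ?M s (cut_sum (\<lambda>c d. ?F c \<otimes> ?F d) js)"])
      (rule linearQ_add[OF bilinearQ_left[OF M]])
  also have "\<dots> = ?M (embedded_coproduct (Phi1 is)) (embedded_coproduct (Phi1 js))"
    by (simp only: embedded_coproduct_Phi1 assms)
  finally show ?thesis .
qed

lemma chen_mult_Phi_update:
  assumes "chen_index is ss" "chen_index js ts" "set is \<inter> set js = {}" "j < length is"
  shows "chen_mult (Phi is (ss[j := ss ! j + 1])) (Phi js ts) =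
    (1 / of_nat (ss ! j)) *\<^sub>Q index_diff chen_pd is j (chen_mult (Phi is ss) (Phi js ts))"
proof (rule chen_multI)
  have l: "chen_loc (Phi is ss) (Phi js ts)" using assms by (simp add: chen_loc_iff chen_vars_Phi)
  show "ratfun_of ((1 / of_nat (ss ! j)) *\<^sub>Q index_diff chen_pd is j (chen_mult (Phi is ss) (Phi js ts))) =
      ratfun_of (Phi is (ss[j := ss ! j + 1])) * ratfun_of (Phi js ts)"
    unfolding ratfun_of_Phi[OF chen_index_update[OF assms(1,4)]] ratfun_of_Phi[OF assms(2)]
      chen_fraction_update_mult[OF assms] linearQ_scale[OF linearQ_ratfun_of]
      chen_intertwiner_index_diff[of _ ratfun_nd, OF linearQ_ratfun_of ratfun_of_chen_pd]
      ratfun_of_chen_mult[OF l] ratfun_of_Phi[OF assms(1)] ..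
qed

text \<open>Derivations in variables of \<open>is\<close> annihilate the coproduct of the other
  fraction, so in the product of the two coproducts they act on the first one alone, exactly as they
  do for the fractions themselves.\<close>

lemma embedded_coproduct_mult_Phi_update:
  assumes "chen_index is ss" "chen_index js ts" "set is \<inter> set js = {}" "j < length is"
    and "embedded_coproduct (chen_mult (Phi is ss) (Phi js ts)) =
      ratfun_tensor_mult (embedded_coproduct (Phi is ss)) (embedded_coproduct (Phi js ts))"
  shows "embedded_coproduct (chen_mult (Phi is (ss[j := ss ! j + 1])) (Phi js ts)) =
    ratfun_tensor_mult (embedded_coproduct (Phi is (ss[j := ss ! j + 1]))) (embedded_coproduct (Phi js ts))"
proof -
  let ?M = ratfun_tensor_mult and ?\<delta> = "\<lambda>i. coderiv (ratfun_nd i)"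
  note M = bilinearQ_ratfun_tensor_mult
  let ?E = "embedded_coproduct (Phi is ss)" and ?E' = "embedded_coproduct (Phi js ts)"
  have \<delta>: "?\<delta> (is ! l) (?M ?E ?E') = ?M (?\<delta> (is ! l) ?E) ?E'" if "l < length is" for l
  proof -
    have "is ! l \<notin> set js" using nth_mem[OF that] assms(3) by blast
    then have "?\<delta> (is ! l) ?E' = 0"
      unfolding embedded_coproduct_pd[symmetric] chen_pd_Phi_notin[OF assms(2)]
      by (simp add: chen_pd_Phi_notin[OF assms(2)] linearQ_zero[OF linearQ_embedded_coproduct])
    then show ?thesis
      by (simp add: ratfun_tensor_mult_coderiv linearQ_zero[OF bilinearQ_right[OF M]])
  qed
  have "index_diff ?\<delta> is j (?M ?E ?E') = ?M (index_diff ?\<delta> is j ?E) ?E'"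
    using \<delta>[of j] \<delta>[of "j - 1"] assms(4)
    by (cases "j = 0") (simp_all add: index_diff_def linearQ_diff[OF bilinearQ_left[OF M]])
  then show ?thesis
    unfolding chen_mult_Phi_update[OF assms(1-4)]
      chen_intertwiner_Phi_update[of _ ?\<delta>, OF linearQ_embedded_coproduct embedded_coproduct_pd assms(1,4)]
      linearQ_scale[OF linearQ_embedded_coproduct] linearQ_scale[OF bilinearQ_left[OF M]]
      chen_intertwiner_index_diff[of _ ?\<delta>, OF linearQ_embedded_coproduct embedded_coproduct_pd] assms(5)
    by simp
qed

lemma chen_mult_commute: "chen_mult f g = chen_mult g f"
  by (simp add: chen_mult_def mult.commute)

lemma embedded_coproduct_mult:
  assumes "chen_loc f g"
  shows "embedded_coproduct (chen_mult f g) = ratfun_tensor_mult (embedded_coproduct f) (embedded_coproduct g)"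
proof (rule chen_loc_bilinear_eq[OF assms linearQ_embedded_coproduct])
  show "bilinearQ (\<lambda>f g. ratfun_tensor_mult (embedded_coproduct f) (embedded_coproduct g))"
    by (rule bilinearQ_compose[OF bilinearQ_ratfun_tensor_mult linearQ_embedded_coproduct linearQ_embedded_coproduct])
  fix "is" ss js ts assume a: "chen_index is ss" "chen_index js ts" and d: "set is \<inter> set js = {}"
  have d': "set js \<inter> set is = {}" using d by blast
  from a show "embedded_coproduct (chen_mult (Phi is ss) (Phi js ts)) =
      ratfun_tensor_mult (embedded_coproduct (Phi is ss)) (embedded_coproduct (Phi js ts))"
  proof (induction rule: chen_pair_induct)
    case ones
    then show ?case using d by (rule embedded_coproduct_mult_Phi1)
  next
    case (left ss ts j)
    then show ?case by (intro embedded_coproduct_mult_Phi_update d)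
  next
    \<comment> \<open>By commutativity, raising an exponent on the right is the left step with the
      factors exchanged.\<close>
    case (right ss ts j)
    then show ?case
      using embedded_coproduct_mult_Phi_update[OF right(2,1) d' right(3)]
      by (simp only: chen_mult_commute[of "Phi is ss"] ratfun_tensor_mult_commute[of "embedded_coproduct (Phi is ss)"])
  qed
qed


section \<open>The antipode\<close>

text \<open>Applying \<open>coderiv\<close> and then multiplying is the product rule, so a
  convolution of two intertwiners intertwines the derivations. The other side takes constant values,
  and the counit kills derivatives. Hence exponents 1 decide.\<close>

lemma chen_convolution_eq_counit:
  assumes \<phi>: "linearQ \<phi>" "\<And>i f. \<phi> (chen_pd i f) = chen_pd i (\<phi> f)"
    and \<psi>: "linearQ \<psi>" "\<And>i f. \<psi> (chen_pd i f) = chen_pd i (\<psi> f)"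
    and ones: "\<And>is. chen_index is (replicate (length is) 1) \<Longrightarrow>
      cut_sum (\<lambda>u v. ratfun_of (\<phi> (Phi1 u)) * ratfun_of (\<psi> (Phi1 v))) is = (if is = [] then 1 else 0)"
  shows "chen_convolution \<phi> \<psi> a = ratfun_of (chen_counit a *\<^sub>Q chen_one)"
proof -
  define C where "C t = tensor_lift (*) (chen_tensor_embed (tensor_map \<phi> \<psi> t))" for t
  have C: "linearQ C"
    unfolding C_def[abs_def]
    by (rule linearQ_comp[OF linearQ_comp[OF linearQ_tensor_map[OF \<phi>(1) \<psi>(1)] linearQ_chen_tensor_embed]
          linearQ_tensor_lift[OF bilinearQ_ratfun_times]])
  have Cp: "C (x \<otimes> y) = ratfun_of (\<phi> x) * ratfun_of (\<psi> y)" for x y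
    by (simp add: C_def tensor_map_pure \<phi>(1) \<psi>(1) chen_tensor_embed_pure tensor_lift_pure[OF bilinearQ_ratfun_times])
  have Cd: "C (coderiv (chen_pd i) t) = ratfun_nd i (C t)" for i t
  proof (rule tensor_linear_eq[of _ _ t])
    show "linearQ (\<lambda>t. C (coderiv (chen_pd i) t))" by (rule linearQ_comp[OF linearQ_coderiv[OF linearQ_chen_pd] C])
    show "linearQ (\<lambda>t. ratfun_nd i (C t))" by (rule linearQ_comp[OF C linearQ_ratfun_nd])
    show "C (coderiv (chen_pd i) (x \<otimes> y)) = ratfun_nd i (C (x \<otimes> y))" for x y
      by (simp add: coderiv_pure linearQ_chen_pd linearQ_add[OF C] Cp \<phi>(2) \<psi>(2) ratfun_of_chen_pd ratfun_pderiv_mult)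
  qed
  have "C (chen_coproduct a) = ratfun_of (chen_counit a *\<^sub>Q chen_one)"
  proof (rule chen_intertwiner_eq[where \<delta> = ratfun_nd and T = "\<lambda>a. C (chen_coproduct a)"
        and T' = "\<lambda>a. ratfun_of (chen_counit a *\<^sub>Q chen_one)"])
    show "linearQ (\<lambda>a. C (chen_coproduct a))" by (rule linearQ_comp[OF linearQ_chen_coproduct C])
    show "linearQ (\<lambda>a. ratfun_of (chen_counit a *\<^sub>Q chen_one))"
      by (rule linearQI) (simp_all add: linearQ_add[OF linearQ_chen_counit] linearQ_scale[OF linearQ_chen_counit]
          plus_chen.rep_eq scaleQ_chen.rep_eq scaleQ_rat_def scaleQ_add_left)
    show "C (chen_coproduct (chen_pd i f)) = ratfun_nd i (C (chen_coproduct f))" for i f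
      by (simp add: chen_coproduct_pd Cd)
    show "ratfun_of (chen_counit (chen_pd i f) *\<^sub>Q chen_one) = ratfun_nd i (ratfun_of (chen_counit f *\<^sub>Q chen_one))" for i f
      by (simp add: chen_counit_pd scaleQ_chen.rep_eq ratfun_of_one linearQ_scale[OF linearQ_ratfun_pderiv] zero_chen.rep_eq)
    fix "is" assume i: "chen_index is (replicate (length is) 1)"
    have "C (chen_coproduct (Phi1 is)) = (if is = [] then 1 else 0)"
      unfolding chen_coproduct_Phi1[OF i] cut_sum_hom[of C, OF linearQ_add[OF C]] Cp by (rule ones[OF i])
    also have "\<dots> = ratfun_of (chen_counit (Phi1 is) *\<^sub>Q chen_one)"
      unfolding chen_counit_Phi[OF i] by (simp add: scaleQ_chen.rep_eq ratfun_of_one zero_chen.rep_eq)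
    finally show "C (chen_coproduct (Phi1 is)) = ratfun_of (chen_counit (Phi1 is) *\<^sub>Q chen_one)" .
  qed
  then show ?thesis by (simp add: chen_convolution_def C_def)
qed

lemma chen_index_rev: "chen_index is (replicate (length is) 1) \<Longrightarrow> chen_index (rev is) (replicate (length (rev is)) 1)"
  by (auto simp: chen_index_def)

lemma chen_antipode_exists:
  "\<exists>S. linearQ S \<and> (\<forall>a b. chen_loc a b \<longrightarrow> chen_loc a (S b)) \<and>
    (\<forall>a. chen_convolution S id a = ratfun_of (chen_counit a *\<^sub>Q chen_one)) \<and>
    (\<forall>a. chen_convolution id S a = ratfun_of (chen_counit a *\<^sub>Q chen_one))"
proof -
  \<comment> \<open>Signed reversal is the antipode of the shuffle Hopf algebra, whose structure
    governs exponents 1.\<close>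
  let ?\<phi> = "\<lambda>is. ((- 1) ^ length is :: rat) *\<^sub>Q Phi1 (rev is)"
  have zero: "chen_pd i (?\<phi> is) = 0" if "chen_index is (replicate (length is) 1)" "i \<notin> set is" for "is" i
    unfolding linearQ_scale[OF linearQ_chen_pd] using chen_pd_Phi_notin[OF chen_index_rev[OF that(1)], of i] that(2) by simp
  obtain S where S: "linearQ S" "\<And>is. chen_index is (replicate (length is) 1) \<Longrightarrow> S (Phi1 is) = ?\<phi> is"
    "\<And>i f. S (chen_pd i f) = chen_pd i (S f)"
    by (rule chen_extend[of chen_pd ?\<phi>, OF linearQ_chen_pd chen_pd_commute zero]) auto
  \<comment> \<open>Neither reversal nor differentiation introduces variables, and this is all that
    locality of \<open>S\<close> asks for.\<close>
  have over: "S b \<in> chen_over A" if "b \<in> chen_over A" for b A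
    using that unfolding chen_over_def[of A]
  proof (rule chen_span_linear[OF S(1) _ subspace_chen_span])
    fix "is" ss assume i: "chen_index is ss" and A: "set is \<subseteq> A"
    have "S (Phi is ss) \<in> chen_over A"
      using i
    proof (induction rule: chen_exponent_induct)
      case ones
      have "Phi1 (rev is) \<in> chen_over A"
        using A by (simp only: chen_over_iff chen_vars_Phi[OF chen_index_rev[OF ones]] set_rev)
      then show ?case
        unfolding S(2)[OF ones] by (rule ratvec.subspace_scale[OF subspace_chen_over])
    next
      case (step ts j)
      have "index_diff chen_pd is j (S (Phi is ts)) \<in> chen_over A"
        using chen_pd_over[OF step(3)] by (auto simp: index_diff_def intro: ratvec.subspace_diff[OF subspace_chen_over])
      then show ?case
        unfolding chen_intertwiner_Phi_update[of S chen_pd, OF S(1,3) step(1,2)]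
        by (rule ratvec.subspace_scale[OF subspace_chen_over])
    qed
    then show "S (Phi is ss) \<in> chen_span (\<lambda>is ss. set is \<subseteq> A)" by (simp add: chen_over_def)
  qed
  have loc: "chen_loc a (S b)" if "chen_loc a b" for a b
    using that over[OF chen_over_vars[of b]] unfolding chen_loc_iff chen_over_iff by blast
  let ?F = chen_fraction1
  have RS: "ratfun_of (S (Phi1 u)) = (- 1) ^ length u * ?F (rev u)" if "chen_index u (replicate (length u) 1)" for u
    unfolding S(2)[OF that] linearQ_scale[OF linearQ_ratfun_of] ratfun_of_Phi[OF chen_index_rev[OF that]] scaleQ_ratfun
    by (simp add: of_rat_power of_rat_minus)
  \<comment> \<open>Multiplying a reversed prefix by the suffix is a sum over shuffles, so the
    convolution is the telescoping alternating sum.\<close>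
  have conv1: "chen_convolution S id a = ratfun_of (chen_counit a *\<^sub>Q chen_one)" for a
  proof (rule chen_convolution_eq_counit[OF S(1,3) linearQ_id])
    fix "is" assume i: "chen_index is (replicate (length is) 1)"
    have "cut_sum (\<lambda>u v. ratfun_of (S (Phi1 u)) * ratfun_of (id (Phi1 v))) is =
        cut_sum (\<lambda>u v. (- 1) ^ length u * shuffle_sum ?F (rev u) v) is"
    proof (rule cut_sum_cong)
      fix u v assume uv: "u @ v = is"
      have uv': "chen_index u (replicate (length u) 1)" "chen_index v (replicate (length v) 1)"
        using chen_index_append[of u v] i uv by simp_all
      show "ratfun_of (S (Phi1 u)) * ratfun_of (id (Phi1 v)) = (- 1) ^ length u * shuffle_sum ?F (rev u) v"
        unfolding RS[OF uv'(1)] id_apply ratfun_of_Phi[OF uv'(2)] chen_fraction_ones_mult[symmetric] by (rule mult.assoc)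
    qed
    then show "cut_sum (\<lambda>u v. ratfun_of (S (Phi1 u)) * ratfun_of (id (Phi1 v))) is = (if is = [] then 1 else 0)"
      by (simp add: alternating_shuffle_sum)
  qed simp
  have conv2: "chen_convolution id S a = ratfun_of (chen_counit a *\<^sub>Q chen_one)" for a
  proof (rule chen_convolution_eq_counit[OF linearQ_id _ S(1,3)])
    fix "is" assume i: "chen_index is (replicate (length is) 1)"
    \<comment> \<open>The sign of the suffix is that of \<open>is\<close> times that of the prefix.
      Reversing all words then gives the same alternating sum with \<open>?F (rev w)\<close> as
      summand.\<close>
    have "cut_sum (\<lambda>u v. ratfun_of (id (Phi1 u)) * ratfun_of (S (Phi1 v))) is =
        cut_sum (\<lambda>u v. (- 1) ^ length is * ((- 1) ^ length u * shuffle_sum (\<lambda>w. ?F (rev w)) (rev u) v)) is"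
    proof (rule cut_sum_cong)
      fix u v assume uv: "u @ v = is"
      have uv': "chen_index u (replicate (length u) 1)" "chen_index v (replicate (length v) 1)"
        using chen_index_append[of u v] i uv by simp_all
      have "?F u * ?F (rev v) = shuffle_sum ?F (rev (rev u)) (rev v)"
        unfolding chen_fraction_ones_mult rev_rev_ident ..
      then have 1: "?F u * ?F (rev v) = shuffle_sum (\<lambda>w. ?F (rev w)) (rev u) v"
        unfolding shuffle_sum_rev .
      have "(- 1 :: ratfun) ^ length is * (- 1) ^ length u = (- 1) ^ length v"
        unfolding uv[symmetric] length_append by (simp add: power_add flip: power_mult_distrib)
      then show "ratfun_of (id (Phi1 u)) * ratfun_of (S (Phi1 v)) =
          (- 1) ^ length is * ((- 1) ^ length u * shuffle_sum (\<lambda>w. ?F (rev w)) (rev u) v)"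
        unfolding RS[OF uv'(2)] id_apply ratfun_of_Phi[OF uv'(1)] 1[symmetric] mult.assoc[symmetric]
        by (simp only: mult.commute)
    qed
    also have "\<dots> = (- 1) ^ length is * cut_sum (\<lambda>u v. (- 1) ^ length u * shuffle_sum (\<lambda>w. ?F (rev w)) (rev u) v) is"
      by (rule cut_sum_hom[symmetric]) (rule distrib_left)
    also have "\<dots> = (if is = [] then 1 else 0)"
      by (simp add: alternating_shuffle_sum)
    finally show "cut_sum (\<lambda>u v. ratfun_of (id (Phi1 u)) * ratfun_of (S (Phi1 v))) is = (if is = [] then 1 else 0)" .
  qed simp
  show ?thesis using S(1) loc conv1 conv2 by blast
qed

theorem theorem3p8:
  shows "
    ratvec.independent chen_basis \<and>
    (\<exists>!D. is_chen_coproduct D) \<and>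
    (\<forall>f g. chen_loc f g \<longrightarrow> ratfun_of f * ratfun_of g \<in> ratvec.span chen_fractions) \<and>
    (\<forall>i\<ge>1. \<forall>f. - ratfun_pderiv i (ratfun_of f) \<in> ratvec.span chen_fractions) \<and>

    locality_algebra chen_loc chen_mult chen_one \<and>
    locality_coalgebra chen_loc chen_coproduct chen_counit \<and>

    (\<forall>f g. chen_loc f g \<longrightarrow>
       chen_tensor_embed (chen_coproduct (chen_mult f g)) =
         ratfun_tensor_mult (chen_tensor_embed (chen_coproduct f)) (chen_tensor_embed (chen_coproduct g))) \<and>
    (\<forall>f g. chen_loc f g \<longrightarrow> chen_counit (chen_mult f g) = chen_counit f * chen_counit g) \<and>
    chen_coproduct chen_one = chen_one \<otimes> chen_one \<and>
    chen_counit chen_one = 1 \<and>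

    direct_family UNIV chen_degree_part \<and>
    subspace_sum UNIV chen_degree_part = UNIV \<and>
    (\<forall>m n f g. f \<in> chen_degree_part m \<longrightarrow> g \<in> chen_degree_part n \<longrightarrow> chen_loc f g \<longrightarrow>
       chen_mult f g \<in> chen_degree_part (m + n)) \<and>
    (\<forall>m U. direct_family {(p, q). p + q = m}
         (\<lambda>(p, q). locality_tensor chen_loc
            (chen_degree_part p \<inter> polar chen_loc U) (chen_degree_part q \<inter> polar chen_loc U)) \<and>
       chen_coproduct ` (chen_degree_part m \<inter> polar chen_loc U) \<subseteq>
         subspace_sum {(p, q). p + q = m}
           (\<lambda>(p, q). locality_tensor chen_loc
              (chen_degree_part p \<inter> polar chen_loc U) (chen_degree_part q \<inter> polar chen_loc U))) \<and>
    {f. chen_counit f = 0} = subspace_sum {1..} chen_degree_part \<and>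

    (\<exists>S. linearQ S \<and> (\<forall>a b. chen_loc a b \<longrightarrow> chen_loc a (S b)) \<and>
       (\<forall>a. chen_convolution S id a = ratfun_of (chen_counit a *\<^sub>Q chen_one)) \<and>
       (\<forall>a. chen_convolution id S a = ratfun_of (chen_counit a *\<^sub>Q chen_one))) \<and>

    (\<forall>i\<ge>1. locality_derivation chen_loc chen_mult (chen_pd i)) \<and>
    (\<forall>i\<ge>1. \<forall>j\<ge>1. chen_pd i \<circ> chen_pd j = chen_pd j \<circ> chen_pd i) \<and>
    (\<forall>i\<ge>1. \<forall>f. chen_coproduct (chen_pd i f) = coderiv (chen_pd i) (chen_coproduct f)) \<and>
    (\<forall>i\<ge>1. \<forall>a. (\<lambda>f. chen_coproduct (chen_pd i f)) ` polar chen_loc {a} \<subseteq>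
       locality_tensor chen_loc (polar chen_loc {a}) (polar chen_loc {a}))"
proof (intro conjI allI impI)
  fix m U
  show "chen_coproduct ` (chen_degree_part m \<inter> polar chen_loc U) \<subseteq>
      subspace_sum {(p, q). p + q = m}
        (\<lambda>(p, q). locality_tensor chen_loc
          (chen_degree_part p \<inter> polar chen_loc U) (chen_degree_part q \<inter> polar chen_loc U))"
    unfolding polar_chen_loc using chen_coproduct_graded_locality by blast
next
  show "chen_pd i \<circ> chen_pd j = chen_pd j \<circ> chen_pd i" for i j
    by (simp add: fun_eq_iff chen_pd_commute)
next
  \<comment> \<open>A derivative of an element of the polar stays in the polar, so locality of the
    coproduct applies to it.\<close>
  show "(\<lambda>f. chen_coproduct (chen_pd i f)) ` polar chen_loc {a} \<subseteq>
      locality_tensor chen_loc (polar chen_loc {a}) (polar chen_loc {a})" for i a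
    unfolding polar_chen_loc using chen_coproduct_locality chen_pd_over by blast
next
  show "chen_counit chen_one = 1"
    using chen_counit_Phi[of "[]" "[]"] by (simp add: Phi_Nil)
next
  show "chen_tensor_embed (chen_coproduct (chen_mult f g)) =
      ratfun_tensor_mult (chen_tensor_embed (chen_coproduct f)) (chen_tensor_embed (chen_coproduct g))"
    if "chen_loc f g" for f g
    using embedded_coproduct_mult[OF that] by (simp add: embedded_coproduct_def)
qed (simp_all only: chen_basis_independent ex1_chen_coproduct chen_loc_product_in_span uminus_pderiv_in_span
    locality_algebra_chen locality_coalgebra_chen chen_counit_mult chen_coproduct_one chen_degree_direct
    chen_degree_sum chen_mult_degree chen_tensor_degree_direct chen_counit_kernel chen_antipode_exists
    chen_pd_derivation chen_coproduct_pd not_False_eq_True)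

end
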